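(* Let $n,m\ge1$ be integers, let $q_1,\dots,q_n\in(0,1)$ be distinct, let $r_1,\dots,r_m\in(0,1)$ be distinct, and let $a,\sigma,b_1,\dots,b_n,\sigma_1,\dots,\sigma_m\in\mathbb{R}$. Let $(X(t))_{t\ge0}$ be the solution of $$dX(t)=\Big(aX(t)+\sum_{i=1}^n b_iX(q_it)\Big)dt+\Big(\sigma X(t)+\sum_{i=1}^m\sigma_iX(r_it)\Big)dB(t),\quad t\ge0,\qquad X(0)=X_0,$$ with $\mathbb{E}(|X_0|^4)<\infty$. Consider the two estimates $$\text{(A)}\quad \limsup_{t\to\infty}\frac{\log\mathbb{E}[|X(t)|^2]}{\log t}\le\alpha,\qquad\qquad \text{(B)}\quad \limsup_{t\to\infty}\frac{\log|X(t)|}{\log t}\le\frac12(\alpha+1)\ \text{ a.s.}$$ Then the following hold. (i) Suppose $2a+\sigma^2<0$. Then there exists $\alpha\in\mathbb{R}$ such that (A) and (B) hold. Therefore the process is polynomially bounded in mean-square and almost surely polynomially bounded. (ii) Suppose $$2a+2\sum_{i=1}^n|b_i|+\Big(|\sigma|+\sum_{j=1}^m|\sigma_j|\Big)^2<0 .$$ Then there exists $\alpha<0$ such that (A) holds. Therefore the equilibrium solution is polynomially stable in mean-square. (iii) Suppose $$2a+2\sum_{i=1}^n\frac{|b_i|}{\sqrt{q_i}}+\Big(|\sigma|+\sum_{j=1}^m\frac{|\sigma_j|}{\sqrt{r_j}}\Big)^2<0 .$$ Then there exists $\alpha<-1$ such that (A) and (B) hold. Therefore the equilibrium solution is polynomially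 stable in mean-square and a.s. polynomially stable.
   Context: $(B(t))_{t\ge0}$ is a standard one-dimensional Brownian motion, and $X_0$ is a real random variable independent of $B$. The solution $X$ is the pathwise unique strong solution: the continuous process adapted to the (completed) filtration generated by $X_0$ and $B$ satisfying the integrated (Itô) form of the equation; existence and uniqueness may be taken as known. Convention: $\log 0=-\infty$. Definitions. The solution is polynomially bounded in mean-square if there are constants $C>0$, $\alpha_1\in\mathbb{R}$ (independent of $X_0$) with $\mathbb{E}(|X(t)|^2)\le C\,\mathbb{E}(|X_0|^2)(1+t)^{\alpha_1}$ for all $t\ge0$; it is almost surely polynomially bounded if there is a constant $\alpha_2\in\mathbb{R}$ (independent of $X_0$) with $\limsup_{t\to\infty}\log|X(t)|/\log t\le\alpha_2$ a.s. The equilibrium (zero) solution is polynomially stable in mean-square if the first property holds with $\alpha_1<0$, and almost surely polynomially stable if the second holds with $\alpha_2<0$. *)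

theory Defs
  imports "HOL-Probability.Probability"
begin

text \<open>
  Processes are functions of type \<open>real \<Rightarrow> 'w \<Rightarrow> real\<close>; only their values at times \<open>t \<ge> 0\<close> matter.
\<close>

definition brownian_motion :: "'w measure \<Rightarrow> (real \<Rightarrow> 'w \<Rightarrow> real) \<Rightarrow> bool" where
  "brownian_motion M B \<longleftrightarrow>
     (\<forall>t\<ge>0. B t \<in> borel_measurable M) \<and>
     (AE \<omega> in M. B 0 \<omega> = 0) \<and>
     (\<forall>\<omega>\<in>space M. continuous_on {0..} (\<lambda>t. B t \<omega>)) \<and>
     (\<forall>s t. 0 \<le> s \<and> s < t \<longrightarrow>
        distributed M lborel (\<lambda>\<omega>. B t \<omega> - B s \<omega>) (\<lambda>x. ennreal (normal_density 0 (sqrt (t - s)) x))) \<and>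
     (\<forall>(N::nat) \<tau>. 0 \<le> \<tau> 0 \<and> (\<forall>i<N. \<tau> i < \<tau> (Suc i)) \<longrightarrow>
        prob_space.indep_vars M (\<lambda>_. borel) (\<lambda>i \<omega>. B (\<tau> (Suc i)) \<omega> - B (\<tau> i) \<omega>) {..<N})"

definition indep_of_process ::
  "'w measure \<Rightarrow> ('w \<Rightarrow> real) \<Rightarrow> (real \<Rightarrow> 'w \<Rightarrow> real) \<Rightarrow> bool" where
  "indep_of_process M X0 B \<longleftrightarrow>
     X0 \<in> borel_measurable M \<and>
     prob_space.indep_set M
       (sets (vimage_algebra (space M) X0 borel))
       (sigma_sets (space M) (\<Union>t\<in>{0..}. sets (vimage_algebra (space M) (B t) borel)))"

text \<open>
  The completed filtration generated by \<open>X0\<close> and \<open>B\<close>. It is augmented by the null sets that belong to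
  the \<open>\<sigma>\<close>-algebra of \<open>M\<close>, so that every member of the filtration is a sub-\<open>\<sigma>\<close>-algebra of \<open>M\<close>. For complete \<open>M\<close> these
  are all subsets of sets of measure zero.
\<close>

definition gen_filtration ::
  "'w measure \<Rightarrow> ('w \<Rightarrow> real) \<Rightarrow> (real \<Rightarrow> 'w \<Rightarrow> real) \<Rightarrow> real \<Rightarrow> 'w measure" where
  "gen_filtration M X0 B t =
     sigma (space M)
       (sets (vimage_algebra (space M) X0 borel) \<union>
        (\<Union>s\<in>{0..t}. sets (vimage_algebra (space M) (B s) borel)) \<union>
        null_sets M)"

definition tends_to_zero_in_prob :: "'w measure \<Rightarrow> (nat \<Rightarrow> 'w \<Rightarrow> ennreal) \<Rightarrow> bool" where
  "tends_to_zero_in_prob M Y \<longleftrightarrow>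
     (\<forall>\<epsilon>>0. (\<lambda>k. measure M {\<omega> \<in> space M. ennreal \<epsilon> < Y k \<omega>}) \<longlonglongrightarrow> 0)"

text \<open>
  \<open>simple_ito M F B t H J\<close>: \<open>H\<close> is a bounded simple process adapted to the filtration \<open>F\<close>, and \<open>J\<close> is
  its elementary stochastic integral over \<open>[0, t]\<close>.
\<close>

definition simple_ito ::
  "'w measure \<Rightarrow> (real \<Rightarrow> 'w measure) \<Rightarrow> (real \<Rightarrow> 'w \<Rightarrow> real) \<Rightarrow> real \<Rightarrow>
   (real \<Rightarrow> 'w \<Rightarrow> real) \<Rightarrow> ('w \<Rightarrow> real) \<Rightarrow> bool" where
  "simple_ito M F B t H J \<longleftrightarrow>
     (\<exists>(N::nat) \<tau> \<xi>.
        0 \<le> \<tau> 0 \<and> (\<forall>i<N. \<tau> i < \<tau> (Suc i)) \<and>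
        (\<forall>i<N. \<xi> i \<in> borel_measurable (F (\<tau> i)) \<and> (\<exists>c. \<forall>\<omega>\<in>space M. \<bar>\<xi> i \<omega>\<bar> \<le> c)) \<and>
        H = (\<lambda>s \<omega>. \<Sum>i<N. \<xi> i \<omega> * indicator {\<tau> i<..\<tau> (Suc i)} s) \<and>
        J = (\<lambda>\<omega>. \<Sum>i<N. \<xi> i \<omega> * (B (min t (\<tau> (Suc i))) \<omega> - B (min t (\<tau> i)) \<omega>)))"

text \<open>
  \<open>has_ito_integral M F B H t I\<close>: the random variable \<open>I\<close> is (a version of) the Ito integral of \<open>H\<close>
  with respect to \<open>B\<close> over \<open>[0, t]\<close>. This is the usual construction for measurable adapted integrands
  that are almost surely square integrable on \<open>[0, t]\<close>: the limit in probability of elementary integrals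
  of simple processes approximating \<open>H\<close> in \<open>L\<^sup>2[0, t]\<close> in probability.
\<close>

definition has_ito_integral ::
  "'w measure \<Rightarrow> (real \<Rightarrow> 'w measure) \<Rightarrow> (real \<Rightarrow> 'w \<Rightarrow> real) \<Rightarrow>
   (real \<Rightarrow> 'w \<Rightarrow> real) \<Rightarrow> real \<Rightarrow> ('w \<Rightarrow> real) \<Rightarrow> bool" where
  "has_ito_integral M F B H t I \<longleftrightarrow>
     (\<forall>s\<in>{0..t}. H s \<in> borel_measurable (F s)) \<and>
     (\<lambda>(s, \<omega>). H s \<omega>) \<in> borel_measurable (restrict_space borel {0..t} \<Otimes>\<^sub>M M) \<and>
     (AE \<omega> in M. (\<integral>\<^sup>+ s\<in>{0..t}. ennreal ((H s \<omega>)\<^sup>2) \<partial>lborel) < \<infinity>) \<and>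
     I \<in> borel_measurable M \<and>
     (\<exists>H' J'.
        (\<forall>k. simple_ito M F B t (H' k) (J' k)) \<and>
        tends_to_zero_in_prob M (\<lambda>k \<omega>. \<integral>\<^sup>+ s\<in>{0..t}. ennreal ((H' k s \<omega> - H s \<omega>)\<^sup>2) \<partial>lborel) \<and>
        tends_to_zero_in_prob M (\<lambda>k \<omega>. ennreal \<bar>J' k \<omega> - I \<omega>\<bar>))"

definition pantograph_coeff ::
  "real \<Rightarrow> nat \<Rightarrow> (nat \<Rightarrow> real) \<Rightarrow> (nat \<Rightarrow> real) \<Rightarrow> (real \<Rightarrow> 'w \<Rightarrow> real) \<Rightarrow> real \<Rightarrow> 'w \<Rightarrow> real" where
  "pantograph_coeff a n b q X t \<omega> = a * X t \<omega> + (\<Sum>i=1..n. b i * X (q i * t) \<omega>)"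

definition pantograph_solution ::
  "'w measure \<Rightarrow> (real \<Rightarrow> 'w \<Rightarrow> real) \<Rightarrow>
   real \<Rightarrow> nat \<Rightarrow> (nat \<Rightarrow> real) \<Rightarrow> (nat \<Rightarrow> real) \<Rightarrow>
   real \<Rightarrow> nat \<Rightarrow> (nat \<Rightarrow> real) \<Rightarrow> (nat \<Rightarrow> real) \<Rightarrow>
   ('w \<Rightarrow> real) \<Rightarrow> (real \<Rightarrow> 'w \<Rightarrow> real) \<Rightarrow> bool" where
  "pantograph_solution M B a n b q \<sigma> m \<sigma>' r X0 X \<longleftrightarrow>
     (\<forall>t\<ge>0. X t \<in> borel_measurable (gen_filtration M X0 B t)) \<and>
     (\<forall>\<omega>\<in>space M. continuous_on {0..} (\<lambda>t. X t \<omega>)) \<and>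
     (\<forall>t\<ge>0. \<exists>I.
        has_ito_integral M (gen_filtration M X0 B) B (pantograph_coeff \<sigma> m \<sigma>' r X) t I \<and>
        (AE \<omega> in M. X t \<omega> = X0 \<omega> + (LINT s:{0..t}|lborel. pantograph_coeff a n b q X s \<omega>) + I \<omega>))"

text \<open>
  All pairs of an initial value \<open>X0\<close>, independent of \<open>B\<close> and with finite fourth moment, and the solution
  \<open>X\<close> with \<open>X(0) = X0\<close>.
\<close>

definition pantograph_solutions_L4 ::
  "'w measure \<Rightarrow> (real \<Rightarrow> 'w \<Rightarrow> real) \<Rightarrow>
   real \<Rightarrow> nat \<Rightarrow> (nat \<Rightarrow> real) \<Rightarrow> (nat \<Rightarrow> real) \<Rightarrow>
   real \<Rightarrow> nat \<Rightarrow> (nat \<Rightarrow> real) \<Rightarrow> (nat \<Rightarrow> real) \<Rightarrow>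
   (('w \<Rightarrow> real) \<times> (real \<Rightarrow> 'w \<Rightarrow> real)) set" where
  "pantograph_solutions_L4 M B a n b q \<sigma> m \<sigma>' r =
     {(X0, X). indep_of_process M X0 B \<and>
        (\<integral>\<^sup>+ \<omega>. ennreal (\<bar>X0 \<omega>\<bar> ^ 4) \<partial>M) < \<infinity> \<and>
        pantograph_solution M B a n b q \<sigma> m \<sigma>' r X0 X}"

definition elog :: "ennreal \<Rightarrow> ereal" where
  "elog x = (if x = 0 then -\<infinity> else if x = \<infinity> then \<infinity> else ereal (ln (enn2real x)))"

text \<open>
  Expectations of nonnegative variables are taken in \<open>[0, \<infinity>]\<close>, so that a bound on them includes
  integrability.
\<close>

definition ms_growth_le :: "'w measure \<Rightarrow> (real \<Rightarrow> 'w \<Rightarrow> real) \<Rightarrow> real \<Rightarrow> bool" where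
  "ms_growth_le M X \<alpha> \<longleftrightarrow>
     Limsup at_top (\<lambda>t::real. elog (\<integral>\<^sup>+ \<omega>. ennreal (\<bar>X t \<omega>\<bar>\<^sup>2) \<partial>M) / ereal (ln t)) \<le> ereal \<alpha>"

definition as_growth_le :: "'w measure \<Rightarrow> (real \<Rightarrow> 'w \<Rightarrow> real) \<Rightarrow> real \<Rightarrow> bool" where
  "as_growth_le M X \<alpha> \<longleftrightarrow>
     (AE \<omega> in M. Limsup at_top (\<lambda>t::real. elog (ennreal \<bar>X t \<omega>\<bar>) / ereal (ln t)) \<le> ereal \<alpha>)"

text \<open>
  The following notions refer to a class \<open>S\<close> of pairs (initial value, solution); the constants are
  uniform over the class, i.e. independent of the initial value.
\<close>

definition ms_poly_bound ::
  "'w measure \<Rightarrow> (('w \<Rightarrow> real) \<times> (real \<Rightarrow> 'w \<Rightarrow> real)) set \<Rightarrow> real \<Rightarrow> bool" where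
  "ms_poly_bound M S \<alpha> \<longleftrightarrow>
     (\<exists>C>0. \<forall>(X0, X)\<in>S. \<forall>t\<ge>0.
        (\<integral>\<^sup>+ \<omega>. ennreal (\<bar>X t \<omega>\<bar>\<^sup>2) \<partial>M)
          \<le> ennreal C * (\<integral>\<^sup>+ \<omega>. ennreal (\<bar>X0 \<omega>\<bar>\<^sup>2) \<partial>M) * ennreal ((1 + t) powr \<alpha>))"

definition ms_poly_bounded ::
  "'w measure \<Rightarrow> (('w \<Rightarrow> real) \<times> (real \<Rightarrow> 'w \<Rightarrow> real)) set \<Rightarrow> bool" where
  "ms_poly_bounded M S \<longleftrightarrow> (\<exists>\<alpha>. ms_poly_bound M S \<alpha>)"

definition ms_poly_stable ::
  "'w measure \<Rightarrow> (('w \<Rightarrow> real) \<times> (real \<Rightarrow> 'w \<Rightarrow> real)) set \<Rightarrow> bool" where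
  "ms_poly_stable M S \<longleftrightarrow> (\<exists>\<alpha><0. ms_poly_bound M S \<alpha>)"

definition as_poly_bounded ::
  "'w measure \<Rightarrow> (('w \<Rightarrow> real) \<times> (real \<Rightarrow> 'w \<Rightarrow> real)) set \<Rightarrow> bool" where
  "as_poly_bounded M S \<longleftrightarrow> (\<exists>\<alpha>. \<forall>(X0, X)\<in>S. as_growth_le M X \<alpha>)"

definition as_poly_stable ::
  "'w measure \<Rightarrow> (('w \<Rightarrow> real) \<times> (real \<Rightarrow> 'w \<Rightarrow> real)) set \<Rightarrow> bool" where
  "as_poly_stable M S \<longleftrightarrow> (\<exists>\<alpha><0. \<forall>(X0, X)\<in>S. as_growth_le M X \<alpha>)"

end

theory Submission
  imports Defs
begin

text \<open>
  No Ito formula is needed: second moments suffice. Along the grid \<open>i / (k + 1)\<close> the Ito integral of a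
  continuous adapted integrand is the limit in probability of Riemann sums, so martingale orthogonality
  (by weak convergence) and the isometry (as an inequality, by Fatou's lemma) pass to the limit.
  Truncating on the event that \<open>\<bar>X\<bar>\<close> has stayed below \<open>N\<close> yields a finite second moment \<open>E X(t)\<^sup>2 \<le> K\<^sub>T E X\<^sub>0\<^sup>2\<close> with \<open>K\<^sub>T\<close> independent of \<open>X\<^sub>0\<close>.
  Expanding \<open>(X(t) + (X(t + h) - X(t)))\<^sup>2\<close> bounds the upper right Dini derivative of \<open>v(t) = E X(t)\<^sup>2\<close> by
  \<open>2 a v(t) + 2 \<Sum> \<bar>b\<^sub>i\<bar> (v(t) v(q\<^sub>i t))\<^sup>1\<^sup>/\<^sup>2 + (\<bar>\<sigma>\<bar> v(t)\<^sup>1\<^sup>/\<^sup>2 + \<Sum> \<bar>\<sigma>\<^sub>j\<bar> v(r\<^sub>j t)\<^sup>1\<^sup>/\<^sup>2)\<^sup>2\<close>, and a multiple of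
  \<open>(1 + t)\<^sup>\<beta>\<close> is a supersolution for large \<open>t\<close>: with \<open>\<beta>\<close> large and positive in (i), slightly below \<open>0\<close>
  in (ii) and slightly below \<open>-1\<close> in (iii). The almost sure bounds follow from Kolmogorov's maximal
  inequality on the intervals \<open>[n, n + 1]\<close> and the Borel-Cantelli lemma.
\<close>

section \<open>Square-integrable random variables\<close>

text \<open>Delays look only backwards. At the first time s where v would cross \<psi>(t) = C (1 +
  t)^\<beta>, each delayed value is still below \<psi>, so v(q s) / v(s) is at most ((1 + q s) / (1
  + s))^\<beta>. The square roots of these ratios multiply the delayed coefficients and tend to
  q^(\<beta>/2): this is 1 for \<beta> = 0, 1 / sqrt q for \<beta> = -1, and small for large
  \<beta>, which is the origin of the three conditions. The relative slope \<beta> / (1 + t) of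
  \<psi> tends to 0, so a strictly negative total rate beats it for large t.

  The stochastic part is shaped by \<open>has_ito_integral\<close>: it gives convergence in
  probability along simple processes whose moments are unknown, so expectations do not pass to that
  limit. Truncated Riemann sums of the continuous integrand have the same limit, and their moments
  are controlled by those of the integrand.

  The exponent (\<alpha> + 1)/2 comes from Borel-Cantelli: Chebyshev at level n^((\<alpha> + 1)/2)
  costs a multiple of n^(\<beta> - \<alpha> - 1) on the window starting at n, which is summable when
  \<beta> < \<alpha>.\<close>

definition L2 :: "'w measure \<Rightarrow> ('w \<Rightarrow> real) \<Rightarrow> bool" where
  "L2 M f \<longleftrightarrow> f \<in> borel_measurable M \<and> integrable M (\<lambda>\<omega>. (f \<omega>)\<^sup>2)"

definition l2norm :: "'w measure \<Rightarrow> ('w \<Rightarrow> real) \<Rightarrow> real" where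
  "l2norm M f = sqrt (\<integral>\<omega>. (f \<omega>)\<^sup>2 \<partial>M)"

lemma L2_measurable[measurable_dest]: "L2 M f \<Longrightarrow> f \<in> borel_measurable M"
  by (simp add: L2_def)

lemma L2_integrable: "L2 M f \<Longrightarrow> integrable M (\<lambda>\<omega>. (f \<omega>)\<^sup>2)"
  by (simp add: L2_def)

lemma l2norm_nonneg[simp]: "0 \<le> l2norm M f"
  by (simp add: l2norm_def)

lemma l2norm_sq: "(l2norm M f)\<^sup>2 = (\<integral>\<omega>. (f \<omega>)\<^sup>2 \<partial>M)"
  by (simp add: l2norm_def)

lemma L2_mult_integrable:
  assumes "L2 M f" "L2 M g"
  shows "integrable M (\<lambda>\<omega>. f \<omega> * g \<omega>)"
proof (rule Bochner_Integration.integrable_bound)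
  show "integrable M (\<lambda>\<omega>. (f \<omega>)\<^sup>2 + (g \<omega>)\<^sup>2)"
    using assms by (auto simp: L2_def)
  show "(\<lambda>\<omega>. f \<omega> * g \<omega>) \<in> borel_measurable M" using assms by (auto simp: L2_def)
  have "\<bar>x * y\<bar> \<le> x\<^sup>2 + y\<^sup>2" for x y :: real
  proof -
    have "0 \<le> (\<bar>x\<bar> - \<bar>y\<bar>)\<^sup>2" by simp
    then have "2 * \<bar>x * y\<bar> \<le> x\<^sup>2 + y\<^sup>2" by (simp add: power2_diff abs_mult)
    then show ?thesis using abs_ge_zero[of "x * y"] by linarith
  qed
  then show "AE \<omega> in M. norm (f \<omega> * g \<omega>) \<le> norm ((f \<omega>)\<^sup>2 + (g \<omega>)\<^sup>2)"
    by auto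
qed

lemma L2_cmult: "L2 M f \<Longrightarrow> L2 M (\<lambda>\<omega>. c * f \<omega>)"
  by (auto simp: L2_def power_mult_distrib)

lemma L2_zero[simp]: "L2 M (\<lambda>\<omega>. 0)"
  by (simp add: L2_def)

lemma L2_add:
  assumes "L2 M f" "L2 M g"
  shows "L2 M (\<lambda>\<omega>. f \<omega> + g \<omega>)"
  using assms L2_mult_integrable[OF assms]
  by (auto simp: L2_def power2_sum mult.assoc)

lemma L2_diff:
  assumes "L2 M f" "L2 M g"
  shows "L2 M (\<lambda>\<omega>. f \<omega> - g \<omega>)"
  using L2_add[OF assms(1) L2_cmult[OF assms(2), of "-1"]] by simp

lemma L2_sum:
  assumes "\<And>i. i \<in> I \<Longrightarrow> L2 M (f i)"
  shows "L2 M (\<lambda>\<omega>. \<Sum>i\<in>I. f i \<omega>)"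
  using assms by (induction I rule: infinite_finite_induct) (auto intro: L2_add)

lemma L2_cong_AE:
  assumes "L2 M f" "AE \<omega> in M. f \<omega> = g \<omega>" "g \<in> borel_measurable M"
  shows "L2 M g"
  unfolding L2_def
proof
  have "integrable M (\<lambda>\<omega>. (f \<omega>)\<^sup>2) \<longleftrightarrow> integrable M (\<lambda>\<omega>. (g \<omega>)\<^sup>2)"
    using assms by (intro integrable_cong_AE) (auto simp: L2_def)
  then show "integrable M (\<lambda>\<omega>. (g \<omega>)\<^sup>2)" using assms by (simp add: L2_def)
qed (use assms in auto)

lemma L2_dominated:
  assumes "L2 M g" "f \<in> borel_measurable M" "\<And>\<omega>. \<omega> \<in> space M \<Longrightarrow> \<bar>f \<omega>\<bar> \<le> \<bar>g \<omega>\<bar>"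
  shows "L2 M f"
  unfolding L2_def
proof
  show "integrable M (\<lambda>\<omega>. (f \<omega>)\<^sup>2)"
    by (rule Bochner_Integration.integrable_bound[OF L2_integrable[OF assms(1)]])
      (use assms in \<open>auto intro!: AE_I2 simp: abs_le_square_iff\<close>)
qed (use assms in auto)

lemma L2_bounded:
  assumes "finite_measure M" "f \<in> borel_measurable M" "\<And>\<omega>. \<omega> \<in> space M \<Longrightarrow> \<bar>f \<omega>\<bar> \<le> c"
  shows "L2 M f"
proof (rule L2_dominated[of _ "\<lambda>_. c"])
  show "L2 M (\<lambda>_. c)" using finite_measure.integrable_const[OF assms(1)] by (simp add: L2_def)
  show "\<And>\<omega>. \<omega> \<in> space M \<Longrightarrow> \<bar>f \<omega>\<bar> \<le> \<bar>c\<bar>" using assms(3) by fastforce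
qed fact

lemma l2norm_cmult: "l2norm M (\<lambda>\<omega>. c * f \<omega>) = \<bar>c\<bar> * l2norm M f"
  by (simp add: l2norm_def power_mult_distrib real_sqrt_mult)

lemma L2_cauchy_schwarz:
  assumes "L2 M f" "L2 M g"
  shows "\<bar>\<integral>\<omega>. f \<omega> * g \<omega> \<partial>M\<bar> \<le> l2norm M f * l2norm M g"
proof -
  define A where "A = (\<integral>\<omega>. (f \<omega>)\<^sup>2 \<partial>M)"
  define B where "B = (\<integral>\<omega>. (g \<omega>)\<^sup>2 \<partial>M)"
  define C where "C = (\<integral>\<omega>. f \<omega> * g \<omega> \<partial>M)"
  have nn: "A \<ge> 0" "B \<ge> 0" by (auto simp: A_def B_def)
  have quad: "0 \<le> x\<^sup>2 * A + 2 * x * y * C + y\<^sup>2 * B" for x y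
  proof -
    have "0 \<le> (\<integral>\<omega>. (x * f \<omega> + y * g \<omega>)\<^sup>2 \<partial>M)" by simp
    also have "\<dots> = (\<integral>\<omega>. x\<^sup>2 * (f \<omega>)\<^sup>2 + (2 * x * y * (f \<omega> * g \<omega>) + y\<^sup>2 * (g \<omega>)\<^sup>2) \<partial>M)"
      by (intro Bochner_Integration.integral_cong) (auto simp: power2_eq_square algebra_simps)
    also have "\<dots> = x\<^sup>2 * A + (2 * x * y * C + y\<^sup>2 * B)"
      using L2_integrable[OF assms(1)] L2_integrable[OF assms(2)] L2_mult_integrable[OF assms]
      by (simp add: A_def B_def C_def)
    finally show ?thesis by simp
  qed
  have "C\<^sup>2 \<le> A * B"
  proof (cases "B = 0")
    case True
    have "C = 0"
    proof (rule ccontr)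
      assume "C \<noteq> 0"
      \<comment> \<open>This value of \<open>y\<close> turns the form into
        \<open>A - (A + 1) = - 1\<close>, which contradicts its nonnegativity.\<close>
      have "0 \<le> 1 * A + 2 * 1 * (- (A + 1) / (2 * C)) * C"
        using quad[of 1 "- (A + 1) / (2 * C)"] True by simp
      with \<open>C \<noteq> 0\<close> show False by (simp add: field_simps)
    qed
    then show ?thesis using True by simp
  next
    case False
    \<comment> \<open>With \<open>x = B\<close> and \<open>y = - C\<close> the form becomes
      \<open>B\<close> times the wanted difference, so no quotient has to be formed.\<close>
    then have "B > 0" using nn by simp
    have "0 \<le> B\<^sup>2 * A + 2 * B * (- C) * C + (- C)\<^sup>2 * B" by (rule quad)
    also have "\<dots> = B * (A * B - C\<^sup>2)" by (simp add: power2_eq_square algebra_simps)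
    finally show ?thesis using \<open>B > 0\<close> by (simp add: zero_le_mult_iff)
  qed
  then have "sqrt (C\<^sup>2) \<le> sqrt (A * B)" by (rule real_sqrt_le_mono)
  then show ?thesis by (simp add: l2norm_def A_def B_def C_def real_sqrt_mult del: real_sqrt_le_iff)
qed

lemma l2norm_triangle:
  assumes "L2 M f" "L2 M g"
  shows "l2norm M (\<lambda>\<omega>. f \<omega> + g \<omega>) \<le> l2norm M f + l2norm M g"
proof (rule power2_le_imp_le)
  have "(l2norm M (\<lambda>\<omega>. f \<omega> + g \<omega>))\<^sup>2 = (\<integral>\<omega>. (f \<omega>)\<^sup>2 + ((g \<omega>)\<^sup>2 + 2 * (f \<omega> * g \<omega>)) \<partial>M)"
    by (simp add: l2norm_sq power2_sum mult.assoc add.assoc)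
  also have "\<dots> = (l2norm M f)\<^sup>2 + ((l2norm M g)\<^sup>2 + 2 * (\<integral>\<omega>. f \<omega> * g \<omega> \<partial>M))"
    using L2_integrable[OF assms(1)] L2_integrable[OF assms(2)] L2_mult_integrable[OF assms]
    by (simp add: l2norm_sq)
  also have "\<dots> \<le> (l2norm M f + l2norm M g)\<^sup>2"
    using L2_cauchy_schwarz[OF assms] by (simp add: power2_sum)
  finally show "(l2norm M (\<lambda>\<omega>. f \<omega> + g \<omega>))\<^sup>2 \<le> (l2norm M f + l2norm M g)\<^sup>2" .
qed simp

lemma l2norm_diff_triangle:
  assumes "L2 M f" "L2 M g"
  shows "l2norm M f \<le> l2norm M g + l2norm M (\<lambda>\<omega>. f \<omega> - g \<omega>)"
  using l2norm_triangle[OF assms(2) L2_diff[OF assms]] by simp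

lemma l2norm_sum_le:
  assumes "\<And>i. i \<in> I \<Longrightarrow> L2 M (f i)"
  shows "l2norm M (\<lambda>\<omega>. \<Sum>i\<in>I. f i \<omega>) \<le> (\<Sum>i\<in>I. l2norm M (f i))"
  using assms
proof (induction I rule: infinite_finite_induct)
  case (insert x F)
  have "l2norm M (\<lambda>\<omega>. f x \<omega> + (\<Sum>i\<in>F. f i \<omega>)) \<le> l2norm M (f x) + l2norm M (\<lambda>\<omega>. \<Sum>i\<in>F. f i \<omega>)"
    using insert by (intro l2norm_triangle L2_sum) auto
  then show ?case using insert by fastforce
qed (simp_all add: l2norm_def)

lemma l2norm_cong_AE:
  assumes "AE \<omega> in M. f \<omega> = g \<omega>" "f \<in> borel_measurable M" "g \<in> borel_measurable M"
  shows "l2norm M f = l2norm M g"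
  unfolding l2norm_def
  by (intro arg_cong[where f = sqrt] integral_cong_AE) (use assms in auto)

lemma L2_iff_nn_integral:
  assumes "f \<in> borel_measurable M"
  shows "L2 M f \<longleftrightarrow> (\<integral>\<^sup>+\<omega>. ennreal ((f \<omega>)\<^sup>2) \<partial>M) < \<infinity>"
  using assms unfolding L2_def by (simp add: integrable_iff_bounded)

lemma L2_nn_integral:
  assumes "L2 M f"
  shows "(\<integral>\<^sup>+\<omega>. ennreal ((f \<omega>)\<^sup>2) \<partial>M) = ennreal (\<integral>\<omega>. (f \<omega>)\<^sup>2 \<partial>M)"
  using assms by (intro nn_integral_eq_integral) (auto simp: L2_def)

lemma L2_nn_integral_le:
  assumes "f \<in> borel_measurable M" "(\<integral>\<^sup>+\<omega>. ennreal ((f \<omega>)\<^sup>2) \<partial>M) \<le> ennreal c" "c \<ge> 0"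
  shows "L2 M f" "(\<integral>\<omega>. (f \<omega>)\<^sup>2 \<partial>M) \<le> c"
proof -
  show "L2 M f"
    using assms by (subst L2_iff_nn_integral) (auto intro: le_less_trans)
  from L2_nn_integral[OF this] assms show "(\<integral>\<omega>. (f \<omega>)\<^sup>2 \<partial>M) \<le> c"
    by simp
qed

text \<open>Equality of second moments may be lost under almost sure convergence; Fatou keeps the
  inequality, which is all that is used. The bound is asked only eventually because Riemann sums
  meet it only on fine grids.\<close>

lemma L2_fatou:
  assumes "\<And>k. L2 M (R k)" "eventually (\<lambda>k. (\<integral>\<omega>. (R k \<omega>)\<^sup>2 \<partial>M) \<le> C) sequentially"
    and "AE \<omega> in M. (\<lambda>k. R k \<omega>) \<longlonglongrightarrow> Y \<omega>" and [measurable]: "Y \<in> borel_measurable M"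
  shows "L2 M Y" "(\<integral>\<omega>. (Y \<omega>)\<^sup>2 \<partial>M) \<le> C"
proof -
  note assms(1)[measurable]
  obtain k0 where k0: "\<And>k. k \<ge> k0 \<Longrightarrow> (\<integral>\<omega>. (R k \<omega>)\<^sup>2 \<partial>M) \<le> C"
    using assms(2) by (auto simp: eventually_sequentially)
  have "0 \<le> (\<integral>\<omega>. (R k0 \<omega>)\<^sup>2 \<partial>M)" by simp
  then have C: "C \<ge> 0" using k0[of k0] by linarith
  have "(\<integral>\<^sup>+\<omega>. ennreal ((Y \<omega>)\<^sup>2) \<partial>M) \<le> (\<integral>\<^sup>+\<omega>. liminf (\<lambda>k. ennreal ((R k \<omega>)\<^sup>2)) \<partial>M)"
    using assms(3)
  proof (intro nn_integral_mono_AE, eventually_elim)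
    fix \<omega> assume "(\<lambda>k. R k \<omega>) \<longlonglongrightarrow> Y \<omega>"
    then have "(\<lambda>k. ennreal ((R k \<omega>)\<^sup>2)) \<longlonglongrightarrow> ennreal ((Y \<omega>)\<^sup>2)"
      by (intro tendsto_ennrealI tendsto_power)
    then show "ennreal ((Y \<omega>)\<^sup>2) \<le> liminf (\<lambda>k. ennreal ((R k \<omega>)\<^sup>2))"
      using lim_imp_Liminf[OF sequentially_bot] by (metis order_refl)
  qed
  also have "\<dots> \<le> liminf (\<lambda>k. \<integral>\<^sup>+\<omega>. ennreal ((R k \<omega>)\<^sup>2) \<partial>M)"
    by (rule nn_integral_liminf) simp
  also have "\<dots> \<le> limsup (\<lambda>k. \<integral>\<^sup>+\<omega>. ennreal ((R k \<omega>)\<^sup>2) \<partial>M)"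
    by (rule Liminf_le_Limsup) simp
  also have "\<dots> \<le> ennreal C"
    by (rule Limsup_bounded)
      (use assms(2) in \<open>auto elim!: eventually_mono simp: L2_nn_integral[OF assms(1)] C\<close>)
  finally show "L2 M Y" "(\<integral>\<omega>. (Y \<omega>)\<^sup>2 \<partial>M) \<le> C"
    using L2_nn_integral_le[OF _ _ C, of Y M] by auto
qed

text \<open>
  Weak convergence in \<open>L\<^sup>2\<close>: with \<open>d = \<bar>R k - Y\<bar>\<close>, the part of \<open>d \<bar>W\<bar>\<close> exceeding \<open>\<eta> d\<^sup>2\<close> is dominated by
  \<open>W\<^sup>2 / (4 \<eta>)\<close>.
\<close>

lemma L2_weak_limit:
  assumes R: "\<And>k. L2 M (R k)" "eventually (\<lambda>k. (\<integral>\<omega>. (R k \<omega>)\<^sup>2 \<partial>M) \<le> C) sequentially"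
    and lim: "AE \<omega> in M. (\<lambda>k. R k \<omega>) \<longlonglongrightarrow> Y \<omega>" and [measurable]: "Y \<in> borel_measurable M"
    and W: "L2 M W"
    and orth: "\<And>k. (\<integral>\<omega>. R k \<omega> * W \<omega> \<partial>M) = 0"
  shows "(\<integral>\<omega>. Y \<omega> * W \<omega> \<partial>M) = 0"
proof -
  note R(1)[measurable] W[measurable]
  have Y: "L2 M Y" "(\<integral>\<omega>. (Y \<omega>)\<^sup>2 \<partial>M) \<le> C"
    using L2_fatou[OF R lim] by auto
  define d where "d k \<omega> = \<bar>R k \<omega> - Y \<omega>\<bar>" for k \<omega>
  have dL: "L2 M (d k)" for k
    unfolding d_def by (rule L2_dominated[OF L2_diff[OF R(1)[of k] Y(1)]]) auto
  have d2: "eventually (\<lambda>k. (\<integral>\<omega>. (d k \<omega>)\<^sup>2 \<partial>M) \<le> 4 * C) sequentially"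
    using R(2)
  proof eventually_elim
    case (elim k)
    have "(\<integral>\<omega>. (d k \<omega>)\<^sup>2 \<partial>M) \<le> (\<integral>\<omega>. 2 * (R k \<omega>)\<^sup>2 + 2 * (Y \<omega>)\<^sup>2 \<partial>M)"
    proof (rule integral_mono)
      fix \<omega>
      have "0 \<le> (R k \<omega> + Y \<omega>)\<^sup>2" by simp
      then show "(d k \<omega>)\<^sup>2 \<le> 2 * (R k \<omega>)\<^sup>2 + 2 * (Y \<omega>)\<^sup>2"
        by (simp add: d_def power2_diff power2_sum)
    qed (use dL R(1) Y in \<open>auto simp: L2_def\<close>)
    also have "\<dots> = 2 * (\<integral>\<omega>. (R k \<omega>)\<^sup>2 \<partial>M) + 2 * (\<integral>\<omega>. (Y \<omega>)\<^sup>2 \<partial>M)"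
      using R(1) Y by (simp add: L2_def)
    finally show ?case using elim Y by simp
  qed
  define Q where "Q = \<bar>\<integral>\<omega>. Y \<omega> * W \<omega> \<partial>M\<bar>"
  have bound: "Q \<le> \<eta> * (4 * C)" if "\<eta> > 0" for \<eta>
  proof -
    define g where "g k \<omega> = max 0 (d k \<omega> * \<bar>W \<omega>\<bar> - \<eta> * (d k \<omega>)\<^sup>2)" for k \<omega>
    have [measurable]: "g k \<in> borel_measurable M" for k
      unfolding g_def d_def by measurable
    have gle: "g k \<omega> \<le> (W \<omega>)\<^sup>2 / (4 * \<eta>)" for k \<omega>
    proof -
      have "0 \<le> (2 * \<eta> * d k \<omega> - \<bar>W \<omega>\<bar>)\<^sup>2" by simp
      then have "4 * \<eta> * (d k \<omega> * \<bar>W \<omega>\<bar> - \<eta> * (d k \<omega>)\<^sup>2) \<le> (W \<omega>)\<^sup>2"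
        by (simp add: power2_diff power_mult_distrib algebra_simps power2_eq_square)
      then have "d k \<omega> * \<bar>W \<omega>\<bar> - \<eta> * (d k \<omega>)\<^sup>2 \<le> (W \<omega>)\<^sup>2 / (4 * \<eta>)"
        using that by (simp add: field_simps)
      then show ?thesis using that by (simp add: g_def)
    qed
    have intW: "integrable M (\<lambda>\<omega>. (W \<omega>)\<^sup>2 / (4 * \<eta>))"
      using W by (auto simp: L2_def)
    have gint: "integrable M (g k)" for k
      by (rule Bochner_Integration.integrable_bound[OF intW])
        (use gle[of k] that in \<open>auto simp: g_def intro!: AE_I2\<close>)
    have "(\<lambda>k. \<integral>\<omega>. g k \<omega> \<partial>M) \<longlonglongrightarrow> (\<integral>\<omega>. 0 \<partial>M)"
    proof (rule integral_dominated_convergence[where w = "\<lambda>\<omega>. (W \<omega>)\<^sup>2 / (4 * \<eta>)"])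
      show "AE \<omega> in M. (\<lambda>k. g k \<omega>) \<longlonglongrightarrow> 0"
        using lim
      proof eventually_elim
        case (elim \<omega>)
        have "(\<lambda>k. d k \<omega>) \<longlonglongrightarrow> \<bar>Y \<omega> - Y \<omega>\<bar>"
          unfolding d_def by (intro tendsto_intros elim)
        then have "(\<lambda>k. g k \<omega>) \<longlonglongrightarrow> max 0 (0 * \<bar>W \<omega>\<bar> - \<eta> * 0\<^sup>2)"
          unfolding g_def by (intro tendsto_intros) auto
        then show ?case by simp
      qed
      show "AE \<omega> in M. norm (g k \<omega>) \<le> (W \<omega>)\<^sup>2 / (4 * \<eta>)" for k
        using gle[of k] by (auto simp: g_def)
    qed (use intW in auto)
    then have glim: "(\<lambda>k. (\<integral>\<omega>. g k \<omega> \<partial>M) + \<eta> * (4 * C)) \<longlonglongrightarrow> 0 + \<eta> * (4 * C)"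
      by (intro tendsto_intros) simp
    have "eventually (\<lambda>k. Q \<le> (\<integral>\<omega>. g k \<omega> \<partial>M) + \<eta> * (4 * C)) sequentially"
      using d2
    proof eventually_elim
      case (elim k)
      have "(\<integral>\<omega>. Y \<omega> * W \<omega> \<partial>M) = (\<integral>\<omega>. Y \<omega> * W \<omega> \<partial>M) - (\<integral>\<omega>. R k \<omega> * W \<omega> \<partial>M)"
        using orth by simp
      also have "\<dots> = (\<integral>\<omega>. Y \<omega> * W \<omega> - R k \<omega> * W \<omega> \<partial>M)"
        by (rule Bochner_Integration.integral_diff[symmetric]) (auto intro: L2_mult_integrable Y R W)
      also have "\<bar>\<dots>\<bar> \<le> (\<integral>\<omega>. g k \<omega> + \<eta> * (d k \<omega>)\<^sup>2 \<partial>M)"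
      proof (rule integral_abs_bound[THEN order_trans], rule integral_mono)
        show "integrable M (\<lambda>\<omega>. \<bar>Y \<omega> * W \<omega> - R k \<omega> * W \<omega>\<bar>)"
          by (intro integrable_abs Bochner_Integration.integrable_diff L2_mult_integrable Y R W)
        show "integrable M (\<lambda>\<omega>. g k \<omega> + \<eta> * (d k \<omega>)\<^sup>2)"
          using gint dL by (auto simp: L2_def)
        fix \<omega>
        have "\<bar>Y \<omega> * W \<omega> - R k \<omega> * W \<omega>\<bar> = d k \<omega> * \<bar>W \<omega>\<bar>"
          by (simp add: d_def abs_mult[symmetric] algebra_simps abs_minus_commute)
        then show "\<bar>Y \<omega> * W \<omega> - R k \<omega> * W \<omega>\<bar> \<le> g k \<omega> + \<eta> * (d k \<omega>)\<^sup>2"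
          by (simp add: g_def)
      qed
      also have "\<dots> = (\<integral>\<omega>. g k \<omega> \<partial>M) + \<eta> * (\<integral>\<omega>. (d k \<omega>)\<^sup>2 \<partial>M)"
        using gint dL by (simp add: L2_def)
      finally have "Q \<le> (\<integral>\<omega>. g k \<omega> \<partial>M) + \<eta> * (\<integral>\<omega>. (d k \<omega>)\<^sup>2 \<partial>M)" unfolding Q_def .
      moreover have "\<eta> * (\<integral>\<omega>. (d k \<omega>)\<^sup>2 \<partial>M) \<le> \<eta> * (4 * C)"
        using elim that by (intro mult_left_mono) auto
      ultimately show ?case by linarith
    qed
    then show ?thesis
      using tendsto_lowerbound[OF glim, of Q] by simp
  qed
  have "Q \<le> 0"
  proof (rule ccontr)
    assume *: "\<not> Q \<le> 0"
    \<comment> \<open>Taking \<eta> proportional to \<open>Q\<close> makes the bound return at most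
      half of \<open>Q\<close>; adding 1 to \<open>\<bar>C\<bar>\<close> keeps the quotient
      defined.\<close>
    have "Q \<le> Q / (8 * (\<bar>C\<bar> + 1)) * (4 * C)" using * by (intro bound) auto
    also have "\<dots> \<le> Q / (8 * (\<bar>C\<bar> + 1)) * (4 * (\<bar>C\<bar> + 1))" using * by (intro mult_left_mono) auto
    also have "\<dots> = Q / 2" by (simp add: field_simps)
    finally show False using * by simp
  qed
  then show ?thesis by (simp add: Q_def)
qed

section \<open>Convergence in probability\<close>

lemma (in prob_space) tends_to_zero_in_prob_real:
  "tends_to_zero_in_prob M (\<lambda>k \<omega>. ennreal \<bar>Y k \<omega>\<bar>) \<longleftrightarrow>
    (\<forall>\<epsilon>>0. (\<lambda>k. prob {\<omega> \<in> space M. \<epsilon> < \<bar>Y k \<omega>\<bar>}) \<longlonglongrightarrow> 0)"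
  unfolding tends_to_zero_in_prob_def by (auto simp: ennreal_less_iff)

lemma (in prob_space) tends_to_zero_in_prob_add:
  assumes [measurable]: "\<And>k. Y k \<in> borel_measurable M" "\<And>k. Z k \<in> borel_measurable M"
    and Y: "tends_to_zero_in_prob M (\<lambda>k \<omega>. ennreal \<bar>Y k \<omega>\<bar>)"
    and Z: "tends_to_zero_in_prob M (\<lambda>k \<omega>. ennreal \<bar>Z k \<omega>\<bar>)"
    and S: "\<And>k \<omega>. \<omega> \<in> space M \<Longrightarrow> \<bar>S k \<omega>\<bar> \<le> \<bar>Y k \<omega>\<bar> + \<bar>Z k \<omega>\<bar>"
  shows "tends_to_zero_in_prob M (\<lambda>k \<omega>. ennreal \<bar>S k \<omega>\<bar>)"
  unfolding tends_to_zero_in_prob_real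
proof (intro allI impI)
  fix \<epsilon> :: real assume "\<epsilon> > 0"
  have "(\<lambda>k. prob {\<omega> \<in> space M. \<epsilon> / 2 < \<bar>Y k \<omega>\<bar>} + prob {\<omega> \<in> space M. \<epsilon> / 2 < \<bar>Z k \<omega>\<bar>}) \<longlonglongrightarrow> 0 + 0"
    using Y Z \<open>\<epsilon> > 0\<close> half_gt_zero unfolding tends_to_zero_in_prob_real by (intro tendsto_add) blast+
  then have lim: "(\<lambda>k. prob {\<omega> \<in> space M. \<epsilon> / 2 < \<bar>Y k \<omega>\<bar>} + prob {\<omega> \<in> space M. \<epsilon> / 2 < \<bar>Z k \<omega>\<bar>}) \<longlonglongrightarrow> 0"
    by simp
  show "(\<lambda>k. prob {\<omega> \<in> space M. \<epsilon> < \<bar>S k \<omega>\<bar>}) \<longlonglongrightarrow> 0"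
  proof (rule tendsto_sandwich[OF _ _ tendsto_const lim])
    show "eventually (\<lambda>k. prob {\<omega> \<in> space M. \<epsilon> < \<bar>S k \<omega>\<bar>}
      \<le> prob {\<omega> \<in> space M. \<epsilon> / 2 < \<bar>Y k \<omega>\<bar>} + prob {\<omega> \<in> space M. \<epsilon> / 2 < \<bar>Z k \<omega>\<bar>}) sequentially"
    proof (intro always_eventually allI)
      fix k
      have "prob {\<omega> \<in> space M. \<epsilon> < \<bar>S k \<omega>\<bar>} \<le>
        prob ({\<omega> \<in> space M. \<epsilon> / 2 < \<bar>Y k \<omega>\<bar>} \<union> {\<omega> \<in> space M. \<epsilon> / 2 < \<bar>Z k \<omega>\<bar>})"
        using S[of _ k] by (intro finite_measure_mono) fastforce+
      also have "\<dots> \<le> prob {\<omega> \<in> space M. \<epsilon> / 2 < \<bar>Y k \<omega>\<bar>} + prob {\<omega> \<in> space M. \<epsilon> / 2 < \<bar>Z k \<omega>\<bar>}"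
        by (intro measure_Un_le) auto
      finally show "prob {\<omega> \<in> space M. \<epsilon> < \<bar>S k \<omega>\<bar>} \<le> \<dots>" .
    qed
  qed simp
qed

text \<open>Convergence in probability is convergence in mean of the distances truncated at 1, and
  convergence in mean has almost surely convergent subsequences. Close to the limit the truncation
  is inactive.\<close>

lemma (in prob_space) tends_to_zero_in_prob_AE_subseq:
  assumes [measurable]: "\<And>k. Y k \<in> borel_measurable M"
    and Y: "tends_to_zero_in_prob M (\<lambda>k \<omega>. ennreal \<bar>Y k \<omega>\<bar>)"
  obtains r :: "nat \<Rightarrow> nat" where "strict_mono r" "AE \<omega> in M. (\<lambda>k. Y (r k) \<omega>) \<longlonglongrightarrow> 0"
proof -
  define u where "u k \<omega> = min 1 \<bar>Y k \<omega>\<bar>" for k \<omega>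
  have [measurable]: "u k \<in> borel_measurable M" for k unfolding u_def by measurable
  have int: "integrable M (u k)" for k
    by (rule integrable_const_bound[where B = 1]) (auto simp: u_def)
  have "(\<lambda>k. \<integral>\<omega>. norm (u k \<omega>) \<partial>M) \<longlonglongrightarrow> 0"
  proof (rule LIMSEQ_I)
    fix \<epsilon> :: real assume "\<epsilon> > 0"
    have "(\<lambda>k. prob {\<omega> \<in> space M. \<epsilon> / 2 < \<bar>Y k \<omega>\<bar>}) \<longlonglongrightarrow> 0"
      using Y \<open>\<epsilon> > 0\<close> half_gt_zero unfolding tends_to_zero_in_prob_real by blast
    from LIMSEQ_D[OF this, of "\<epsilon> / 2"] \<open>\<epsilon> > 0\<close> obtain N
      where N: "\<And>k. k \<ge> N \<Longrightarrow> prob {\<omega> \<in> space M. \<epsilon> / 2 < \<bar>Y k \<omega>\<bar>} < \<epsilon> / 2" by auto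
    have "norm ((\<integral>\<omega>. norm (u k \<omega>) \<partial>M) - 0) < \<epsilon>" if "k \<ge> N" for k
    proof -
define E where "E = {\<omega> \<in> space M. \<epsilon> / 2 < \<bar>Y k \<omega>\<bar>}"
      have [measurable]: "E \<in> events" unfolding E_def by measurable
      have i: "integrable M (indicator E :: _ \<Rightarrow> real)"
        by (rule integrable_real_indicator) (auto simp: less_top[symmetric])
      have "(\<integral>\<omega>. norm (u k \<omega>) \<partial>M) \<le> (\<integral>\<omega>. \<epsilon> / 2 + indicator E \<omega> \<partial>M)"
      proof (rule integral_mono)
        show "integrable M (\<lambda>\<omega>. norm (u k \<omega>))" by (intro integrable_norm int)
        show "integrable M (\<lambda>\<omega>. \<epsilon> / 2 + indicator E \<omega>)"
          by (intro Bochner_Integration.integrable_add integrable_const i)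
        show "norm (u k \<omega>) \<le> \<epsilon> / 2 + indicator E \<omega>" if "\<omega> \<in> space M" for \<omega>
          using that \<open>\<epsilon> > 0\<close> by (cases "\<omega> \<in> E") (auto simp: u_def E_def)
      qed
      also have "\<dots> = \<epsilon> / 2 + prob E"
        by (subst Bochner_Integration.integral_add[OF integrable_const i]) (simp add: prob_space)
      finally have "(\<integral>\<omega>. norm (u k \<omega>) \<partial>M) \<le> \<epsilon> / 2 + prob E" .
      then show ?thesis using N[OF that] by (simp add: E_def u_def)
    qed
    then show "\<exists>N. \<forall>k\<ge>N. norm ((\<integral>\<omega>. norm (u k \<omega>) \<partial>M) - 0) < \<epsilon>" by blast
  qed
  from tendsto_L1_AE_subseq[OF int this] obtain r where r: "strict_mono r"
    "AE \<omega> in M. (\<lambda>k. u (r k) \<omega>) \<longlonglongrightarrow> 0" by blast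
  from r(2) have "AE \<omega> in M. (\<lambda>k. Y (r k) \<omega>) \<longlonglongrightarrow> 0"
  proof eventually_elim
    case (elim \<omega>)
    have "eventually (\<lambda>k. u (r k) \<omega> < 1) sequentially"
      using elim by (rule order_tendstoD) simp
    then have "eventually (\<lambda>k. u (r k) \<omega> = \<bar>Y (r k) \<omega>\<bar>) sequentially"
      by eventually_elim (auto simp: u_def)
    from Lim_transform_eventually[OF elim this] show ?case
      by (simp add: tendsto_rabs_zero_iff)
  qed
  with r(1) show thesis by (rule that)
qed

lemma (in prob_space) L2_prob_bound:
  assumes "L2 M f" "a > 0"
  shows "prob {\<omega> \<in> space M. a \<le> \<bar>f \<omega>\<bar>} \<le> (\<integral>\<omega>. (f \<omega>)\<^sup>2 \<partial>M) / a\<^sup>2"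
  using assms by (intro second_moment_method) (auto simp: L2_def)

section \<open>The generated filtration is independent of future increments\<close>

lemma less_if_Suc_less:
  fixes \<rho> :: "nat \<Rightarrow> 'a::order"
  assumes "\<And>i. i < L \<Longrightarrow> \<rho> i < \<rho> (Suc i)" "i < j" "j \<le> L"
  shows "\<rho> i < \<rho> j"
  using assms(2,3)
proof (induction j)
  case (Suc j)
  then show ?case using assms(1)[of j]
    by (cases "i = j") (auto intro: less_trans)
qed simp

lemma le_if_Suc_le:
  fixes \<rho> :: "nat \<Rightarrow> 'a::order"
  assumes "\<And>i. i < L \<Longrightarrow> \<rho> i \<le> \<rho> (Suc i)" "i \<le> j" "j \<le> L"
  shows "\<rho> i \<le> \<rho> j"
  using assms(2,3)
proof (induction j)
  case (Suc j)
  then show ?case using assms(1)[of j]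
    by (cases "i = Suc j") (auto intro: order_trans)
qed simp

text \<open>Brings a finite set of times into the form of a strict grid. It serves twice: for
  cylinder events of the Brownian path and for the common refinement of two partitions.\<close>

lemma finite_set_strict_enumeration:
  fixes S :: "real set"
  assumes "finite S" "S \<noteq> {}"
  obtains \<rho> :: "nat \<Rightarrow> real" and L where "\<And>i. i < L \<Longrightarrow> \<rho> i < \<rho> (Suc i)" "S = \<rho> ` {..L}"
proof -
  define us where "us = sorted_list_of_set S"
  have us: "set us = S" "sorted_wrt (<) us"
    using assms by (auto simp: us_def)
  have ne: "us \<noteq> []" using us assms by auto
  define L where "L = length us - 1"
  have L: "length us = Suc L" using ne by (simp add: L_def)
  have "us ! i < us ! (Suc i)" if "i < L" for i
    using us(2) that L by (auto simp: sorted_wrt_iff_nth_less)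
  moreover have "S = (!) us ` {..L}"
    using us(1) L by (auto simp: in_set_conv_nth image_iff less_Suc_eq_le)
  ultimately show thesis by (rule that)
qed

context prob_space
begin

text \<open>Dynkin's argument for one fixed event \<open>D\<close>: the system \<open>{D}\<close> is
  itself intersection-stable.\<close>

lemma indep_event_sigma_sets:
  assumes G: "G \<subseteq> events" "Int_stable G" and D: "D \<in> events"
    and ind: "\<And>E. E \<in> G \<Longrightarrow> prob (E \<inter> D) = prob E * prob D"
    and E: "E \<in> sigma_sets (space M) G"
  shows "prob (E \<inter> D) = prob E * prob D"
proof -
  have "indep_set G {D}"
    using G D ind by (intro indep_setI) auto
  then have "indep_set (sigma_sets (space M) G) (sigma_sets (space M) {D})"
    by (rule indep_set_sigma_sets) (use G in \<open>auto simp: Int_stable_def\<close>)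
  then show ?thesis by (rule indep_setD) (use E in auto)
qed

text \<open>Deals with the completion. A null set is almost surely the empty set, and almost sure
  equality survives complements and countable unions, so independence only has to be shown for the
  raw filtration.\<close>

lemma sigma_sets_null_AE_eq:
  assumes G: "G \<subseteq> events"
    and E: "E \<in> sigma_sets (space M) (G \<union> null_sets M)"
  shows "\<exists>E'\<in>sigma_sets (space M) G. AE \<omega> in M. \<omega> \<in> E \<longleftrightarrow> \<omega> \<in> E'"
  using E
proof induction
  case (Basic a)
  then show ?case
  proof
    assume "a \<in> null_sets M"
    then have "AE \<omega> in M. \<omega> \<in> a \<longleftrightarrow> \<omega> \<in> {}" using AE_not_in by fastforce
    then show ?thesis using sigma_sets.Empty by blast
  qed auto
next
  case Empty
  then show ?case by (intro bexI[of _ "{}"]) (auto intro: sigma_sets.Empty)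
next
  case (Compl a)
  then obtain E' where E': "E' \<in> sigma_sets (space M) G" "AE \<omega> in M. \<omega> \<in> a \<longleftrightarrow> \<omega> \<in> E'" by blast
  then show ?case
    by (intro bexI[of _ "space M - E'"]) (auto intro: sigma_sets.Compl)
next
  case (Union a)
  then obtain E' where E': "\<And>i. E' i \<in> sigma_sets (space M) G"
    "\<And>i. AE \<omega> in M. \<omega> \<in> a i \<longleftrightarrow> \<omega> \<in> E' i" by metis
  have "AE \<omega> in M. \<forall>i::nat. \<omega> \<in> a i \<longleftrightarrow> \<omega> \<in> E' i" using E'(2) by (simp add: AE_all_countable)
  then have "AE \<omega> in M. \<omega> \<in> (\<Union>i. a i) \<longleftrightarrow> \<omega> \<in> (\<Union>i. E' i)" by eventually_elim auto
  then show ?case using E'(1) by (intro bexI[of _ "\<Union>i. E' i"]) (auto intro: sigma_sets.Union)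
qed

text \<open>Each \<open>B u\<close> with \<open>u \<le> s\<close> is almost surely a partial sum of
  increments over a grid ending at \<open>s\<close>. Hence the first event depends on those
  increments only, and grouping independent variables separates it from the increment up to
  \<open>t\<close>.\<close>

lemma brownian_cylinder_indep:
  assumes bm: "brownian_motion M B" and st: "0 \<le> s" "s < t"
    and U: "finite U" "U \<subseteq> {0..s}" and V: "\<And>u. V u \<in> sets borel" and C: "C \<in> sets borel"
  shows "prob ({\<omega> \<in> space M. \<forall>u\<in>U. B u \<omega> \<in> V u} \<inter> {\<omega> \<in> space M. B t \<omega> - B s \<omega> \<in> C}) =
    prob {\<omega> \<in> space M. \<forall>u\<in>U. B u \<omega> \<in> V u} * prob {\<omega> \<in> space M. B t \<omega> - B s \<omega> \<in> C}"
proof -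
  have Bm[measurable]: "u \<in> U \<Longrightarrow> B u \<in> borel_measurable M" "B s \<in> borel_measurable M"
    "B t \<in> borel_measurable M" "B 0 \<in> borel_measurable M" for u
    using bm st U by (auto simp: brownian_motion_def)
  note V[measurable] C[measurable]
  \<comment> \<open>The points 0 and \<open>s\<close> are added so that partial sums start at
    \<open>B 0\<close> and the increment following the grid starts at \<open>s\<close>.\<close>
  define S where "S = U \<union> {0, s}"
  have "finite S" "S \<noteq> {}" using U by (auto simp: S_def)
  then obtain \<rho> L where \<rho>: "\<And>i. i < L \<Longrightarrow> \<rho> i < \<rho> (Suc i)" and S: "S = \<rho> ` {..L}"
    by (rule finite_set_strict_enumeration) blast
  have le: "\<rho> i \<le> \<rho> j" if "i \<le> j" "j \<le> L" for i j
    using le_if_Suc_le[of L \<rho> i j] \<rho> that by (auto intro: less_imp_le)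
  have range: "\<And>x. x \<in> S \<Longrightarrow> 0 \<le> x \<and> x \<le> s" using U st by (auto simp: S_def)
  have "0 \<in> S" "s \<in> S" by (auto simp: S_def)
  have ex: "\<exists>i\<le>L. \<rho> i = u" if "u \<in> S" for u using that S by (metis atMost_iff imageE)
  obtain i0 iL where i0: "i0 \<le> L" "\<rho> i0 = 0" and iL: "iL \<le> L" "\<rho> iL = s"
    using ex[OF \<open>0 \<in> S\<close>] ex[OF \<open>s \<in> S\<close>] by blast
  have \<rho>0: "\<rho> 0 = 0" using le[of 0 i0] i0 range[of "\<rho> 0"] by (auto simp: S)
  have \<rho>L: "\<rho> L = s" using le[of iL L] iL range[of "\<rho> L"] by (auto simp: S)
  \<comment> \<open>Index \<open>Suc L\<close> carries the time \<open>t\<close>; the values at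
    larger indices are arbitrary.\<close>
  define \<tau> where "\<tau> i = (if i \<le> L then \<rho> i else t + real (i - Suc L))" for i
  have \<tau>: "0 \<le> \<tau> 0" "\<forall>i<Suc L. \<tau> i < \<tau> (Suc i)"
  proof -
    show "0 \<le> \<tau> 0" by (simp add: \<tau>_def \<rho>0)
    show "\<forall>i<Suc L. \<tau> i < \<tau> (Suc i)"
      using \<rho> \<rho>L st by (auto simp: \<tau>_def less_Suc_eq)
  qed
  define D where "D i \<omega> = B (\<tau> (Suc i)) \<omega> - B (\<tau> i) \<omega>" for i \<omega>
  have ind: "indep_vars (\<lambda>_. borel) D {..<Suc L}"
    using bm \<tau> unfolding brownian_motion_def D_def by blast
  have DL: "D L \<omega> = B t \<omega> - B s \<omega>" for \<omega> by (simp add: D_def \<tau>_def \<rho>L)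
  have tel: "(\<Sum>i<j. D i \<omega>) = B (\<rho> j) \<omega> - B 0 \<omega>" if "j \<le> L" for j \<omega>
  proof -
    have "(\<Sum>i<j. D i \<omega>) = B (\<tau> j) \<omega> - B (\<tau> 0) \<omega>"
      unfolding D_def by (rule sum_lessThan_telescope)
    then show ?thesis using that by (simp add: \<tau>_def \<rho>0)
  qed
  obtain ix where ix: "\<And>u. u \<in> U \<Longrightarrow> ix u \<le> L \<and> \<rho> (ix u) = u"
  proof -
    have "\<forall>u\<in>U. \<exists>i. i \<le> L \<and> \<rho> i = u" using ex by (auto simp: S_def)
    then show thesis using that by metis
  qed
  let ?PA = "PiM {..<L} (\<lambda>_. borel :: real measure)" and ?PB = "PiM {L} (\<lambda>_. borel :: real measure)"
  have iv: "indep_var ?PA (\<lambda>\<omega>. restrict (\<lambda>i. D i \<omega>) {..<L}) ?PB (\<lambda>\<omega>. restrict (\<lambda>i. D i \<omega>) {L})"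
    by (rule indep_var_restrict[OF ind]) auto
  define XA where "XA = {x \<in> space ?PA. \<forall>u\<in>U. (\<Sum>i<ix u. x i) \<in> V u}"
  define XB where "XB = {x \<in> space ?PB. x L \<in> C}"
  have meas_sum: "(\<lambda>x. \<Sum>i<ix u. x i) \<in> borel_measurable ?PA" if "u \<in> U" for u
    using ix[OF that] by (intro borel_measurable_sum measurable_component_singleton) auto
  have XA: "XA \<in> sets ?PA"
    unfolding XA_def
  proof (intro sets.sets_Collect_finite_All U(1))
    fix u assume "u \<in> U"
    from measurable_sets[OF meas_sum[OF this] V[of u]]
    show "{x \<in> space ?PA. (\<Sum>i<ix u. x i) \<in> V u} \<in> sets ?PA"
      by (simp add: vimage_def Int_def conj_commute)
  qed
  have XB: "XB \<in> sets ?PB" unfolding XB_def by measurable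
  have main: "prob ((\<lambda>\<omega>. (restrict (\<lambda>i. D i \<omega>) {..<L}, restrict (\<lambda>i. D i \<omega>) {L})) -` (XA \<times> XB) \<inter> space M) =
    prob ((\<lambda>\<omega>. restrict (\<lambda>i. D i \<omega>) {..<L}) -` XA \<inter> space M) *
    prob ((\<lambda>\<omega>. restrict (\<lambda>i. D i \<omega>) {L}) -` XB \<inter> space M)"
    by (rule indep_varD[OF iv XA XB])
  have inA: "restrict (\<lambda>i. D i \<omega>) {..<L} \<in> XA \<longleftrightarrow> (\<forall>u\<in>U. B u \<omega> - B 0 \<omega> \<in> V u)" for \<omega>
  proof -
    have "(\<Sum>i<ix u. restrict (\<lambda>i. D i \<omega>) {..<L} i) = B u \<omega> - B 0 \<omega>" if "u \<in> U" for u
    proof -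
      have "(\<Sum>i<ix u. restrict (\<lambda>i. D i \<omega>) {..<L} i) = (\<Sum>i<ix u. D i \<omega>)"
        using ix[OF that] by (intro sum.cong) auto
      then show ?thesis using tel[of "ix u"] ix[OF that] by simp
    qed
    then show ?thesis by (auto simp: XA_def space_PiM)
  qed
  have inB: "restrict (\<lambda>i. D i \<omega>) {L} \<in> XB \<longleftrightarrow> B t \<omega> - B s \<omega> \<in> C" for \<omega>
    by (auto simp: XB_def space_PiM DL)
  \<comment> \<open>Partial sums give \<open>B u - B 0\<close>, and \<open>B 0\<close> vanishes only
    almost surely; \<open>E'\<close> bridges that gap.\<close>
  define E' where "E' = {\<omega> \<in> space M. \<forall>u\<in>U. B u \<omega> - B 0 \<omega> \<in> V u}"
  define E where "E = {\<omega> \<in> space M. \<forall>u\<in>U. B u \<omega> \<in> V u}"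
  define Dt where "Dt = {\<omega> \<in> space M. B t \<omega> - B s \<omega> \<in> C}"
  have [measurable]: "E' \<in> events" "E \<in> events" "Dt \<in> events"
    unfolding E'_def E_def Dt_def using U(1) by measurable
  have B0: "AE \<omega> in M. B 0 \<omega> = 0" using bm by (simp add: brownian_motion_def)
  have "prob (E' \<inter> Dt) = prob E' * prob Dt"
    using main
    by (simp add: vimage_def inA inB E'_def Dt_def Int_def conj_ac)
  moreover have "prob (E' \<inter> Dt) = prob (E \<inter> Dt)" "prob E' = prob E"
  proof -
    have "AE \<omega> in M. \<omega> \<in> E' \<longleftrightarrow> \<omega> \<in> E" using B0 by eventually_elim (auto simp: E_def E'_def)
    then show "prob (E' \<inter> Dt) = prob (E \<inter> Dt)" "prob E' = prob E"
      by (auto intro!: measure_eq_AE)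
  qed
  ultimately show ?thesis by (simp add: E_def Dt_def)
qed

lemma gen_filtration_generator_events:
  assumes "X0 \<in> borel_measurable M" "\<And>u. 0 \<le> u \<Longrightarrow> B u \<in> borel_measurable M"
  shows "sets (vimage_algebra (space M) X0 borel) \<union>
    (\<Union>s\<in>{0..t}. sets (vimage_algebra (space M) (B s) borel)) \<union> null_sets M \<subseteq> events"
  using assms by (auto simp: sets_vimage_algebra2 intro: measurable_sets)

lemma gen_filtration_subalgebra:
  assumes "X0 \<in> borel_measurable M" "\<And>u. 0 \<le> u \<Longrightarrow> B u \<in> borel_measurable M"
  shows "subalgebra M (gen_filtration M X0 B t)"
  unfolding subalgebra_def gen_filtration_def
proof
  let ?G = "sets (vimage_algebra (space M) X0 borel) \<union>
    (\<Union>s\<in>{0..t}. sets (vimage_algebra (space M) (B s) borel)) \<union> null_sets M"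
  have G: "?G \<subseteq> events" by (rule gen_filtration_generator_events[of X0 B t, OF assms])
  then have "sigma_sets (space M) ?G \<subseteq> events" by (rule sets.sigma_sets_subset)
  moreover have "?G \<subseteq> Pow (space M)" using G sets.space_closed by blast
  ultimately show "sets (sigma (space M) ?G) \<subseteq> events" by simp
qed (simp add: space_measure_of_conv)

lemma sets_gen_filtration:
  assumes "X0 \<in> borel_measurable M" "\<And>u. 0 \<le> u \<Longrightarrow> B u \<in> borel_measurable M"
  shows "sets (gen_filtration M X0 B t) = sigma_sets (space M)
       (sets (vimage_algebra (space M) X0 borel) \<union>
        (\<Union>s\<in>{0..t}. sets (vimage_algebra (space M) (B s) borel)) \<union> null_sets M)"
proof -
  have "sets (vimage_algebra (space M) X0 borel) \<union>
    (\<Union>s\<in>{0..t}. sets (vimage_algebra (space M) (B s) borel)) \<union> null_sets M \<subseteq> events"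
    by (rule gen_filtration_generator_events[of X0 B t, OF assms])
  then show ?thesis
    unfolding gen_filtration_def using sets.space_closed by (intro sets_measure_of) blast
qed

lemma gen_filtration_mono:
  assumes "X0 \<in> borel_measurable M" "\<And>u. 0 \<le> u \<Longrightarrow> B u \<in> borel_measurable M" "s \<le> t"
  shows "sets (gen_filtration M X0 B s) \<subseteq> sets (gen_filtration M X0 B t)"
  unfolding sets_gen_filtration[of X0 B, OF assms(1,2), simplified]
  by (intro sigma_sets_mono') (use assms(3) in force)

lemma gen_filtration_adapted:
  assumes "X0 \<in> borel_measurable M" "\<And>u. 0 \<le> u \<Longrightarrow> B u \<in> borel_measurable M" "0 \<le> t"
  shows "B t \<in> borel_measurable (gen_filtration M X0 B t)"
proof (rule measurableI)
  fix A :: "real set" assume "A \<in> sets borel"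
  then have "B t -` A \<inter> space M \<in> sets (vimage_algebra (space M) (B t) borel)"
    by (auto simp: sets_vimage_algebra2)
  then show "B t -` A \<inter> space (gen_filtration M X0 B t) \<in> sets (gen_filtration M X0 B t)"
    using assms(3) gen_filtration_subalgebra[of X0 B t, OF assms(1,2)]
    unfolding sets_gen_filtration[of X0 B, OF assms(1,2), simplified] subalgebra_def
    by (auto intro!: sigma_sets.Basic)
qed simp

text \<open>The \<sigma>-algebra is built up in three layers: the past of \<open>B\<close>,
  generated by cylinder events; then \<open>X0\<close>, which is independent of the whole path; then
  the null sets.\<close>

lemma gen_filtration_indep_event:
  assumes bm: "brownian_motion M B" and ip: "indep_of_process M X0 B" and st: "0 \<le> s" "s < t"
    and E: "E \<in> sets (gen_filtration M X0 B s)" and C: "C \<in> sets borel"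
  shows "prob (E \<inter> {\<omega> \<in> space M. B t \<omega> - B s \<omega> \<in> C}) =
    prob E * prob {\<omega> \<in> space M. B t \<omega> - B s \<omega> \<in> C}"
proof -
  have Bm: "\<And>u. 0 \<le> u \<Longrightarrow> B u \<in> borel_measurable M" using bm by (auto simp: brownian_motion_def)
  have Xm: "X0 \<in> borel_measurable M" using ip by (auto simp: indep_of_process_def)
  have [measurable]: "B s \<in> borel_measurable M" "B t \<in> borel_measurable M" using Bm st by auto
  note C[measurable]
  define Dt where "Dt = {\<omega> \<in> space M. B t \<omega> - B s \<omega> \<in> C}"
  have Dt[measurable]: "Dt \<in> events" unfolding Dt_def by measurable
  define GX where "GX = sets (vimage_algebra (space M) X0 borel)"
  define gB where "gB = (\<Union>u\<in>{0..s}. sets (vimage_algebra (space M) (B u) borel))"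
  define gA where "gA = (\<Union>u\<in>{0..}. sets (vimage_algebra (space M) (B u) borel))"
  note gev = gen_filtration_generator_events[of X0 B s, OF Xm Bm, simplified]
  have GX: "GX \<subseteq> events" and gB: "gB \<subseteq> events" unfolding GX_def gB_def using gev by auto
  have gA: "gA \<subseteq> Pow (space M)"
    unfolding gA_def by (auto simp: sets_vimage_algebra2)
  have XB: "indep_set GX (sigma_sets (space M) gA)"
    using ip by (simp add: indep_of_process_def GX_def gA_def)
  have gBA: "sigma_sets (space M) gB \<subseteq> sigma_sets (space M) gA"
    by (rule sigma_sets_mono') (auto simp: gB_def gA_def)
  \<comment> \<open>It is \<open>E1 \<inter> Dt\<close>, and not just \<open>E1\<close>, that gets
    separated from the \<open>X0\<close>-event, so \<open>Dt\<close> must belong to the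
    \<sigma>-algebra of the whole path.\<close>
  have DtA: "Dt \<in> sigma_sets (space M) gA"
  proof -
    let ?N = "sigma (space M) gA"
    have "B u \<in> borel_measurable ?N" if "0 \<le> u" for u
    proof (rule measurableI)
      fix A :: "real set" assume "A \<in> sets borel"
      then have "B u -` A \<inter> space M \<in> gA"
        using that by (auto simp: gA_def sets_vimage_algebra2)
      then show "B u -` A \<inter> space ?N \<in> sets ?N" using gA by (auto simp: space_measure_of_conv)
    qed simp
    then have [measurable]: "B s \<in> borel_measurable ?N" "B t \<in> borel_measurable ?N" using st by auto
    have "{\<omega> \<in> space ?N. B t \<omega> - B s \<omega> \<in> C} \<in> sets ?N" by measurable
    then show ?thesis using gA by (simp add: Dt_def space_measure_of_conv)
  qed
  have stepB: "prob (E \<inter> Dt) = prob E * prob Dt" if "E \<in> sigma_sets (space M) gB" for E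
  proof -
    define P where "P = {E. \<exists>U V. finite U \<and> U \<subseteq> {0..s} \<and> (\<forall>u. V u \<in> sets (borel :: real measure)) \<and>
      E = {\<omega> \<in> space M. \<forall>u\<in>U. B u \<omega> \<in> V u}}"
    have Pev: "P \<subseteq> events"
    proof
      fix E assume "E \<in> P"
      then obtain U V where U: "finite U" "U \<subseteq> {0..s}" and V: "\<And>u. V u \<in> sets (borel :: real measure)"
        and E: "E = {\<omega> \<in> space M. \<forall>u\<in>U. B u \<omega> \<in> V u}" unfolding P_def by blast
      have [measurable]: "u \<in> U \<Longrightarrow> B u \<in> borel_measurable M" for u using U Bm by auto
      note V[measurable]
      show "E \<in> events" unfolding E using U(1) by measurable
    qed
    have "Int_stable P"
    proof (rule Int_stableI)
      fix E1 E2 assume "E1 \<in> P" "E2 \<in> P"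
      then obtain U1 V1 U2 V2 where U: "finite U1" "U1 \<subseteq> {0..s}" "finite U2" "U2 \<subseteq> {0..s}"
        and V: "\<And>u. V1 u \<in> sets (borel :: real measure)" "\<And>u. V2 u \<in> sets (borel :: real measure)"
        and E: "E1 = {\<omega> \<in> space M. \<forall>u\<in>U1. B u \<omega> \<in> V1 u}" "E2 = {\<omega> \<in> space M. \<forall>u\<in>U2. B u \<omega> \<in> V2 u}"
        unfolding P_def by blast
      show "E1 \<inter> E2 \<in> P"
        unfolding P_def mem_Collect_eq
      proof (intro exI conjI allI)
        \<comment> \<open>Outside its own index set each constraint becomes trivial, so a time that
          occurs in one cylinder only is not constrained by the other.\<close>
        let ?V = "\<lambda>u. (if u \<in> U1 then V1 u else UNIV) \<inter> (if u \<in> U2 then V2 u else UNIV)"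
        show "finite (U1 \<union> U2)" "U1 \<union> U2 \<subseteq> {0..s}" using U by auto
        show "?V u \<in> sets borel" for u using V by auto
        show "E1 \<inter> E2 = {\<omega> \<in> space M. \<forall>u\<in>U1 \<union> U2. B u \<omega> \<in> ?V u}"
          unfolding E by auto
      qed
    qed
    moreover have "gB \<subseteq> P"
    proof
      fix E assume "E \<in> gB"
      then obtain u A where u: "u \<in> {0..s}" "A \<in> sets borel" "E = B u -` A \<inter> space M"
        by (auto simp: gB_def sets_vimage_algebra2)
      then show "E \<in> P" unfolding P_def mem_Collect_eq
        by (intro exI[of _ "{u}"] exI[of _ "\<lambda>_. A"]) auto
    qed
    then have "E \<in> sigma_sets (space M) P" by (rule subsetD[OF sigma_sets_mono' that])
    moreover have "prob (E \<inter> Dt) = prob E * prob Dt" if E: "E \<in> P" for E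
    proof -
      obtain U V where U: "finite U" "U \<subseteq> {0..s}" and V: "\<And>u. V u \<in> sets (borel :: real measure)"
        and E: "E = {\<omega> \<in> space M. \<forall>u\<in>U. B u \<omega> \<in> V u}" using E unfolding P_def by blast
      show ?thesis unfolding E Dt_def by (rule brownian_cylinder_indep[OF bm st U V C])
    qed
    ultimately show ?thesis using indep_event_sigma_sets[where G = P and D = Dt and E = E] Pev Dt by simp
  qed
  have step0: "prob (E \<inter> Dt) = prob E * prob Dt" if "E \<in> sigma_sets (space M) (GX \<union> gB)" for E
  proof -
    define P where "P = {E0 \<inter> E1 | E0 E1. E0 \<in> GX \<and> E1 \<in> sigma_sets (space M) gB}"
    have GBev: "sigma_sets (space M) gB \<subseteq> events" using gB by (rule sets.sigma_sets_subset)
    have Pev: "P \<subseteq> events" using GX GBev unfolding P_def by auto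
    have GXint: "a \<inter> b \<in> GX" if "a \<in> GX" "b \<in> GX" for a b using that by (auto simp: GX_def)
    have GBint: "a \<inter> b \<in> sigma_sets (space M) gB" if "a \<in> sigma_sets (space M) gB" "b \<in> sigma_sets (space M) gB" for a b
    proof -
      have "gB \<subseteq> Pow (space M)" using gB sets.space_closed by blast
      then interpret sigma_algebra "space M" "sigma_sets (space M) gB" by (rule sigma_algebra_sigma_sets)
      show ?thesis using that by auto
    qed
    have "Int_stable P"
    proof (rule Int_stableI)
      fix a b assume "a \<in> P" "b \<in> P"
      then obtain a0 a1 b0 b1 where *: "a = a0 \<inter> a1" "b = b0 \<inter> b1" "a0 \<in> GX" "b0 \<in> GX"
        "a1 \<in> sigma_sets (space M) gB" "b1 \<in> sigma_sets (space M) gB" unfolding P_def by blast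
      have ab: "a \<inter> b = (a0 \<inter> b0) \<inter> (a1 \<inter> b1)" unfolding * by auto
      show "a \<inter> b \<in> P" unfolding P_def mem_Collect_eq
        by (intro exI[of _ "a0 \<inter> b0"] exI[of _ "a1 \<inter> b1"] conjI GXint GBint ab *)
    qed
    moreover have "GX \<union> gB \<subseteq> P"
    proof
      fix E assume "E \<in> GX \<union> gB"
      then show "E \<in> P"
      proof
        assume "E \<in> GX"
        moreover have "E = E \<inter> space M" using \<open>E \<in> GX\<close> GX sets.sets_into_space by blast
        ultimately show "E \<in> P" unfolding P_def mem_Collect_eq
          by (intro exI[of _ E] exI[of _ "space M"] conjI sigma_sets_top)
      next
        assume "E \<in> gB"
        moreover have "E = space M \<inter> E" using \<open>E \<in> gB\<close> gB sets.sets_into_space by blast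
        moreover have "space M \<in> GX" unfolding GX_def using sets.top[of "vimage_algebra (space M) X0 borel"] by simp
        ultimately show "E \<in> P" unfolding P_def mem_Collect_eq
          by (intro exI[of _ "space M"] exI[of _ E] conjI sigma_sets.Basic)
      qed
    qed
    then have "E \<in> sigma_sets (space M) P" by (rule subsetD[OF sigma_sets_mono' that])
    moreover have "prob (E \<inter> Dt) = prob E * prob Dt" if "E \<in> P" for E
    proof -
      from that obtain E0 E1 where *: "E = E0 \<inter> E1" "E0 \<in> GX" "E1 \<in> sigma_sets (space M) gB"
        unfolding P_def by (elim CollectE exE conjE)
      have A1: "E1 \<in> sigma_sets (space M) gA" by (rule subsetD[OF gBA *(3)])
      interpret A: sigma_algebra "space M" "sigma_sets (space M) gA" by (rule sigma_algebra_sigma_sets[OF gA])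
      have A2: "E1 \<inter> Dt \<in> sigma_sets (space M) gA" by (rule A.Int[OF A1 DtA])
      have "prob (E \<inter> Dt) = prob (E0 \<inter> (E1 \<inter> Dt))" by (simp add: *(1) Int_assoc)
      also have "\<dots> = prob E0 * prob (E1 \<inter> Dt)" by (rule indep_setD[OF XB *(2) A2])
      also have "\<dots> = prob E0 * prob E1 * prob Dt" using stepB[OF *(3)] by simp
      also have "prob E0 * prob E1 = prob E" unfolding *(1) by (rule indep_setD[OF XB *(2) A1, symmetric])
      finally show ?thesis .
    qed
    ultimately show ?thesis using indep_event_sigma_sets[where G = P and D = Dt and E = E] Pev Dt by simp
  qed
  have "E \<in> sigma_sets (space M) ((GX \<union> gB) \<union> null_sets M)"
    using E unfolding sets_gen_filtration[of X0 B, OF Xm Bm, simplified] GX_def gB_def by simp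
  moreover have Gev: "GX \<union> gB \<subseteq> events" using GX gB by auto
  ultimately obtain E' where E': "E' \<in> sigma_sets (space M) (GX \<union> gB)" "AE \<omega> in M. \<omega> \<in> E \<longleftrightarrow> \<omega> \<in> E'"
    using sigma_sets_null_AE_eq by blast
  have [measurable]: "E' \<in> events" using E'(1) sets.sigma_sets_subset[OF Gev] by blast
  have [measurable]: "E \<in> events"
    using E gen_filtration_subalgebra[of X0 B s, OF Xm Bm] by (auto simp: subalgebra_def)
  have "prob (E \<inter> Dt) = prob (E' \<inter> Dt)" "prob E = prob E'"
    using E'(2) by (auto intro!: measure_eq_AE)
  then show ?thesis using step0[OF E'(1)] by (simp add: Dt_def)
qed

lemma gen_filtration_indep_var:
  assumes bm: "brownian_motion M B" and ip: "indep_of_process M X0 B" and st: "0 \<le> s" "s < t"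
    and Y: "Y \<in> borel_measurable (gen_filtration M X0 B s)"
  shows "indep_var borel Y borel (\<lambda>\<omega>. B t \<omega> - B s \<omega>)"
proof -
  let ?F = "gen_filtration M X0 B s"
  have Bm: "\<And>u. 0 \<le> u \<Longrightarrow> B u \<in> borel_measurable M" using bm by (auto simp: brownian_motion_def)
  have Xm: "X0 \<in> borel_measurable M" using ip by (auto simp: indep_of_process_def)
  have [measurable]: "B s \<in> borel_measurable M" "B t \<in> borel_measurable M" using Bm st by auto
  have sub: "subalgebra M ?F" by (rule gen_filtration_subalgebra[OF Xm Bm])
  define GD where "GD = {(\<lambda>\<omega>. B t \<omega> - B s \<omega>) -` A \<inter> space M | A. A \<in> sets borel}"
  have "indep_set (sets ?F) GD"
  proof (rule indep_setI)
    show "sets ?F \<subseteq> events" using sub by (simp add: subalgebra_def)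
    show "GD \<subseteq> events" by (auto simp: GD_def)
    fix a b assume "a \<in> sets ?F" "b \<in> GD"
    then show "prob (a \<inter> b) = prob a * prob b"
      using gen_filtration_indep_event[OF bm ip st] by (auto simp: GD_def vimage_def Int_def conj_commute)
  qed
  moreover have "Int_stable GD"
  proof (rule Int_stableI)
    fix a b assume "a \<in> GD" "b \<in> GD"
    then obtain A A' where "A \<in> sets borel" "A' \<in> sets borel"
      "a = (\<lambda>\<omega>. B t \<omega> - B s \<omega>) -` A \<inter> space M" "b = (\<lambda>\<omega>. B t \<omega> - B s \<omega>) -` A' \<inter> space M"
      by (auto simp: GD_def)
    then show "a \<inter> b \<in> GD" unfolding GD_def by (intro CollectI exI[of _ "A \<inter> A'"]) auto
  qed
  ultimately have ind: "indep_set (sigma_sets (space M) (sets ?F)) (sigma_sets (space M) GD)"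
    by (intro indep_set_sigma_sets sets.Int_stable)
  have "sigma_sets (space M) {Y -` A \<inter> space M | A. A \<in> sets borel} \<subseteq> sigma_sets (space M) (sets ?F)"
    using sub measurable_sets[OF Y] by (intro sigma_sets_mono') (auto simp: subalgebra_def)
  then have "indep_set (sigma_sets (space M) {Y -` A \<inter> space M | A. A \<in> sets borel}) (sigma_sets (space M) GD)"
    using ind unfolding indep_sets2_eq by blast
  moreover have "Y \<in> borel_measurable M" using measurable_from_subalg[OF sub Y] .
  ultimately show ?thesis unfolding indep_var_eq GD_def by auto
qed

end

section \<open>Elementary stochastic integrals\<close>

text \<open>What the stochastic integral needs from the filtration; generators, \<open>X0\<close>
  and null sets no longer appear. Independence is stated for random variables because it is used to
  factor expectations.\<close>

locale brownian_filtration = prob_space M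
  for M :: "'w measure" and F :: "real \<Rightarrow> 'w measure" and B :: "real \<Rightarrow> 'w \<Rightarrow> real" +
  assumes subalg: "0 \<le> t \<Longrightarrow> subalgebra M (F t)"
    and sets_mono: "0 \<le> s \<Longrightarrow> s \<le> t \<Longrightarrow> sets (F s) \<subseteq> sets (F t)"
    and B_adapted: "0 \<le> t \<Longrightarrow> B t \<in> borel_measurable (F t)"
    and B_indep: "0 \<le> s \<Longrightarrow> s < t \<Longrightarrow> Y \<in> borel_measurable (F s) \<Longrightarrow>
      indep_var borel Y borel (\<lambda>\<omega>. B t \<omega> - B s \<omega>)"
    and B_normal: "0 \<le> s \<Longrightarrow> s < t \<Longrightarrow>
      distributed M lborel (\<lambda>\<omega>. B t \<omega> - B s \<omega>) (\<lambda>x. ennreal (normal_density 0 (sqrt (t - s)) x))"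

lemma brownian_filtrationI:
  assumes "prob_space M" "brownian_motion M B" "indep_of_process M X0 B"
  shows "brownian_filtration M (gen_filtration M X0 B) B"
proof -
  interpret prob_space M by fact
  have Bm: "\<And>u. 0 \<le> u \<Longrightarrow> B u \<in> borel_measurable M" using assms by (auto simp: brownian_motion_def)
  have Xm: "X0 \<in> borel_measurable M" using assms by (auto simp: indep_of_process_def)
  show ?thesis
  proof
    show "subalgebra M (gen_filtration M X0 B t)" for t by (rule gen_filtration_subalgebra[OF Xm Bm])
    show "s \<le> t \<Longrightarrow> sets (gen_filtration M X0 B s) \<subseteq> sets (gen_filtration M X0 B t)" for s t
      by (rule gen_filtration_mono[OF Xm Bm])
    show "0 \<le> t \<Longrightarrow> B t \<in> borel_measurable (gen_filtration M X0 B t)" for t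
      by (rule gen_filtration_adapted[OF Xm Bm])
    show "0 \<le> s \<Longrightarrow> s < t \<Longrightarrow> Y \<in> borel_measurable (gen_filtration M X0 B s) \<Longrightarrow>
      indep_var borel Y borel (\<lambda>\<omega>. B t \<omega> - B s \<omega>)" for s t Y
      by (rule gen_filtration_indep_var[OF assms(2,3)])
    show "0 \<le> s \<Longrightarrow> s < t \<Longrightarrow>
      distributed M lborel (\<lambda>\<omega>. B t \<omega> - B s \<omega>) (\<lambda>x. ennreal (normal_density 0 (sqrt (t - s)) x))" for s t
      using assms(2) by (auto simp: brownian_motion_def)
  qed
qed

context brownian_filtration
begin

lemma adapted_M: "0 \<le> s \<Longrightarrow> Y \<in> borel_measurable (F s) \<Longrightarrow> Y \<in> borel_measurable M"
  using measurable_from_subalg[OF subalg] .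

lemma adapted_mono: "0 \<le> s \<Longrightarrow> s \<le> t \<Longrightarrow> Y \<in> borel_measurable (F s) \<Longrightarrow> Y \<in> borel_measurable (F t)"
  using measurable_from_subalg[of "F t" "F s"] subalg[of s] subalg[of t] sets_mono[of s t]
  by (auto simp: subalgebra_def)

lemma space_F: "0 \<le> s \<Longrightarrow> space (F s) = space M"
  using subalg by (simp add: subalgebra_def)

lemma B_measurable: "0 \<le> t \<Longrightarrow> B t \<in> borel_measurable M"
  using adapted_M B_adapted by blast

lemma B_increment:
  assumes "0 \<le> s" "s \<le> t"
  shows "L2 M (\<lambda>\<omega>. B t \<omega> - B s \<omega>)" "(\<integral>\<omega>. B t \<omega> - B s \<omega> \<partial>M) = 0"
    "(\<integral>\<omega>. (B t \<omega> - B s \<omega>)\<^sup>2 \<partial>M) = t - s"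
proof -
  have "L2 M (\<lambda>\<omega>. B t \<omega> - B s \<omega>) \<and> (\<integral>\<omega>. B t \<omega> - B s \<omega> \<partial>M) = 0 \<and>
    (\<integral>\<omega>. (B t \<omega> - B s \<omega>)\<^sup>2 \<partial>M) = t - s"
  proof (cases "s = t")
    case False
    then have st: "s < t" and pos: "0 < sqrt (t - s)" using assms by auto
    note D = B_normal[OF assms(1) st]
    have e: "(\<integral>\<omega>. B t \<omega> - B s \<omega> \<partial>M) = 0"
      by (rule normal_distributed_expectation[OF pos D])
    have v: "(\<integral>\<omega>. (B t \<omega> - B s \<omega>)\<^sup>2 \<partial>M) = t - s"
      using normal_distributed_variance[OF pos D] e assms by simp
    \<comment> \<open>A non-integrable function has Bochner integral 0 by convention, so a nonzero
      value of the integral proves integrability.\<close>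
    have "(\<integral>\<omega>. (B t \<omega> - B s \<omega>)\<^sup>2 \<partial>M) \<noteq> 0" using v st by simp
    then have "integrable M (\<lambda>\<omega>. (B t \<omega> - B s \<omega>)\<^sup>2)"
      using not_integrable_integral_eq by blast
    then show ?thesis using e v B_measurable assms by (auto simp: L2_def)
  qed simp
  then show "L2 M (\<lambda>\<omega>. B t \<omega> - B s \<omega>)" "(\<integral>\<omega>. B t \<omega> - B s \<omega> \<partial>M) = 0"
    "(\<integral>\<omega>. (B t \<omega> - B s \<omega>)\<^sup>2 \<partial>M) = t - s" by auto
qed

lemma increment_orth:
  assumes "0 \<le> s" "s \<le> t" "Y \<in> borel_measurable (F s)" "integrable M Y"
  shows "integrable M (\<lambda>\<omega>. Y \<omega> * (B t \<omega> - B s \<omega>))"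
    "(\<integral>\<omega>. Y \<omega> * (B t \<omega> - B s \<omega>) \<partial>M) = 0"
proof -
  have i: "integrable M (\<lambda>\<omega>. B t \<omega> - B s \<omega>)"
    using B_increment(1)[OF assms(1,2)] square_integrable_imp_integrable unfolding L2_def by blast
  show "integrable M (\<lambda>\<omega>. Y \<omega> * (B t \<omega> - B s \<omega>))"
    "(\<integral>\<omega>. Y \<omega> * (B t \<omega> - B s \<omega>) \<partial>M) = 0"
    using indep_var_integrable[OF B_indep[OF assms(1) _ assms(3)] assms(4) i]
      indep_var_lebesgue_integral[OF B_indep[OF assms(1) _ assms(3)] assms(4) i] assms B_increment(2)[OF assms(1,2)]
    by (cases "s = t"; simp)+
qed

lemma increment_isometry:
  assumes "0 \<le> s" "s \<le> t" "Y \<in> borel_measurable (F s)" "L2 M Y"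
  shows "L2 M (\<lambda>\<omega>. Y \<omega> * (B t \<omega> - B s \<omega>))"
    "(\<integral>\<omega>. (Y \<omega> * (B t \<omega> - B s \<omega>))\<^sup>2 \<partial>M) = (\<integral>\<omega>. (Y \<omega>)\<^sup>2 \<partial>M) * (t - s)"
proof -
  have "L2 M (\<lambda>\<omega>. Y \<omega> * (B t \<omega> - B s \<omega>)) \<and>
    (\<integral>\<omega>. (Y \<omega> * (B t \<omega> - B s \<omega>))\<^sup>2 \<partial>M) = (\<integral>\<omega>. (Y \<omega>)\<^sup>2 \<partial>M) * (t - s)"
  proof (cases "s = t")
    case False
    then have st: "s < t" using assms by simp
    have sq: "(\<lambda>x::real. x\<^sup>2) \<in> borel_measurable borel" by measurable
    have iv: "indep_var borel (\<lambda>\<omega>. (Y \<omega>)\<^sup>2) borel (\<lambda>\<omega>. (B t \<omega> - B s \<omega>)\<^sup>2)"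
      using indep_var_compose[OF B_indep[OF assms(1) st assms(3)] sq sq] by (simp add: comp_def)
    note I = L2_integrable[OF assms(4)] L2_integrable[OF B_increment(1)[OF assms(1,2)]]
    show ?thesis
      using indep_var_integrable[OF iv I] indep_var_lebesgue_integral[OF iv I]
        B_increment(3)[OF assms(1,2)] B_measurable assms
      by (auto simp: L2_def power_mult_distrib)
  qed simp
  then show "L2 M (\<lambda>\<omega>. Y \<omega> * (B t \<omega> - B s \<omega>))"
    "(\<integral>\<omega>. (Y \<omega> * (B t \<omega> - B s \<omega>))\<^sup>2 \<partial>M) = (\<integral>\<omega>. (Y \<omega>)\<^sup>2 \<partial>M) * (t - s)" by auto
qed

end

section \<open>Isometry, orthogonality and tail bound for elementary sums\<close>

context brownian_filtration
begin

definition esum :: "(nat \<Rightarrow> 'w \<Rightarrow> real) \<Rightarrow> (nat \<Rightarrow> real) \<Rightarrow> nat \<Rightarrow> 'w \<Rightarrow> real" where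
  "esum \<xi> \<tau> N \<omega> = (\<Sum>i<N. \<xi> i \<omega> * (B (\<tau> (Suc i)) \<omega> - B (\<tau> i) \<omega>))"

lemma esum_Suc: "esum \<xi> \<tau> (Suc N) \<omega> = esum \<xi> \<tau> N \<omega> + \<xi> N \<omega> * (B (\<tau> (Suc N)) \<omega> - B (\<tau> N) \<omega>)"
  by (simp add: esum_def)

text \<open>Induction on the number of cells. The cross term is the past sum times
  \<open>\<xi> j\<close>, both known at \<open>\<tau> j\<close>, against a future increment, so its
  mean is zero; adaptedness is carried along for this purpose.\<close>

lemma esum_isometry:
  assumes \<tau>: "0 \<le> \<tau> 0" "\<And>i. i < N \<Longrightarrow> \<tau> i \<le> \<tau> (Suc i)"
    and \<xi>: "\<And>i. i < N \<Longrightarrow> \<xi> i \<in> borel_measurable (F (\<tau> i))"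
    and bd: "\<And>i \<omega>. i < N \<Longrightarrow> \<omega> \<in> space M \<Longrightarrow> \<bar>\<xi> i \<omega>\<bar> \<le> c"
  shows "esum \<xi> \<tau> N \<in> borel_measurable (F (\<tau> N))" "L2 M (esum \<xi> \<tau> N)"
    "(\<integral>\<omega>. (esum \<xi> \<tau> N \<omega>)\<^sup>2 \<partial>M) = (\<Sum>i<N. (\<integral>\<omega>. (\<xi> i \<omega>)\<^sup>2 \<partial>M) * (\<tau> (Suc i) - \<tau> i))"
proof -
  have "esum \<xi> \<tau> j \<in> borel_measurable (F (\<tau> j)) \<and> L2 M (esum \<xi> \<tau> j) \<and>
    (\<integral>\<omega>. (esum \<xi> \<tau> j \<omega>)\<^sup>2 \<partial>M) = (\<Sum>i<j. (\<integral>\<omega>. (\<xi> i \<omega>)\<^sup>2 \<partial>M) * (\<tau> (Suc i) - \<tau> i))" if "j \<le> N" for j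
    using that
  proof (induction j)
    case 0
    then show ?case by (simp add: esum_def[abs_def])
  next
    case (Suc j)
    have j: "j < N" using Suc by simp
    have S: "esum \<xi> \<tau> j \<in> borel_measurable (F (\<tau> j))" "L2 M (esum \<xi> \<tau> j)"
      "(\<integral>\<omega>. (esum \<xi> \<tau> j \<omega>)\<^sup>2 \<partial>M) = (\<Sum>i<j. (\<integral>\<omega>. (\<xi> i \<omega>)\<^sup>2 \<partial>M) * (\<tau> (Suc i) - \<tau> i))"
      using Suc by auto
    have tj: "0 \<le> \<tau> j" using le_if_Suc_le[of N \<tau> 0 j] \<tau> j by force
    have tj': "\<tau> j \<le> \<tau> (Suc j)" "0 \<le> \<tau> (Suc j)" using \<tau>(2)[OF j] tj by auto
    have \<xi>M: "\<xi> j \<in> borel_measurable M" using adapted_M[OF tj \<xi>[OF j]] .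
    have \<xi>L: "L2 M (\<xi> j)"
      by (rule L2_bounded[OF finite_measure_axioms \<xi>M bd[OF j]])
    let ?D = "\<lambda>\<omega>. B (\<tau> (Suc j)) \<omega> - B (\<tau> j) \<omega>"
    have \<xi>D: "L2 M (\<lambda>\<omega>. \<xi> j \<omega> * ?D \<omega>)"
      "(\<integral>\<omega>. (\<xi> j \<omega> * ?D \<omega>)\<^sup>2 \<partial>M) = (\<integral>\<omega>. (\<xi> j \<omega>)\<^sup>2 \<partial>M) * (\<tau> (Suc j) - \<tau> j)"
      by (rule increment_isometry[OF tj tj'(1) \<xi>[OF j] \<xi>L])+
    have cross: "(\<integral>\<omega>. esum \<xi> \<tau> j \<omega> * (\<xi> j \<omega> * ?D \<omega>) \<partial>M) = 0"
    proof -
      have "(\<integral>\<omega>. (esum \<xi> \<tau> j \<omega> * \<xi> j \<omega>) * ?D \<omega> \<partial>M) = 0"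
        by (rule increment_orth(2)[OF tj tj'(1)])
          (use S \<xi>[OF j] \<xi>L in \<open>auto intro: L2_mult_integrable\<close>)
      then show ?thesis by (simp add: mult.assoc)
    qed
    have eq: "esum \<xi> \<tau> (Suc j) = (\<lambda>\<omega>. esum \<xi> \<tau> j \<omega> + \<xi> j \<omega> * ?D \<omega>)"
      by (simp add: esum_Suc fun_eq_iff)
    have [measurable]: "esum \<xi> \<tau> j \<in> borel_measurable (F (\<tau> (Suc j)))"
      "\<xi> j \<in> borel_measurable (F (\<tau> (Suc j)))" "B (\<tau> j) \<in> borel_measurable (F (\<tau> (Suc j)))"
      "B (\<tau> (Suc j)) \<in> borel_measurable (F (\<tau> (Suc j)))"
      using adapted_mono[OF tj tj'(1)] S(1) \<xi>[OF j] B_adapted tj tj' by auto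
    have 1: "esum \<xi> \<tau> (Suc j) \<in> borel_measurable (F (\<tau> (Suc j)))"
      unfolding eq by measurable
    have 2: "L2 M (esum \<xi> \<tau> (Suc j))" unfolding eq by (rule L2_add[OF S(2) \<xi>D(1)])
    have "(\<integral>\<omega>. (esum \<xi> \<tau> (Suc j) \<omega>)\<^sup>2 \<partial>M) =
      (\<integral>\<omega>. (esum \<xi> \<tau> j \<omega>)\<^sup>2 + ((\<xi> j \<omega> * ?D \<omega>)\<^sup>2 + 2 * (esum \<xi> \<tau> j \<omega> * (\<xi> j \<omega> * ?D \<omega>))) \<partial>M)"
      unfolding eq by (intro Bochner_Integration.integral_cong refl) (simp only: power2_sum mult.assoc add.assoc)
    also have "\<dots> = (\<integral>\<omega>. (esum \<xi> \<tau> j \<omega>)\<^sup>2 \<partial>M) + (\<integral>\<omega>. (\<xi> j \<omega> * ?D \<omega>)\<^sup>2 \<partial>M)"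
      using L2_integrable[OF S(2)] L2_integrable[OF \<xi>D(1)] L2_mult_integrable[OF S(2) \<xi>D(1)] cross
      by simp
    finally show ?case using 1 2 S(3) \<xi>D(2) by simp
  qed
  from this[of N] show "esum \<xi> \<tau> N \<in> borel_measurable (F (\<tau> N))" "L2 M (esum \<xi> \<tau> N)"
    "(\<integral>\<omega>. (esum \<xi> \<tau> N \<omega>)\<^sup>2 \<partial>M) = (\<Sum>i<N. (\<integral>\<omega>. (\<xi> i \<omega>)\<^sup>2 \<partial>M) * (\<tau> (Suc i) - \<tau> i))" by auto
qed

lemma esum_orth:
  assumes \<tau>: "0 \<le> \<tau> 0" "\<And>i. i < N \<Longrightarrow> \<tau> i \<le> \<tau> (Suc i)"
    and \<xi>: "\<And>i. i < N \<Longrightarrow> \<xi> i \<in> borel_measurable (F (\<tau> i))"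
    and bd: "\<And>i \<omega>. i < N \<Longrightarrow> \<omega> \<in> space M \<Longrightarrow> \<bar>\<xi> i \<omega>\<bar> \<le> c"
    and W: "W \<in> borel_measurable (F (\<tau> 0))" "L2 M W"
  shows "(\<integral>\<omega>. esum \<xi> \<tau> N \<omega> * W \<omega> \<partial>M) = 0"
proof -
  have *: "integrable M (\<lambda>\<omega>. (W \<omega> * \<xi> i \<omega>) * (B (\<tau> (Suc i)) \<omega> - B (\<tau> i) \<omega>))"
    "(\<integral>\<omega>. (W \<omega> * \<xi> i \<omega>) * (B (\<tau> (Suc i)) \<omega> - B (\<tau> i) \<omega>) \<partial>M) = 0" if i: "i < N" for i
  proof -
    have t0: "\<tau> 0 \<le> \<tau> i" using le_if_Suc_le[of N \<tau> 0 i] \<tau> i by force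
    have ti: "0 \<le> \<tau> i" "\<tau> i \<le> \<tau> (Suc i)" using t0 \<tau> i by auto
    have \<xi>L: "L2 M (\<xi> i)"
      by (rule L2_bounded[OF finite_measure_axioms adapted_M[OF ti(1) \<xi>[OF i]] bd[OF i]])
    have [measurable]: "W \<in> borel_measurable (F (\<tau> i))" "\<xi> i \<in> borel_measurable (F (\<tau> i))"
      using adapted_mono[OF \<tau>(1) t0 W(1)] \<xi>[OF i] by auto
    have "(\<lambda>\<omega>. W \<omega> * \<xi> i \<omega>) \<in> borel_measurable (F (\<tau> i))" by measurable
    then show "integrable M (\<lambda>\<omega>. (W \<omega> * \<xi> i \<omega>) * (B (\<tau> (Suc i)) \<omega> - B (\<tau> i) \<omega>))"
      "(\<integral>\<omega>. (W \<omega> * \<xi> i \<omega>) * (B (\<tau> (Suc i)) \<omega> - B (\<tau> i) \<omega>) \<partial>M) = 0"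
      using increment_orth[OF ti _ L2_mult_integrable[OF W(2) \<xi>L]] by simp_all
  qed
  have "(\<integral>\<omega>. esum \<xi> \<tau> N \<omega> * W \<omega> \<partial>M) =
    (\<integral>\<omega>. (\<Sum>i<N. (W \<omega> * \<xi> i \<omega>) * (B (\<tau> (Suc i)) \<omega> - B (\<tau> i) \<omega>)) \<partial>M)"
    unfolding esum_def sum_distrib_right
    by (intro Bochner_Integration.integral_cong refl sum.cong) (simp add: ac_simps)
  also have "\<dots> = (\<Sum>i<N. (\<integral>\<omega>. (W \<omega> * \<xi> i \<omega>) * (B (\<tau> (Suc i)) \<omega> - B (\<tau> i) \<omega>) \<partial>M))"
    using * by (intro Bochner_Integration.integral_sum) auto
  also have "\<dots> = 0" using * by simp
  finally show ?thesis .
qed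

text \<open>
  A Lenglart-type inequality: stop the sum just before its quadratic variation exceeds \<open>\<delta>\<close>.
\<close>

lemma esum_prob_bound:
  assumes \<tau>: "0 \<le> \<tau> 0" "\<And>i. i < N \<Longrightarrow> \<tau> i \<le> \<tau> (Suc i)"
    and \<xi>: "\<And>i. i < N \<Longrightarrow> \<xi> i \<in> borel_measurable (F (\<tau> i))"
    and bd: "\<And>i \<omega>. i < N \<Longrightarrow> \<omega> \<in> space M \<Longrightarrow> \<bar>\<xi> i \<omega>\<bar> \<le> c"
    and pos: "\<delta> \<ge> 0" "\<epsilon> > 0"
  shows "prob {\<omega> \<in> space M. \<epsilon> < \<bar>esum \<xi> \<tau> N \<omega>\<bar>} \<le>
    prob {\<omega> \<in> space M. \<delta> < (\<Sum>i<N. (\<xi> i \<omega>)\<^sup>2 * (\<tau> (Suc i) - \<tau> i))} + \<delta> / \<epsilon>\<^sup>2"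
proof -
  define V where "V j \<omega> = (\<Sum>i<j. (\<xi> i \<omega>)\<^sup>2 * (\<tau> (Suc i) - \<tau> i))" for j \<omega>
  \<comment> \<open>The test includes the current cell: \<open>V (Suc i)\<close> is already known at
    \<open>\<tau> i\<close>, so \<open>\<xi>'\<close> stays adapted and the kept cells never
    overshoot \<open>\<delta>\<close>.\<close>
  define \<xi>' where "\<xi>' i \<omega> = (if V (Suc i) \<omega> \<le> \<delta> then \<xi> i \<omega> else 0)" for i \<omega>
  have tm: "\<tau> i \<le> \<tau> j" if "i \<le> j" "j \<le> N" for i j
    using le_if_Suc_le[of N \<tau> i j] \<tau> that by force
  have t0: "0 \<le> \<tau> i" if "i \<le> N" for i using tm[of 0 i] \<tau> that by force
  have \<xi>F: "\<xi> i \<in> borel_measurable (F (\<tau> j))" if "i \<le> j" "j < N" for i j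
    using adapted_mono[OF t0 tm \<xi>] that by auto
  have \<xi>M: "\<xi> i \<in> borel_measurable M" if "i < N" for i
    using adapted_M[OF t0 \<xi>] that by auto
  have \<xi>'F: "\<xi>' i \<in> borel_measurable (F (\<tau> i))" if "i < N" for i
  proof -
    have [measurable]: "\<xi> k \<in> borel_measurable (F (\<tau> i))" if "k < Suc i" for k
      using \<xi>F that \<open>i < N\<close> by auto
    have [measurable]: "\<xi> i \<in> borel_measurable (F (\<tau> i))" using \<xi> that by auto
    have "V (Suc i) \<in> borel_measurable (F (\<tau> i))"
      unfolding V_def by (intro borel_measurable_sum) auto
    then show ?thesis unfolding \<xi>'_def by measurable
  qed
  have \<xi>'bd: "\<bar>\<xi>' i \<omega>\<bar> \<le> \<bar>c\<bar>" if "i < N" "\<omega> \<in> space M" for i \<omega>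
    using bd[OF that] by (auto simp: \<xi>'_def)
  \<comment> \<open>The minimum closes the induction: a kept cell has
    \<open>V (Suc j) \<le> \<delta>\<close>, and a dropped one contributes nothing.\<close>
  have V': "(\<Sum>i<j. (\<xi>' i \<omega>)\<^sup>2 * (\<tau> (Suc i) - \<tau> i)) \<le> min (V j \<omega>) \<delta>" if "j \<le> N" for j \<omega>
    using that
  proof (induction j)
    case 0
    then show ?case using pos by (simp add: V_def)
  next
    case (Suc j)
    then have "(\<Sum>i<j. (\<xi>' i \<omega>)\<^sup>2 * (\<tau> (Suc i) - \<tau> i)) \<le> min (V j \<omega>) \<delta>" by simp
    moreover have "0 \<le> (\<xi> j \<omega>)\<^sup>2 * (\<tau> (Suc j) - \<tau> j)" using \<tau>(2)[of j] Suc by simp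
    ultimately show ?case by (auto simp: \<xi>'_def V_def)
  qed
  note iso = esum_isometry[of \<tau> N \<xi>' "\<bar>c\<bar>", OF \<tau> \<xi>'F \<xi>'bd]
  have \<xi>'L: "L2 M (\<xi>' i)" if "i < N" for i
    using L2_bounded[OF finite_measure_axioms adapted_M[OF t0 \<xi>'F] \<xi>'bd] that by simp
  have "(\<integral>\<omega>. (esum \<xi>' \<tau> N \<omega>)\<^sup>2 \<partial>M) = (\<integral>\<omega>. (\<Sum>i<N. (\<xi>' i \<omega>)\<^sup>2 * (\<tau> (Suc i) - \<tau> i)) \<partial>M)"
  proof -
    have "(\<integral>\<omega>. (\<Sum>i<N. (\<xi>' i \<omega>)\<^sup>2 * (\<tau> (Suc i) - \<tau> i)) \<partial>M) =
      (\<Sum>i<N. (\<integral>\<omega>. (\<xi>' i \<omega>)\<^sup>2 \<partial>M) * (\<tau> (Suc i) - \<tau> i))"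
      using \<xi>'L by (subst Bochner_Integration.integral_sum) (auto simp: L2_def)
    then show ?thesis using iso(3) by simp
  qed
  also have "\<dots> \<le> (\<integral>\<omega>. \<delta> \<partial>M)"
    by (rule integral_mono)
      (use V'[OF order_refl] \<xi>'L in \<open>auto simp: L2_def\<close>)
  also have "\<dots> = \<delta>" by (simp add: prob_space)
  finally have E: "(\<integral>\<omega>. (esum \<xi>' \<tau> N \<omega>)\<^sup>2 \<partial>M) \<le> \<delta>" .
  have [measurable]: "esum \<xi>' \<tau> N \<in> borel_measurable M" "V N \<in> borel_measurable M"
    using iso(2) \<xi>M by (auto simp: L2_def V_def[abs_def])
  have eq: "esum \<xi> \<tau> N \<omega> = esum \<xi>' \<tau> N \<omega>" if "V N \<omega> \<le> \<delta>" for \<omega>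
  proof -
    have "V (Suc i) \<omega> \<le> V N \<omega>" if "i < N" for i
      unfolding V_def using that \<tau>(2)
      by (intro sum_mono2) auto
    then have "\<xi>' i \<omega> = \<xi> i \<omega>" if "i < N" for i
      using that \<open>V N \<omega> \<le> \<delta>\<close> order_trans by (fastforce simp: \<xi>'_def)
    then show ?thesis by (simp add: esum_def)
  qed
  have "prob {\<omega> \<in> space M. \<epsilon> < \<bar>esum \<xi> \<tau> N \<omega>\<bar>} \<le>
    prob ({\<omega> \<in> space M. \<delta> < V N \<omega>} \<union> {\<omega> \<in> space M. \<epsilon> \<le> \<bar>esum \<xi>' \<tau> N \<omega>\<bar>})"
  proof (rule finite_measure_mono)
    show "{\<omega> \<in> space M. \<epsilon> < \<bar>esum \<xi> \<tau> N \<omega>\<bar>} \<subseteq>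
      {\<omega> \<in> space M. \<delta> < V N \<omega>} \<union> {\<omega> \<in> space M. \<epsilon> \<le> \<bar>esum \<xi>' \<tau> N \<omega>\<bar>}"
    proof
      fix \<omega> assume "\<omega> \<in> {\<omega> \<in> space M. \<epsilon> < \<bar>esum \<xi> \<tau> N \<omega>\<bar>}"
      then show "\<omega> \<in> {\<omega> \<in> space M. \<delta> < V N \<omega>} \<union> {\<omega> \<in> space M. \<epsilon> \<le> \<bar>esum \<xi>' \<tau> N \<omega>\<bar>}"
        using eq[of \<omega>] by (cases "V N \<omega> \<le> \<delta>") auto
    qed
  qed auto
  also have "\<dots> \<le> prob {\<omega> \<in> space M. \<delta> < V N \<omega>} + prob {\<omega> \<in> space M. \<epsilon> \<le> \<bar>esum \<xi>' \<tau> N \<omega>\<bar>}"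
    by (intro measure_Un_le) auto
  also have "prob {\<omega> \<in> space M. \<epsilon> \<le> \<bar>esum \<xi>' \<tau> N \<omega>\<bar>} \<le> (\<integral>\<omega>. (esum \<xi>' \<tau> N \<omega>)\<^sup>2 \<partial>M) / \<epsilon>\<^sup>2"
    by (rule L2_prob_bound[OF iso(2) pos(2)])
  also have "\<dots> \<le> \<delta> / \<epsilon>\<^sup>2" using E by (intro divide_right_mono) auto
  finally show ?thesis by (simp add: V_def)
qed

end

section \<open>Ito integrals as limits of Riemann sums\<close>

text \<open>A coarse increment telescopes over the fine cells it contains, and the inner sum picks
  the coefficient of the coarse cell around a fine one. Coarse points may coincide, as they do after
  clamping at \<open>t\<close>; only \<open>\<rho>\<close> is strict.\<close>

lemma sum_refine:
  fixes x \<rho> :: "nat \<Rightarrow> real" and c :: "nat \<Rightarrow> real" and f :: "real \<Rightarrow> real"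
  assumes \<rho>: "\<And>l. l < L \<Longrightarrow> \<rho> l < \<rho> (Suc l)"
    and x: "\<And>i. i < N \<Longrightarrow> x i \<le> x (Suc i)" "x ` {..N} \<subseteq> \<rho> ` {..L}"
  shows "(\<Sum>i<N. c i * (f (x (Suc i)) - f (x i))) =
    (\<Sum>l<L. (\<Sum>i<N. c i * of_bool (x i \<le> \<rho> l \<and> \<rho> l < x (Suc i))) * (f (\<rho> (Suc l)) - f (\<rho> l)))"
proof -
  have inner: "(\<Sum>l<L. of_bool (x i \<le> \<rho> l \<and> \<rho> l < x (Suc i)) * (f (\<rho> (Suc l)) - f (\<rho> l))) =
    f (x (Suc i)) - f (x i)" if i: "i < N" for i
  proof -
    have "x i \<in> \<rho> ` {..L}" "x (Suc i) \<in> \<rho> ` {..L}" using x(2) i by auto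
    then obtain a b where ab: "a \<le> L" "\<rho> a = x i" "b \<le> L" "\<rho> b = x (Suc i)" by force
    have mono: "\<rho> p < \<rho> q \<longleftrightarrow> p < q" if "p \<le> L" "q \<le> L" for p q
      using less_if_Suc_less[of L \<rho> p q] less_if_Suc_less[of L \<rho> q p] \<rho> that
      by (cases p q rule: linorder_cases) (auto simp: not_less less_imp_le)
    have mono': "\<rho> p \<le> \<rho> q \<longleftrightarrow> p \<le> q" if "p \<le> L" "q \<le> L" for p q
      using mono[OF that(2,1)] by (simp add: not_less[symmetric])
    have le: "a \<le> b" using mono'[OF ab(1,3)] x(1)[OF i] ab by simp
    have "(\<Sum>l<L. of_bool (x i \<le> \<rho> l \<and> \<rho> l < x (Suc i)) * (f (\<rho> (Suc l)) - f (\<rho> l))) =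
      (\<Sum>l<L. if l \<in> {a..<b} then f (\<rho> (Suc l)) - f (\<rho> l) else 0)"
      using mono mono' ab by (intro sum.cong) (auto simp flip: ab(2,4))
    also have "\<dots> = (\<Sum>l=a..<b. f (\<rho> (Suc l)) - f (\<rho> l))"
      using ab(3) by (subst sum.inter_restrict[symmetric]) (auto intro!: sum.cong)
    also have "\<dots> = f (\<rho> b) - f (\<rho> a)"
      using sum_Suc_diff'[OF le, of "\<lambda>l. f (\<rho> l)"] by simp
    finally show ?thesis by (simp add: ab)
  qed
  have "(\<Sum>l<L. (\<Sum>i<N. c i * of_bool (x i \<le> \<rho> l \<and> \<rho> l < x (Suc i))) * (f (\<rho> (Suc l)) - f (\<rho> l))) =
    (\<Sum>i<N. \<Sum>l<L. c i * (of_bool (x i \<le> \<rho> l \<and> \<rho> l < x (Suc i)) * (f (\<rho> (Suc l)) - f (\<rho> l))))"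
    unfolding sum_distrib_right by (subst sum.swap) (simp add: mult.assoc)
  also have "\<dots> = (\<Sum>i<N. c i * (f (x (Suc i)) - f (x i)))"
    by (intro sum.cong refl) (simp only: sum_distrib_left[symmetric] inner lessThan_iff)
  finally show ?thesis by simp
qed

text \<open>The left side is the integral of a step function. Its cells are disjoint, so at each
  point at most one term is nonzero, and that one is below \<open>g\<close>.\<close>

lemma step_sum_le_nn_integral:
  fixes \<rho> \<zeta> :: "nat \<Rightarrow> real" and g :: "real \<Rightarrow> ennreal"
  assumes \<rho>: "\<And>l. l < L \<Longrightarrow> \<rho> l < \<rho> (Suc l)" "0 \<le> \<rho> 0" "\<rho> L \<le> t"
    and g: "\<And>l s. l < L \<Longrightarrow> \<rho> l < s \<Longrightarrow> s \<le> \<rho> (Suc l) \<Longrightarrow> ennreal ((\<zeta> l)\<^sup>2) \<le> g s"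
  shows "ennreal (\<Sum>l<L. (\<zeta> l)\<^sup>2 * (\<rho> (Suc l) - \<rho> l)) \<le> (\<integral>\<^sup>+ s\<in>{0..t}. g s \<partial>lborel)"
proof -
  have mono: "\<rho> p \<le> \<rho> q" if "p \<le> q" "q \<le> L" for p q
    using le_if_Suc_le[of L \<rho> p q] \<rho>(1) that by force
  have "ennreal (\<Sum>l<L. (\<zeta> l)\<^sup>2 * (\<rho> (Suc l) - \<rho> l)) =
    (\<Sum>l<L. ennreal ((\<zeta> l)\<^sup>2 * (\<rho> (Suc l) - \<rho> l)))"
    using \<rho>(1) by (intro sum_ennreal[symmetric]) (auto intro!: mult_nonneg_nonneg simp: less_imp_le)
  also have "\<dots> = (\<Sum>l<L. \<integral>\<^sup>+ s. ennreal ((\<zeta> l)\<^sup>2) * indicator {\<rho> l<..\<rho> (Suc l)} s \<partial>lborel)"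
    using \<rho>(1) by (intro sum.cong) (auto simp: nn_integral_cmult_indicator ennreal_mult' less_imp_le)
  also have "\<dots> = (\<integral>\<^sup>+ s. (\<Sum>l<L. ennreal ((\<zeta> l)\<^sup>2) * indicator {\<rho> l<..\<rho> (Suc l)} s) \<partial>lborel)"
    by (subst nn_integral_sum) auto
  also have "\<dots> \<le> (\<integral>\<^sup>+ s\<in>{0..t}. g s \<partial>lborel)"
  proof (rule nn_integral_mono)
    fix s
    show "(\<Sum>l<L. ennreal ((\<zeta> l)\<^sup>2) * indicator {\<rho> l<..\<rho> (Suc l)} s) \<le> g s * indicator {0..t} s"
    proof (cases "\<exists>l<L. \<rho> l < s \<and> s \<le> \<rho> (Suc l)")
      case True
      then obtain l where l: "l < L" "\<rho> l < s" "s \<le> \<rho> (Suc l)" by blast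
      have z: "ennreal ((\<zeta> m)\<^sup>2) * indicator {\<rho> m<..\<rho> (Suc m)} s = 0" if "m < L" "m \<noteq> l" for m
      proof -
        have "\<rho> (Suc m) \<le> \<rho> l \<or> \<rho> (Suc l) \<le> \<rho> m"
          using that l mono[of "Suc m" l] mono[of "Suc l" m] by linarith
        then show ?thesis using l by (auto simp: indicator_def)
      qed
      have "(\<Sum>m<L. ennreal ((\<zeta> m)\<^sup>2) * indicator {\<rho> m<..\<rho> (Suc m)} s) =
        ennreal ((\<zeta> l)\<^sup>2) * indicator {\<rho> l<..\<rho> (Suc l)} s"
      proof (subst sum.remove[of _ l])
        have "(\<Sum>m\<in>{..<L} - {l}. ennreal ((\<zeta> m)\<^sup>2) * indicator {\<rho> m<..\<rho> (Suc m)} s) = 0"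
          by (intro sum.neutral ballI z) auto
        then show "ennreal ((\<zeta> l)\<^sup>2) * indicator {\<rho> l<..\<rho> (Suc l)} s +
          (\<Sum>m\<in>{..<L} - {l}. ennreal ((\<zeta> m)\<^sup>2) * indicator {\<rho> m<..\<rho> (Suc m)} s) =
          ennreal ((\<zeta> l)\<^sup>2) * indicator {\<rho> l<..\<rho> (Suc l)} s" by simp
      qed (use l in auto)
      also have "\<dots> = ennreal ((\<zeta> l)\<^sup>2)" using l by simp
      also have "\<dots> \<le> g s" by (rule g[OF l])
      also have "\<dots> = g s * indicator {0..t} s"
        using l mono[of 0 l] mono[of "Suc l" L] \<rho> by (auto simp: indicator_def)
      finally show ?thesis .
    next
      case False
      then have "(\<Sum>l<L. ennreal ((\<zeta> l)\<^sup>2) * indicator {\<rho> l<..\<rho> (Suc l)} s) = 0"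
        by (intro sum.neutral) (auto simp: indicator_def)
      then show ?thesis by simp
    qed
  qed
  finally show ?thesis .
qed

text \<open>The level is tied to the mesh index: coefficients of Riemann sums become bounded, as
  simple processes require, while for a continuous path on a compact interval the clipping is
  inactive from some \<open>k\<close> on.\<close>

definition clip :: "nat \<Rightarrow> real \<Rightarrow> real" where
  "clip k x = max (- real k) (min (real k) x)"

lemma clip_measurable[measurable]: "clip k \<in> borel_measurable borel"
  unfolding clip_def[abs_def] by measurable

lemma abs_clip_le: "\<bar>clip k x\<bar> \<le> real k" "\<bar>clip k x\<bar> \<le> \<bar>x\<bar>"
  by (auto simp: clip_def)

lemma clip_eq: "\<bar>x\<bar> \<le> real k \<Longrightarrow> clip k x = x"
  by (auto simp: clip_def)

definition grid :: "nat \<Rightarrow> nat \<Rightarrow> real" where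
  "grid k i = real i / real (Suc k)"

lemma grid_simps: "grid k 0 = 0" "0 \<le> grid k i" "grid k (Suc i) = grid k i + 1 / real (Suc k)"
  "grid k (T * Suc k) = real T" "grid k i \<le> grid k (Suc i)"
proof -
  show "grid k (Suc i) = grid k i + 1 / real (Suc k)"
    by (simp add: grid_def add_divide_distrib)
  show "grid k (T * Suc k) = real T"
    unfolding grid_def of_nat_mult by (rule nonzero_mult_div_cancel_right) simp
qed (auto simp: grid_def divide_right_mono)

text \<open>Uniform continuity handles the mesh and boundedness the clipping. The threshold for
  \<open>k\<close> depends on the path, which later forces dominated convergence instead of a
  uniform estimate.\<close>

lemma clip_grid_uniform:
  fixes f :: "real \<Rightarrow> real"
  assumes f: "continuous_on {0..t} f" and \<eta>: "\<eta> > 0" and t: "t \<ge> 0"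
  shows "eventually (\<lambda>k. \<forall>j s. min t (grid k j) \<le> s \<and> s \<le> min t (grid k (Suc j)) \<longrightarrow>
    \<bar>f s - clip k (f (min t (grid k j)))\<bar> \<le> \<eta> \<and> \<bar>f s - f (min t (grid k j))\<bar> \<le> \<eta>) sequentially"
proof -
  have "uniformly_continuous_on {0..t} f" by (intro compact_uniformly_continuous f) auto
  then obtain \<delta> where \<delta>: "\<delta> > 0" "\<And>x y. x \<in> {0..t} \<Longrightarrow> y \<in> {0..t} \<Longrightarrow> dist x y < \<delta> \<Longrightarrow> dist (f x) (f y) < \<eta>"
    using \<eta> unfolding uniformly_continuous_on_def by blast
  have "bounded (f ` {0..t})" by (intro compact_imp_bounded compact_continuous_image f) auto
  then obtain b where b: "\<forall>x\<in>{0..t}. \<bar>f x\<bar> \<le> b" by (auto simp: bounded_iff)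
  obtain k0 where k0: "b \<le> real k0" using real_arch_simple by blast
  obtain k1 where k1: "1 / real (Suc k1) < \<delta>" using \<delta>(1) nat_approx_posE by blast
  show ?thesis
  proof (rule eventually_sequentiallyI[of "max k0 k1"], intro allI impI)
    fix k j s assume k: "max k0 k1 \<le> k" and s: "min t (grid k j) \<le> s \<and> s \<le> min t (grid k (Suc j))"
    have "1 / real (Suc k) \<le> 1 / real (Suc k1)" using k by (intro divide_left_mono) auto
    then have "\<bar>s - min t (grid k j)\<bar> < \<delta>"
      using s k1 \<delta>(1) by (auto simp: grid_simps(3) min_def split: if_splits)
    moreover have in01: "min t (grid k j) \<in> {0..t}" "s \<in> {0..t}"
      using s t grid_simps(2)[of k j] by (auto simp: min_def split: if_splits)
    ultimately have "\<bar>f s - f (min t (grid k j))\<bar> \<le> \<eta>"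
      using \<delta>(2)[of s "min t (grid k j)"] by (auto simp: dist_real_def)
    moreover have "clip k (f (min t (grid k j))) = f (min t (grid k j))"
      using bspec[OF b in01(1)] k0 k by (intro clip_eq) auto
    ultimately show "\<bar>f s - clip k (f (min t (grid k j)))\<bar> \<le> \<eta> \<and> \<bar>f s - f (min t (grid k j))\<bar> \<le> \<eta>" by simp
  qed
qed

context brownian_filtration
begin

text \<open>The left-endpoint Riemann sum over \<open>{0..t}\<close>. Times beyond \<open>t\<close>
  are frozen at \<open>t\<close>, so cells there have increment zero and one horizon
  \<open>T\<close> serves all \<open>t \<le> T\<close>; sums for two times can then be subtracted
  cell by cell.\<close>

definition ito_sum :: "(real \<Rightarrow> 'w \<Rightarrow> real) \<Rightarrow> real \<Rightarrow> nat \<Rightarrow> nat \<Rightarrow> 'w \<Rightarrow> real" where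
  "ito_sum H t T k = esum (\<lambda>i \<omega>. clip k (H (min t (grid k i)) \<omega>)) (\<lambda>i. min t (grid k i)) (T * Suc k)"

text \<open>Tonelli applied to the jointly measurable integrand. It is needed to split events
  according to the size of this distance.\<close>

lemma L2_distance_measurable:
  assumes "0 \<le> t" "simple_ito M F B t H' J'"
    and H: "(\<lambda>(s, \<omega>). H s \<omega>) \<in> borel_measurable (restrict_space borel {0..t} \<Otimes>\<^sub>M M)"
  shows "(\<lambda>\<omega>. \<integral>\<^sup>+ s\<in>{0..t}. ennreal ((H' s \<omega> - H s \<omega>)\<^sup>2) \<partial>lborel) \<in> borel_measurable M"
proof -
  let ?R = "restrict_space lborel {0..t}"
  obtain N \<tau> \<xi> where \<tau>: "0 \<le> \<tau> 0" "\<And>i. i < N \<Longrightarrow> \<tau> i < \<tau> (Suc i)"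
    and \<xi>: "\<And>i. i < N \<Longrightarrow> \<xi> i \<in> borel_measurable (F (\<tau> i))"
    and H': "H' = (\<lambda>s \<omega>. \<Sum>i<(N::nat). \<xi> i \<omega> * indicator {\<tau> i<..\<tau> (Suc i)} s)"
    using assms(2) unfolding simple_ito_def by blast
  have t0: "0 \<le> \<tau> i" if "i \<le> N" for i
    using le_if_Suc_le[of N \<tau> 0 i] \<tau> that by force
  have \<xi>M: "\<xi> i \<in> borel_measurable M" if "i < N" for i using adapted_M[OF t0 \<xi>] that by auto
  interpret R: finite_measure ?R
    by (rule finite_measureI) (auto simp: emeasure_restrict_space assms)
  have sR: "sets (?R \<Otimes>\<^sub>M M) = sets (restrict_space borel {0..t} \<Otimes>\<^sub>M M)"
    by (intro sets_pair_measure_cong sets_restrict_space_cong) auto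
  have [measurable]: "(\<lambda>(s, \<omega>). H s \<omega>) \<in> borel_measurable (?R \<Otimes>\<^sub>M M)"
    using H measurable_cong_sets[OF sR refl] by blast
  have ind: "(\<lambda>s. indicator {\<tau> i<..\<tau> (Suc i)} s :: real) \<in> borel_measurable ?R" for i
    by (rule measurable_restrict_space1) auto
  have [measurable]: "(\<lambda>(s, \<omega>). H' s \<omega>) \<in> borel_measurable (?R \<Otimes>\<^sub>M M)"
    unfolding H' split_beta
    by (intro borel_measurable_sum borel_measurable_times)
      (auto intro!: measurable_compose[OF measurable_snd \<xi>M] measurable_compose[OF measurable_fst ind])
  have "(\<lambda>(s, \<omega>). ennreal ((H' s \<omega> - H s \<omega>)\<^sup>2)) \<in> borel_measurable (?R \<Otimes>\<^sub>M M)"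
    by measurable
  then have "(\<lambda>(\<omega>, s). ennreal ((H' s \<omega> - H s \<omega>)\<^sup>2)) \<in> borel_measurable (M \<Otimes>\<^sub>M ?R)"
    using measurable_pair_swap by fastforce
  then have "(\<lambda>\<omega>. \<integral>\<^sup>+ s. ennreal ((H' s \<omega> - H s \<omega>)\<^sup>2) \<partial>?R) \<in> borel_measurable M"
    by (rule R.borel_measurable_nn_integral)
  then show ?thesis by (simp add: nn_integral_restrict_space)
qed

text \<open>On a common refinement the difference of the two integrals is a single elementary sum,
  and the witness \<open>V\<close> is its quadratic variation. The first clause on \<open>V\<close>
  is the Lenglart-type bound; the second says that \<open>V\<close> is small where both
  approximations of \<open>H\<close> are good in \<open>{0..t}\<close>.\<close>

lemma simple_ito_minus_ito_sum:
  assumes t: "0 \<le> t" "t \<le> real T" and simple: "simple_ito M F B t H' J'"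
    and H: "\<And>s. s \<in> {0..t} \<Longrightarrow> H s \<in> borel_measurable (F s)"
      "\<And>\<omega>. \<omega> \<in> space M \<Longrightarrow> continuous_on {0..t} (\<lambda>s. H s \<omega>)"
  shows "\<exists>V. V \<in> borel_measurable M \<and>
    (\<forall>\<delta> \<epsilon>. \<delta> \<ge> 0 \<longrightarrow> \<epsilon> > 0 \<longrightarrow>
      prob {\<omega> \<in> space M. \<epsilon> < \<bar>J' \<omega> - ito_sum H t T k \<omega>\<bar>} \<le> prob {\<omega> \<in> space M. \<delta> < V \<omega>} + \<delta> / \<epsilon>\<^sup>2) \<and>
    (\<forall>\<omega> \<eta>. \<omega> \<in> space M \<longrightarrow> \<eta> \<ge> 0 \<longrightarrow>
      (\<forall>j s. min t (grid k j) \<le> s \<and> s \<le> min t (grid k (Suc j)) \<longrightarrow>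
        \<bar>H s \<omega> - clip k (H (min t (grid k j)) \<omega>)\<bar> \<le> \<eta>) \<longrightarrow>
      ennreal (V \<omega>) \<le> 2 * (\<integral>\<^sup>+ s\<in>{0..t}. ennreal ((H' s \<omega> - H s \<omega>)\<^sup>2) \<partial>lborel) + ennreal (2 * \<eta>\<^sup>2 * t))"
proof -
  obtain N \<tau> \<xi> where \<tau>: "0 \<le> \<tau> 0" "\<And>i. i < N \<Longrightarrow> \<tau> i < \<tau> (Suc i)"
    and \<xi>: "\<And>i. i < N \<Longrightarrow> \<xi> i \<in> borel_measurable (F (\<tau> i))"
    and bd: "\<And>i. i < N \<Longrightarrow> \<exists>c. \<forall>\<omega>\<in>space M. \<bar>\<xi> i \<omega>\<bar> \<le> c"
    and H': "H' = (\<lambda>s \<omega>. \<Sum>i<(N::nat). \<xi> i \<omega> * indicator {\<tau> i<..\<tau> (Suc i)} s)"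
    and J': "J' = (\<lambda>\<omega>. \<Sum>i<N. \<xi> i \<omega> * (B (min t (\<tau> (Suc i))) \<omega> - B (min t (\<tau> i)) \<omega>))"
    using simple unfolding simple_ito_def by blast
  obtain c where c: "\<And>i \<omega>. i < N \<Longrightarrow> \<omega> \<in> space M \<Longrightarrow> \<bar>\<xi> i \<omega>\<bar> \<le> c i" using bd by metis
  have t0: "0 \<le> \<tau> i" if "i \<le> N" for i
    using le_if_Suc_le[of N \<tau> 0 i] \<tau> that by force
  define K where "K = T * Suc k"
  define x where "x i = min t (\<tau> i)" for i
  define y where "y j = min t (grid k j)" for j
  define h where "h j \<omega> = clip k (H (y j) \<omega>)" for j \<omega>
  have xm: "x i \<le> x (Suc i)" if "i < N" for i using \<tau>(2)[OF that] by (simp add: x_def)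
  have ym: "y j \<le> y (Suc j)" for j using grid_simps(5)[of k j] by (simp add: y_def)
  have y01: "y j \<in> {0..t}" for j using t grid_simps(2) by (simp add: y_def)
  \<comment> \<open>The common refinement of both partitions, after clamping at
    \<open>t\<close>.\<close>
  define S where "S = x ` {..N} \<union> y ` {..K}"
  have "finite S" "S \<noteq> {}" by (auto simp: S_def)
  then obtain \<rho> L where \<rho>: "\<And>i. i < L \<Longrightarrow> \<rho> i < \<rho> (Suc i)" and S: "S = \<rho> ` {..L}"
    by (rule finite_set_strict_enumeration) blast
  have Srange: "s \<in> {0..t}" if "s \<in> S" for s
    using that y01 t t0 unfolding S_def x_def by auto
  have \<rho>S: "\<rho> l \<in> S" if "l \<le> L" for l using that S by auto
  have \<rho>01: "\<rho> l \<in> {0..t}" if "l \<le> L" for l using Srange[OF \<rho>S[OF that]] .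
  have gap: "s \<le> \<rho> l \<or> \<rho> (Suc l) \<le> s" if "l < L" "s \<in> S" for l s
  proof -
    obtain m where m: "m \<le> L" "s = \<rho> m" using \<open>s \<in> S\<close> S by auto
    show ?thesis using le_if_Suc_le[of L \<rho> m l] le_if_Suc_le[of L \<rho> "Suc l" m] \<rho> m that
      by (cases "m \<le> l") (auto simp: less_imp_le)
  qed
  \<comment> \<open>\<open>\<zeta>1 l\<close> and \<open>\<zeta>2 l\<close> are the values of the
    simple process and of the clipped Riemann step process on the refined cell
    \<open>l\<close>.\<close>
  define \<zeta>1 where "\<zeta>1 l \<omega> = (\<Sum>i<N. \<xi> i \<omega> * of_bool (x i \<le> \<rho> l \<and> \<rho> l < x (Suc i)))" for l \<omega>
  define \<zeta>2 where "\<zeta>2 l \<omega> = (\<Sum>j<K. h j \<omega> * of_bool (y j \<le> \<rho> l \<and> \<rho> l < y (Suc j)))" for l \<omega>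
  define \<zeta> where "\<zeta> l \<omega> = \<zeta>1 l \<omega> - \<zeta>2 l \<omega>" for l \<omega>
  define V where "V \<omega> = (\<Sum>l<L. (\<zeta> l \<omega>)\<^sup>2 * (\<rho> (Suc l) - \<rho> l))" for \<omega>
  have eq: "J' \<omega> - ito_sum H t T k \<omega> = esum \<zeta> \<rho> L \<omega>" for \<omega>
  proof -
    have "J' \<omega> = (\<Sum>l<L. \<zeta>1 l \<omega> * (B (\<rho> (Suc l)) \<omega> - B (\<rho> l) \<omega>))"
      unfolding J' \<zeta>1_def x_def[symmetric]
      by (rule sum_refine[where f = "\<lambda>u. B u \<omega>"]) (use S \<rho> xm in \<open>auto simp: S_def\<close>)
    moreover have "ito_sum H t T k \<omega> = (\<Sum>l<L. \<zeta>2 l \<omega> * (B (\<rho> (Suc l)) \<omega> - B (\<rho> l) \<omega>))"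
      unfolding ito_sum_def esum_def \<zeta>2_def y_def[symmetric] h_def[symmetric] K_def[symmetric]
      by (rule sum_refine[where f = "\<lambda>u. B u \<omega>"]) (use S \<rho> ym in \<open>auto simp: S_def\<close>)
    ultimately show ?thesis
      by (simp add: esum_def \<zeta>_def left_diff_distrib sum_subtractf)
  qed
  have \<zeta>F: "\<zeta> l \<in> borel_measurable (F (\<rho> l))" if l: "l < L" for l
  proof -

    have 1: "(\<lambda>\<omega>. \<xi> i \<omega> * of_bool (x i \<le> \<rho> l \<and> \<rho> l < x (Suc i))) \<in> borel_measurable (F (\<rho> l))" if "i < N" for i
    proof (cases "x i \<le> \<rho> l \<and> \<rho> l < x (Suc i)")
      case True
      then have "\<tau> i \<le> \<rho> l" by (auto simp: x_def min_def split: if_splits)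
      then have "\<xi> i \<in> borel_measurable (F (\<rho> l))"
        using adapted_mono[OF t0 _ \<xi>, of i "\<rho> l"] that by simp
      then show ?thesis by measurable
    next
      case False
      then show ?thesis by (simp only: of_bool_eq mult_zero_right borel_measurable_const)
    qed
    have 2: "(\<lambda>\<omega>. h j \<omega> * of_bool (y j \<le> \<rho> l \<and> \<rho> l < y (Suc j))) \<in> borel_measurable (F (\<rho> l))" for j
    proof (cases "y j \<le> \<rho> l \<and> \<rho> l < y (Suc j)")
      case True
      have [measurable]: "H (y j) \<in> borel_measurable (F (\<rho> l))"
        using adapted_mono[OF _ _ H(1)[OF y01]] True y01[of j] by simp
      show ?thesis unfolding h_def by measurable
    next
      case False
      then show ?thesis by (simp only: of_bool_eq mult_zero_right borel_measurable_const)
    qed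
    show ?thesis unfolding \<zeta>_def \<zeta>1_def \<zeta>2_def
      by (intro borel_measurable_diff borel_measurable_sum 1 2) auto
  qed
  have \<zeta>bd: "\<bar>\<zeta> l \<omega>\<bar> \<le> (\<Sum>i<N. \<bar>c i\<bar>) + (\<Sum>j<K. real k)" if "\<omega> \<in> space M" for l \<omega>
  proof -
    have "\<bar>\<zeta>1 l \<omega>\<bar> \<le> (\<Sum>i<N. \<bar>c i\<bar>)"
      unfolding \<zeta>1_def by (rule order_trans[OF sum_abs], rule sum_mono) (use c that in \<open>fastforce simp: abs_mult\<close>)
    moreover have "\<bar>\<zeta>2 l \<omega>\<bar> \<le> (\<Sum>j<K. real k)"
      unfolding \<zeta>2_def by (rule order_trans[OF sum_abs], rule sum_mono) (use abs_clip_le in \<open>auto simp: abs_mult h_def\<close>)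
    ultimately show ?thesis unfolding \<zeta>_def by linarith
  qed
  have \<rho>0: "0 \<le> \<rho> 0" using \<rho>01[of 0] by simp
  have \<rho>': "\<rho> l \<le> \<rho> (Suc l)" if "l < L" for l using \<rho>[OF that] by simp
  have Vm: "V \<in> borel_measurable M"
    unfolding V_def
  proof (intro borel_measurable_sum borel_measurable_times borel_measurable_power borel_measurable_const)
    fix l assume "l \<in> {..<L}"
    then show "\<zeta> l \<in> borel_measurable M" using adapted_M[OF _ \<zeta>F, of l] \<rho>01[of l] by simp
  qed
  show ?thesis
  proof (intro exI[of _ V] conjI allI impI Vm)
    fix \<delta> \<epsilon> :: real assume "\<delta> \<ge> 0" "\<epsilon> > 0"
    then show "prob {\<omega> \<in> space M. \<epsilon> < \<bar>J' \<omega> - ito_sum H t T k \<omega>\<bar>} \<le> prob {\<omega> \<in> space M. \<delta> < V \<omega>} + \<delta> / \<epsilon>\<^sup>2"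
      unfolding eq V_def by (intro esum_prob_bound[OF \<rho>0 \<rho>' \<zeta>F \<zeta>bd])
  next
    fix \<omega> and \<eta> :: real
    assume \<omega>: "\<omega> \<in> space M" and \<eta>: "\<eta> \<ge> 0"
      and close: "\<forall>j s. min t (grid k j) \<le> s \<and> s \<le> min t (grid k (Suc j)) \<longrightarrow>
        \<bar>H s \<omega> - clip k (H (min t (grid k j)) \<omega>)\<bar> \<le> \<eta>"
    define g where "g s = 2 * ennreal ((H' s \<omega> - H s \<omega>)\<^sup>2) + ennreal (2 * \<eta>\<^sup>2)" for s
    have "ennreal (V \<omega>) \<le> (\<integral>\<^sup>+ s\<in>{0..t}. g s \<partial>lborel)"
      unfolding V_def
    proof (rule step_sum_le_nn_integral[OF \<rho> \<rho>0])
      show "\<rho> L \<le> t" using \<rho>01[of L] by simp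
      fix l s assume l: "l < L" and s: "\<rho> l < s" "s \<le> \<rho> (Suc l)"
      have st: "s \<le> t" using \<rho>01[of "Suc l"] l s by simp
      \<comment> \<open>Refined cells are open on the left like those of a simple process. No point
        of \<open>S\<close> lies strictly inside a cell, so comparing \<open>x i\<close> with
        \<open>\<rho> l\<close> amounts to comparing \<open>\<tau> i\<close> with
        \<open>s\<close>.\<close>
      have "\<zeta>1 l \<omega> = H' s \<omega>"
        unfolding \<zeta>1_def H'
      proof (intro sum.cong refl)
        fix i assume "i \<in> {..<N}"
        then have i: "i < N" by simp
        have "x i \<in> S" "x (Suc i) \<in> S" using i by (auto simp: S_def)
        then have "x i \<le> \<rho> l \<and> \<rho> l < x (Suc i) \<longleftrightarrow> \<tau> i < s \<and> s \<le> \<tau> (Suc i)"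
          using gap[OF l, of "x i"] gap[OF l, of "x (Suc i)"] s st by (auto simp: x_def min_def split: if_splits)
        then show "\<xi> i \<omega> * of_bool (x i \<le> \<rho> l \<and> \<rho> l < x (Suc i)) = \<xi> i \<omega> * indicator {\<tau> i<..\<tau> (Suc i)} s"
          by (simp add: indicator_def)
      qed
      moreover have "\<bar>H s \<omega> - \<zeta>2 l \<omega>\<bar> \<le> \<eta>"
      proof -
        have y0: "y 0 = 0" and yK: "y K = t"
          using t unfolding y_def K_def grid_simps by simp_all
        have "\<rho> l < y K" using s st yK by simp
        moreover have "\<not> \<rho> l < y 0" using \<rho>01[of l] l y0 by simp
        \<comment> \<open>The last grid index not beyond \<open>\<rho> l\<close>; it exists because
          the clamped grid starts at 0 and has reached \<open>t\<close> at index
          \<open>K\<close>.\<close>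
        ultimately obtain j where j: "j < K" "\<forall>i\<le>j. \<not> \<rho> l < y i" "\<rho> l < y (Suc j)"
          using ex_least_nat_less[of "\<lambda>j. \<rho> l < y j" K] by blast
        have j': "y j \<le> \<rho> l" using j(2) by (simp add: not_less)
        have ymono: "y p \<le> y q" if "p \<le> q" for p q using le_if_Suc_le[of q y p q] ym that by auto
        have other: "h m \<omega> * of_bool (y m \<le> \<rho> l \<and> \<rho> l < y (Suc m)) = 0" if "m \<noteq> j" for m
        proof -
          have "y (Suc m) \<le> y j \<or> y (Suc j) \<le> y m"
            using that ymono[of "Suc m" j] ymono[of "Suc j" m] by linarith
          then have "\<not> (y m \<le> \<rho> l \<and> \<rho> l < y (Suc m))" using j' j(3) by linarith
          then show ?thesis by (simp only: of_bool_eq mult_zero_right)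
        qed
        have "\<zeta>2 l \<omega> = h j \<omega> * of_bool (y j \<le> \<rho> l \<and> \<rho> l < y (Suc j))"
        proof -
          have "(\<Sum>m\<in>{..<K} - {j}. h m \<omega> * of_bool (y m \<le> \<rho> l \<and> \<rho> l < y (Suc m))) = 0"
            by (intro sum.neutral ballI other) auto
          then show ?thesis unfolding \<zeta>2_def using j(1) by (subst sum.remove[of _ j]) auto
        qed
        then have "\<zeta>2 l \<omega> = h j \<omega>" using j j' by simp
        moreover have "y j \<le> s" using j' s by simp
        moreover have "s \<le> y (Suc j)"
        proof -
          have "y (Suc j) \<in> S" using j(1) by (auto simp: S_def)
          from gap[OF l this] j(3) s show ?thesis by linarith
        qed
        ultimately show ?thesis using close by (auto simp: h_def y_def)
      qed
      ultimately have "\<bar>\<zeta> l \<omega> - (H' s \<omega> - H s \<omega>)\<bar> \<le> \<eta>" by (simp add: \<zeta>_def)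
      then have "(\<zeta> l \<omega> - (H' s \<omega> - H s \<omega>))\<^sup>2 \<le> \<eta>\<^sup>2" using \<eta> by (simp add: abs_le_square_iff[symmetric])
      moreover have "(\<zeta> l \<omega>)\<^sup>2 \<le> 2 * (H' s \<omega> - H s \<omega>)\<^sup>2 + 2 * (\<zeta> l \<omega> - (H' s \<omega> - H s \<omega>))\<^sup>2"
        using zero_le_power2[of "\<zeta> l \<omega> - 2 * (H' s \<omega> - H s \<omega>)"] by (simp add: power2_eq_square algebra_simps)
      ultimately have "ennreal ((\<zeta> l \<omega>)\<^sup>2) \<le> ennreal (2 * (H' s \<omega> - H s \<omega>)\<^sup>2 + 2 * \<eta>\<^sup>2)"
        by (intro ennreal_leI) linarith
      also have "\<dots> = g s" by (simp add: g_def ennreal_mult')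
      finally show "ennreal ((\<zeta> l \<omega>)\<^sup>2) \<le> g s" .
    qed
    also have "(\<integral>\<^sup>+ s\<in>{0..t}. g s \<partial>lborel) =
      (\<integral>\<^sup>+ s. 2 * (ennreal ((H' s \<omega> - H s \<omega>)\<^sup>2) * indicator {0..t} s) + ennreal (2 * \<eta>\<^sup>2) * indicator {0..t} s \<partial>lborel)"
      by (intro nn_integral_cong) (simp add: g_def indicator_def)
    also have "\<dots> = 2 * (\<integral>\<^sup>+ s\<in>{0..t}. ennreal ((H' s \<omega> - H s \<omega>)\<^sup>2) \<partial>lborel) + ennreal (2 * \<eta>\<^sup>2) * emeasure lborel {0..t}"
    proof -
      \<comment> \<open>Continuity holds on \<open>{0..t}\<close> only, so measurability in time is
        shown for the extension by zero, which agrees with \<open>H\<close> under the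
        indicator.\<close>
      have [measurable]: "(\<lambda>s. indicator {0..t} s *\<^sub>R H s \<omega>) \<in> borel_measurable borel"
        by (rule borel_measurable_continuous_on_indicator) (use H(2)[OF \<omega>] in auto)
      have [measurable]: "(\<lambda>s. H' s \<omega>) \<in> borel_measurable borel" unfolding H' by measurable
      have "(\<lambda>s. ennreal ((H' s \<omega> - indicator {0..t} s *\<^sub>R H s \<omega>)\<^sup>2) * indicator {0..t} s) \<in> borel_measurable borel"
        by measurable
      moreover have "(\<lambda>s. ennreal ((H' s \<omega> - indicator {0..t} s *\<^sub>R H s \<omega>)\<^sup>2) * indicator {0..t} s) =
        (\<lambda>s. ennreal ((H' s \<omega> - H s \<omega>)\<^sup>2) * indicator {0..t} s)"
        by (auto simp: fun_eq_iff indicator_def)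
      ultimately have "(\<lambda>s. ennreal ((H' s \<omega> - H s \<omega>)\<^sup>2) * indicator {0..t} s) \<in> borel_measurable borel" by simp
      then show ?thesis
        by (subst nn_integral_add) (auto simp: nn_integral_cmult)
    qed
    also have "ennreal (2 * \<eta>\<^sup>2) * emeasure lborel {0..t} = ennreal (2 * \<eta>\<^sup>2 * t)"
      using t by (simp add: ennreal_mult'[symmetric])
    finally show "ennreal (V \<omega>) \<le> 2 * (\<integral>\<^sup>+ s\<in>{0..t}. ennreal ((H' s \<omega> - H s \<omega>)\<^sup>2) \<partial>lborel) + ennreal (2 * \<eta>\<^sup>2 * t)" .
  qed
qed

text \<open>The integrals \<open>J' k\<close> of the given simple processes converge to
  \<open>I\<close>, and their distance to the Riemann sums vanishes in probability because the
  quadratic variation \<open>V k\<close> of the difference does.\<close>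

lemma ito_integral_riemann:
  assumes t: "0 \<le> t" "t \<le> real T" and ito: "has_ito_integral M F B H t I"
    and H: "\<And>\<omega>. \<omega> \<in> space M \<Longrightarrow> continuous_on {0..t} (\<lambda>s. H s \<omega>)"
  shows "tends_to_zero_in_prob M (\<lambda>k \<omega>. ennreal \<bar>ito_sum H t T k \<omega> - I \<omega>\<bar>)"
proof -
  have HF: "\<And>s. s \<in> {0..t} \<Longrightarrow> H s \<in> borel_measurable (F s)"
    and HM: "(\<lambda>(s, \<omega>). H s \<omega>) \<in> borel_measurable (restrict_space borel {0..t} \<Otimes>\<^sub>M M)"
    and [measurable]: "I \<in> borel_measurable M"
    using ito unfolding has_ito_integral_def by auto
  obtain H' J' where simple: "\<And>k. simple_ito M F B t (H' k) (J' k)"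
    and A0: "tends_to_zero_in_prob M (\<lambda>k \<omega>. \<integral>\<^sup>+ s\<in>{0..t}. ennreal ((H' k s \<omega> - H s \<omega>)\<^sup>2) \<partial>lborel)"
    and J0: "tends_to_zero_in_prob M (\<lambda>k \<omega>. ennreal \<bar>J' k \<omega> - I \<omega>\<bar>)"
    using ito unfolding has_ito_integral_def by blast
  define A where "A k \<omega> = (\<integral>\<^sup>+ s\<in>{0..t}. ennreal ((H' k s \<omega> - H s \<omega>)\<^sup>2) \<partial>lborel)" for k \<omega>
  have [measurable]: "A k \<in> borel_measurable M" for k
    unfolding A_def by (rule L2_distance_measurable[OF t(1) simple HM])
  have "\<exists>V. V \<in> borel_measurable M \<and>
    (\<forall>\<delta> \<epsilon>. \<delta> \<ge> 0 \<longrightarrow> \<epsilon> > 0 \<longrightarrow>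
      prob {\<omega> \<in> space M. \<epsilon> < \<bar>J' k \<omega> - ito_sum H t T k \<omega>\<bar>} \<le> prob {\<omega> \<in> space M. \<delta> < V \<omega>} + \<delta> / \<epsilon>\<^sup>2) \<and>
    (\<forall>\<omega> \<eta>. \<omega> \<in> space M \<longrightarrow> \<eta> \<ge> 0 \<longrightarrow>
      (\<forall>j s. min t (grid k j) \<le> s \<and> s \<le> min t (grid k (Suc j)) \<longrightarrow>
        \<bar>H s \<omega> - clip k (H (min t (grid k j)) \<omega>)\<bar> \<le> \<eta>) \<longrightarrow>
      ennreal (V \<omega>) \<le> 2 * A k \<omega> + ennreal (2 * \<eta>\<^sup>2 * t))" for k
    unfolding A_def by (rule simple_ito_minus_ito_sum[OF t simple[of k] HF H])
  from choice[OF allI[OF this]] obtain V where VV: "\<forall>k. V k \<in> borel_measurable M \<and>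
    (\<forall>\<delta> \<epsilon>. \<delta> \<ge> 0 \<longrightarrow> \<epsilon> > 0 \<longrightarrow>
      prob {\<omega> \<in> space M. \<epsilon> < \<bar>J' k \<omega> - ito_sum H t T k \<omega>\<bar>} \<le> prob {\<omega> \<in> space M. \<delta> < V k \<omega>} + \<delta> / \<epsilon>\<^sup>2) \<and>
    (\<forall>\<omega> \<eta>. \<omega> \<in> space M \<longrightarrow> \<eta> \<ge> 0 \<longrightarrow>
      (\<forall>j s. min t (grid k j) \<le> s \<and> s \<le> min t (grid k (Suc j)) \<longrightarrow>
        \<bar>H s \<omega> - clip k (H (min t (grid k j)) \<omega>)\<bar> \<le> \<eta>) \<longrightarrow>
      ennreal (V k \<omega>) \<le> 2 * A k \<omega> + ennreal (2 * \<eta>\<^sup>2 * t))" ..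
  have [measurable]: "\<And>k. V k \<in> borel_measurable M"
    and V1: "\<And>k \<delta> \<epsilon>. \<delta> \<ge> 0 \<Longrightarrow> \<epsilon> > 0 \<Longrightarrow>
      prob {\<omega> \<in> space M. \<epsilon> < \<bar>J' k \<omega> - ito_sum H t T k \<omega>\<bar>} \<le> prob {\<omega> \<in> space M. \<delta> < V k \<omega>} + \<delta> / \<epsilon>\<^sup>2"
    and V2: "\<And>k \<omega> \<eta>. \<omega> \<in> space M \<Longrightarrow> \<eta> \<ge> 0 \<Longrightarrow>
      (\<forall>j s. min t (grid k j) \<le> s \<and> s \<le> min t (grid k (Suc j)) \<longrightarrow>
        \<bar>H s \<omega> - clip k (H (min t (grid k j)) \<omega>)\<bar> \<le> \<eta>) \<Longrightarrow>
      ennreal (V k \<omega>) \<le> 2 * A k \<omega> + ennreal (2 * \<eta>\<^sup>2 * t)"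
    using VV by simp_all
  have V0: "(\<lambda>k. prob {\<omega> \<in> space M. \<delta> < V k \<omega>}) \<longlonglongrightarrow> 0" if \<delta>: "\<delta> > 0" for \<delta>
  proof -
    \<comment> \<open>The event that \<open>V k\<close> is large although the simple process is
      close to \<open>H\<close>. Every single path eventually leaves it, so its probability tends to
      zero by dominated convergence.\<close>
    define E where "E k = {\<omega> \<in> space M. \<delta> < V k \<omega> \<and> \<not> ennreal (\<delta> / 4) < A k \<omega>}" for k
    have [measurable]: "E k \<in> events" for k unfolding E_def by measurable
    have "(\<lambda>k. \<integral>\<omega>. indicator (E k) \<omega> \<partial>M) \<longlonglongrightarrow> (\<integral>\<omega>. 0 \<partial>M :: real)"
    proof (rule integral_dominated_convergence[where w = "\<lambda>_. 1"])
      show "AE \<omega> in M. (\<lambda>k. indicator (E k) \<omega> :: real) \<longlonglongrightarrow> 0"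
      proof (rule AE_I2)
        fix \<omega> assume \<omega>: "\<omega> \<in> space M"
        \<comment> \<open>This \<eta> makes the mesh error at most \<delta>/4. With
          \<open>A k\<close> at most \<delta>/4, counted twice, \<open>V k\<close> stays at or below
          3\<delta>/4.\<close>
        define \<eta> where "\<eta> = sqrt (\<delta> / (8 * (t + 1)))"
        have \<eta>: "\<eta> > 0" using \<delta> t by (simp add: \<eta>_def)
        have "2 * \<eta>\<^sup>2 * t \<le> \<delta> / 4"
          using \<delta> t by (simp add: \<eta>_def field_simps)
        have "eventually (\<lambda>k. \<omega> \<notin> E k) sequentially"
          using clip_grid_uniform[OF H[OF \<omega>] \<eta> t(1)]
        proof eventually_elim
          case (elim k)
          have le: "ennreal (V k \<omega>) \<le> 2 * A k \<omega> + ennreal (2 * \<eta>\<^sup>2 * t)"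
            using elim \<eta> by (intro V2[OF \<omega>]) auto
          show ?case
          proof
            assume "\<omega> \<in> E k"
            then have "\<delta> < V k \<omega>" "A k \<omega> \<le> ennreal (\<delta> / 4)" by (auto simp: E_def not_less)
            then have "ennreal (V k \<omega>) \<le> 2 * ennreal (\<delta> / 4) + ennreal (\<delta> / 4)"
              using le \<open>2 * \<eta>\<^sup>2 * t \<le> \<delta> / 4\<close>
              by (intro order_trans[OF le] add_mono mult_left_mono ennreal_leI) auto
            also have "2 * ennreal (\<delta> / 4) = ennreal (2 * (\<delta> / 4))"
              using \<delta> by (subst ennreal_mult) auto
            also have "ennreal (2 * (\<delta> / 4)) + ennreal (\<delta> / 4) = ennreal (2 * (\<delta> / 4) + \<delta> / 4)"
              using \<delta> by (intro ennreal_plus[symmetric]) auto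
            finally have "V k \<omega> \<le> 2 * (\<delta> / 4) + \<delta> / 4" using \<delta> by (subst (asm) ennreal_le_iff) auto
            then show False using \<open>\<delta> < V k \<omega>\<close> \<delta> by simp
          qed
        qed
        then have "eventually (\<lambda>k. indicator (E k) \<omega> = (0 :: real)) sequentially"
          by eventually_elim (simp add: indicator_def)
        then show "(\<lambda>k. indicator (E k) \<omega> :: real) \<longlonglongrightarrow> 0"
          by (rule tendsto_eventually)
      qed
    qed (auto simp: indicator_def)
    then have E0: "(\<lambda>k. prob (E k)) \<longlonglongrightarrow> 0" by simp
    have A0': "(\<lambda>k. prob {\<omega> \<in> space M. ennreal (\<delta> / 4) < A k \<omega>}) \<longlonglongrightarrow> 0"
      using A0 \<delta> unfolding tends_to_zero_in_prob_def A_def[symmetric] by simp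
    have lim: "(\<lambda>k. prob {\<omega> \<in> space M. ennreal (\<delta> / 4) < A k \<omega>} + prob (E k)) \<longlonglongrightarrow> 0"
      using tendsto_add[OF A0' E0] by simp
    show ?thesis
    proof (rule tendsto_sandwich[OF _ _ tendsto_const lim])
      show "eventually (\<lambda>k. prob {\<omega> \<in> space M. \<delta> < V k \<omega>} \<le>
        prob {\<omega> \<in> space M. ennreal (\<delta> / 4) < A k \<omega>} + prob (E k)) sequentially"
      proof (intro always_eventually allI)
        fix k
        have "prob {\<omega> \<in> space M. \<delta> < V k \<omega>} \<le> prob ({\<omega> \<in> space M. ennreal (\<delta> / 4) < A k \<omega>} \<union> E k)"
          by (intro finite_measure_mono) (auto simp: E_def)
        also have "\<dots> \<le> prob {\<omega> \<in> space M. ennreal (\<delta> / 4) < A k \<omega>} + prob (E k)"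
          by (intro measure_Un_le) auto
        finally show "prob {\<omega> \<in> space M. \<delta> < V k \<omega>} \<le> \<dots>" .
      qed
    qed simp
  qed
  have J1: "tends_to_zero_in_prob M (\<lambda>k \<omega>. ennreal \<bar>J' k \<omega> - ito_sum H t T k \<omega>\<bar>)"
    unfolding tends_to_zero_in_prob_real
  proof (intro allI impI)
    fix \<epsilon> :: real assume \<epsilon>: "\<epsilon> > 0"
    show "(\<lambda>k. prob {\<omega> \<in> space M. \<epsilon> < \<bar>J' k \<omega> - ito_sum H t T k \<omega>\<bar>}) \<longlonglongrightarrow> 0"
    proof (rule LIMSEQ_I)
      fix \<gamma> :: real assume \<gamma>: "\<gamma> > 0"
      \<comment> \<open>Chosen so that the second term of the tail bound equals \<gamma>/2.\<close>
      define \<delta> where "\<delta> = \<gamma> * \<epsilon>\<^sup>2 / 2"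
      have \<delta>: "\<delta> > 0" "\<delta> / \<epsilon>\<^sup>2 = \<gamma> / 2" using \<gamma> \<epsilon> by (auto simp: \<delta>_def)
      obtain k0 where k0: "\<And>k. k \<ge> k0 \<Longrightarrow> prob {\<omega> \<in> space M. \<delta> < V k \<omega>} < \<gamma> / 2"
        using LIMSEQ_D[OF V0[OF \<delta>(1)], of "\<gamma> / 2"] \<gamma> by auto
      have "norm (prob {\<omega> \<in> space M. \<epsilon> < \<bar>J' k \<omega> - ito_sum H t T k \<omega>\<bar>} - 0) < \<gamma>" if "k \<ge> k0" for k
        using V1[of \<delta> \<epsilon> k] k0[OF that] \<delta> \<epsilon> by simp
      then show "\<exists>k0. \<forall>k\<ge>k0. norm (prob {\<omega> \<in> space M. \<epsilon> < \<bar>J' k \<omega> - ito_sum H t T k \<omega>\<bar>} - 0) < \<gamma>"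
        by blast
    qed
  qed
  have [measurable]: "J' k \<in> borel_measurable M" for k
  proof -
    obtain N \<tau> \<xi> where \<tau>: "0 \<le> \<tau> 0" "\<And>i. i < N \<Longrightarrow> \<tau> i < \<tau> (Suc i)"
      and \<xi>: "\<And>i. i < N \<Longrightarrow> \<xi> i \<in> borel_measurable (F (\<tau> i))"
      and J': "J' k = (\<lambda>\<omega>. \<Sum>i<(N::nat). \<xi> i \<omega> * (B (min t (\<tau> (Suc i))) \<omega> - B (min t (\<tau> i)) \<omega>))"
      using simple[of k] unfolding simple_ito_def by blast
    have t0: "0 \<le> \<tau> i" if "i \<le> N" for i
      using le_if_Suc_le[of N \<tau> 0 i] \<tau> that by force
    show ?thesis unfolding J'
      by (intro borel_measurable_sum borel_measurable_times borel_measurable_diff B_measurable adapted_M[OF t0 \<xi>])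
        (use t t0 in auto)
  qed
  have [measurable]: "ito_sum H t T k \<in> borel_measurable M" for k
    unfolding ito_sum_def esum_def[abs_def]
  proof (intro borel_measurable_sum borel_measurable_times borel_measurable_diff B_measurable)
    fix i
    have u: "min t (grid k i) \<in> {0..t}" using t grid_simps(2) by simp
    then have [measurable]: "H (min t (grid k i)) \<in> borel_measurable M"
      using adapted_M[OF _ HF[OF u]] by simp
    show "(\<lambda>\<omega>. clip k (H (min t (grid k i)) \<omega>)) \<in> borel_measurable M" by measurable
  qed (use t grid_simps(2) in auto)
  show ?thesis
    by (rule tends_to_zero_in_prob_add[OF _ _ J1 J0]) auto
qed

end

section \<open>Second moments of increments\<close>

text \<open>The uniform grid clamped to \<open>{s..t}\<close>; cells outside the interval collapse
  to a point. Increments of integrals from \<open>s\<close> to \<open>t\<close> are summed over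
  these cells.\<close>

definition window :: "real \<Rightarrow> real \<Rightarrow> nat \<Rightarrow> nat \<Rightarrow> real" where
  "window s t k i = max s (min t (grid k i))"

lemma window_simps:
  assumes "0 \<le> s" "s \<le> t"
  shows "window s t k 0 = s" "window s t k i \<in> {s..t}" "window s t k i \<le> window s t k (Suc i)"
    "t \<le> real T \<Longrightarrow> window s t k (T * Suc k) = t"
    "window s t k (Suc i) - window s t k i \<le> 1 / real (Suc k)"
proof -
  show "window s t k 0 = s" "window s t k i \<in> {s..t}" "window s t k i \<le> window s t k (Suc i)"
    using assms grid_simps(5)[of k i] by (auto simp: window_def grid_simps(1))
  show "t \<le> real T \<Longrightarrow> window s t k (T * Suc k) = t"
    using assms unfolding window_def grid_simps by simp
  define d where "d = 1 / real (Suc k)"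
  have "0 \<le> d" by (simp add: d_def)
  then show "window s t k (Suc i) - window s t k i \<le> 1 / real (Suc k)"
    unfolding window_def grid_simps(3) d_def[symmetric] by (auto simp: max_def min_def)
qed

lemma window_sum:
  assumes "0 \<le> s" "s \<le> t" "t \<le> real T"
  shows "(\<Sum>i<T * Suc k. window s t k (Suc i) - window s t k i) = t - s"
  using sum_lessThan_telescope[of "window s t k" "T * Suc k"] window_simps[OF assms(1,2)] assms(3) by simp

text \<open>The integrand is sampled at unclamped grid points, so on the cell containing
  \<open>s\<close> the sample is taken up to one mesh before \<open>s\<close>. Therefore the bound
  on \<open>g\<close> must hold slightly to the left of \<open>s\<close>, and the claim holds for
  fine grids only.\<close>

lemma window_sum_const_le:
  assumes "0 \<le> s" "s \<le> t" "t \<le> real T" "\<eta> > 0"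
    and g: "\<And>u. max 0 (s - \<eta>) \<le> u \<Longrightarrow> u \<le> t \<Longrightarrow> g u \<le> c"
  shows "eventually (\<lambda>k. (\<Sum>i<T * Suc k. g (min t (grid k i)) * (window s t k (Suc i) - window s t k i)) \<le> c * (t - s)) sequentially"
proof -
  obtain k1 where k1: "1 / real (Suc k1) < \<eta>" using assms nat_approx_posE by blast
  show ?thesis
  proof (rule eventually_sequentiallyI[of k1])
    fix k assume k: "k1 \<le> k"
    have "1 / real (Suc k) \<le> 1 / real (Suc k1)" using k by (intro divide_left_mono) auto
    then have k\<eta>: "1 / real (Suc k) < \<eta>" using k1 by simp
    have "(\<Sum>i<T * Suc k. g (min t (grid k i)) * (window s t k (Suc i) - window s t k i)) \<le>
      (\<Sum>i<T * Suc k. c * (window s t k (Suc i) - window s t k i))"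
    proof (rule sum_mono)
      fix i
      show "g (min t (grid k i)) * (window s t k (Suc i) - window s t k i) \<le> c * (window s t k (Suc i) - window s t k i)"
      proof (cases "grid k (Suc i) \<le> s")
        case True
        then have "window s t k (Suc i) - window s t k i = 0"
          using grid_simps(5)[of k i] assms by (simp add: window_def)
        then show ?thesis by simp
      next
        case False
        then have "s - \<eta> \<le> min t (grid k i)" using k\<eta> assms unfolding grid_simps(3) by auto
        then have "g (min t (grid k i)) \<le> c" using grid_simps(2)[of k i] assms by (intro g) auto
        then show ?thesis using window_simps(3)[OF assms(1,2)] by (intro mult_right_mono) auto
      qed
    qed
    also have "\<dots> = c * (t - s)"
      using window_sum[OF assms(1-3)] by (simp flip: sum_distrib_left)
    finally show "(\<Sum>i<T * Suc k. g (min t (grid k i)) * (window s t k (Suc i) - window s t k i)) \<le> c * (t - s)" .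
  qed
qed

text \<open>A left Riemann sum of an increasing function is below its integral; here
  \<open>1 + z \<le> exp z\<close> on each cell gives it directly as a telescoping sum.\<close>

lemma window_sum_exp_le:
  assumes "0 \<le> t" "t \<le> real T" "\<kappa> > 0" "c \<ge> 0"
  shows "(\<Sum>i<T * Suc k. (c * exp (\<kappa> * min t (grid k i))) * (window 0 t k (Suc i) - window 0 t k i)) \<le> c * exp (\<kappa> * t) / \<kappa>"
proof -
  let ?w = "window 0 t k"
  have w: "min t (grid k i) = ?w i" for i
    using assms grid_simps(2)[of k i] by (simp add: window_def)
  have "(\<Sum>i<T * Suc k. (c * exp (\<kappa> * min t (grid k i))) * (?w (Suc i) - ?w i)) \<le>
    (\<Sum>i<T * Suc k. c / \<kappa> * exp (\<kappa> * ?w (Suc i)) - c / \<kappa> * exp (\<kappa> * ?w i))"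
    unfolding w
  proof (rule sum_mono)
    fix i
    have "1 + \<kappa> * (?w (Suc i) - ?w i) \<le> exp (\<kappa> * (?w (Suc i) - ?w i))"
      by (rule exp_ge_add_one_self)
    then have "exp (\<kappa> * ?w i) * (1 + \<kappa> * (?w (Suc i) - ?w i)) \<le> exp (\<kappa> * ?w i) * exp (\<kappa> * (?w (Suc i) - ?w i))"
      by (intro mult_left_mono) auto
    also have "\<dots> = exp (\<kappa> * ?w (Suc i))" by (simp add: algebra_simps flip: exp_add)
    finally have "exp (\<kappa> * ?w i) * (\<kappa> * (?w (Suc i) - ?w i)) \<le> exp (\<kappa> * ?w (Suc i)) - exp (\<kappa> * ?w i)"
      by (simp add: algebra_simps)
    then have "c / \<kappa> * (exp (\<kappa> * ?w i) * (\<kappa> * (?w (Suc i) - ?w i))) \<le>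
      c / \<kappa> * (exp (\<kappa> * ?w (Suc i)) - exp (\<kappa> * ?w i))"
      using assms by (intro mult_left_mono) auto
    then show "c * exp (\<kappa> * ?w i) * (?w (Suc i) - ?w i) \<le>
      c / \<kappa> * exp (\<kappa> * ?w (Suc i)) - c / \<kappa> * exp (\<kappa> * ?w i)"
      using assms(3) by (simp add: right_diff_distrib mult.assoc)
  qed
  also have "\<dots> = c / \<kappa> * exp (\<kappa> * ?w (T * Suc k)) - c / \<kappa> * exp (\<kappa> * ?w 0)"
    by (rule sum_lessThan_telescope)
  also have "\<dots> \<le> c * exp (\<kappa> * t) / \<kappa>"
  proof -
    have "?w (T * Suc k) = t" using window_simps(4)[OF order_refl assms(1,2)] .
    moreover have "0 \<le> c / \<kappa> * exp (\<kappa> * ?w 0)" using assms by simp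
    ultimately show ?thesis by simp
  qed
  finally show ?thesis .
qed

lemma riemann_sum_tendsto:
  fixes f :: "real \<Rightarrow> real"
  assumes st: "0 \<le> s" "s \<le> t" "t \<le> real T" and f: "continuous_on {s..t} f"
  shows "(\<lambda>k. \<Sum>i<T * Suc k. f (window s t k i) * (window s t k (Suc i) - window s t k i))
    \<longlonglongrightarrow> (LINT u:{s..t}|lborel. f u)"
proof (rule LIMSEQ_I)
  fix e :: real assume e: "e > 0"
  define \<eta> where "\<eta> = e / (t - s + 1)"
  have \<eta>: "\<eta> > 0" using e st by (simp add: \<eta>_def)
  have "uniformly_continuous_on {s..t} f" by (intro compact_uniformly_continuous f) auto
  then obtain \<delta> where \<delta>: "\<delta> > 0" "\<And>x y. x \<in> {s..t} \<Longrightarrow> y \<in> {s..t} \<Longrightarrow> dist x y < \<delta> \<Longrightarrow> dist (f x) (f y) < \<eta>"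
    using \<eta> unfolding uniformly_continuous_on_def by blast
  obtain k0 where k0: "1 / real (Suc k0) < \<delta>" using \<delta>(1) nat_approx_posE by blast
  define G where "G x = integral {s..x} f" for x
  have G: "(G has_vector_derivative f x) (at x within {s..t})" if "x \<in> {s..t}" for x
    unfolding G_def by (rule integral_has_vector_derivative[OF f that])
  have int: "(LINT u:{s..t}|lborel. f u) = G t"
  proof -
    have "set_integrable lborel {s..t} f" by (rule borel_integrable_atLeastAtMost'[OF f])
    then show ?thesis unfolding G_def by (rule set_borel_integral_eq_integral(2))
  qed
  have "norm ((\<Sum>i<T * Suc k. f (window s t k i) * (window s t k (Suc i) - window s t k i)) - G t) < e" if k: "k \<ge> k0" for k
  proof -
    let ?w = "window s t k"
    have "1 / real (Suc k) \<le> 1 / real (Suc k0)" using k by (intro divide_left_mono) auto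
    then have k\<delta>: "1 / real (Suc k) < \<delta>" using k0 by simp
    \<comment> \<open>The mean value theorem for the antiderivative \<open>G\<close> turns the error
      of a cell into an oscillation of \<open>f\<close> over that cell.\<close>
    have piece: "\<bar>f (?w i) * (?w (Suc i) - ?w i) - (G (?w (Suc i)) - G (?w i))\<bar> \<le> \<eta> * (?w (Suc i) - ?w i)" for i
    proof -
      have w: "?w i \<in> {s..t}" "?w (Suc i) \<in> {s..t}" "?w i \<le> ?w (Suc i)"
        using window_simps[OF st(1,2)] by blast+
      have "\<exists>x\<in>{?w i..?w (Suc i)}. G (?w (Suc i)) - G (?w i) = (\<lambda>h. h * f x) (?w (Suc i) - ?w i)"
      proof (rule mvt_very_simple[OF w(3)])
        fix x assume "?w i \<le> x" "x \<le> ?w (Suc i)"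
        then have "x \<in> {s..t}" using w by auto
        from G[OF this] have "(G has_derivative (\<lambda>h. h * f x)) (at x within {s..t})"
          by (simp add: has_vector_derivative_def)
        then show "(G has_derivative (\<lambda>h. h * f x)) (at x within {?w i..?w (Suc i)})"
          by (rule has_derivative_subset) (use w in auto)
      qed
      then obtain x where x: "x \<in> {?w i..?w (Suc i)}" "G (?w (Suc i)) - G (?w i) = (?w (Suc i) - ?w i) * f x" by blast
      have "x \<in> {s..t}" using x w by auto
      moreover have "dist (?w i) x < \<delta>"
        using x(1) window_simps(5)[OF st(1,2), of k i] k\<delta> by (simp add: dist_real_def)
      ultimately have "\<bar>f (?w i) - f x\<bar> \<le> \<eta>" using \<delta>(2)[OF w(1)] by (fastforce simp: dist_real_def)
      then have "\<bar>f (?w i) - f x\<bar> * (?w (Suc i) - ?w i) \<le> \<eta> * (?w (Suc i) - ?w i)"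
        using w by (intro mult_right_mono) auto
      moreover have "f (?w i) * (?w (Suc i) - ?w i) - (G (?w (Suc i)) - G (?w i)) = (f (?w i) - f x) * (?w (Suc i) - ?w i)"
        by (simp add: x(2) algebra_simps)
      ultimately show ?thesis using w by (simp add: abs_mult)
    qed
    have tel: "(\<Sum>i<T * Suc k. G (?w (Suc i)) - G (?w i)) = G t"
    proof -
      have "(\<Sum>i<T * Suc k. G (?w (Suc i)) - G (?w i)) = G (?w (T * Suc k)) - G (?w 0)"
        by (rule sum_lessThan_telescope)
      moreover have "G s = 0" by (simp add: G_def)
      ultimately show ?thesis using window_simps(1)[OF st(1,2)] window_simps(4)[OF st] by simp
    qed
    have "\<bar>(\<Sum>i<T * Suc k. f (?w i) * (?w (Suc i) - ?w i)) - G t\<bar> =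
      \<bar>\<Sum>i<T * Suc k. f (?w i) * (?w (Suc i) - ?w i) - (G (?w (Suc i)) - G (?w i))\<bar>"
      unfolding tel[symmetric] by (simp only: sum_subtractf)
    also have "\<dots> \<le> (\<Sum>i<T * Suc k. \<eta> * (?w (Suc i) - ?w i))"
      by (rule order_trans[OF sum_abs sum_mono]) (rule piece)
    also have "\<dots> = \<eta> * (t - s)" using window_sum[OF st] by (simp flip: sum_distrib_left)
    also have "\<dots> < e" using e st by (simp add: \<eta>_def field_simps)
    finally show ?thesis by simp
  qed
  then show "\<exists>k0. \<forall>k\<ge>k0. norm ((\<Sum>i<T * Suc k. f (window s t k i) * (window s t k (Suc i) - window s t k i)) -
    (LINT u:{s..t}|lborel. f u)) < e"
    unfolding int by blast
qed

text \<open>A pointwise limit of Riemann sums only uses the time sections of \<open>f\<close>. It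
  can thus be applied with \<open>N\<close> a member of the filtration, where no joint measurability
  is at hand.\<close>

lemma riemann_integral_measurable:
  fixes f :: "real \<Rightarrow> 'w \<Rightarrow> real"
  assumes st: "0 \<le> s" "s \<le> t" and f: "\<And>u. u \<in> {s..t} \<Longrightarrow> f u \<in> borel_measurable N"
    and cont: "\<And>\<omega>. \<omega> \<in> space N \<Longrightarrow> continuous_on {s..t} (\<lambda>u. f u \<omega>)"
  shows "(\<lambda>\<omega>. LINT u:{s..t}|lborel. f u \<omega>) \<in> borel_measurable N"
proof -
  obtain T where T: "t \<le> real T" using real_arch_simple by blast
  show ?thesis
  proof (rule borel_measurable_LIMSEQ_real)
    show "(\<lambda>k. \<Sum>i<T * Suc k. f (window s t k i) \<omega> * (window s t k (Suc i) - window s t k i))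
      \<longlonglongrightarrow> (LINT u:{s..t}|lborel. f u \<omega>)" if "\<omega> \<in> space N" for \<omega>
      by (rule riemann_sum_tendsto[OF st T cont[OF that]])
    show "(\<lambda>\<omega>. \<Sum>i<T * Suc k. f (window s t k i) \<omega> * (window s t k (Suc i) - window s t k i)) \<in> borel_measurable N" for k
      using f[OF window_simps(2)[OF st]] by measurable
  qed
qed

lemma sum_weighted_square_le:
  fixes a w :: "nat \<Rightarrow> real"
  assumes "\<And>i. i < N \<Longrightarrow> 0 \<le> w i"
  shows "(\<Sum>i<N. a i * w i)\<^sup>2 \<le> (\<Sum>i<N. w i) * (\<Sum>i<N. (a i)\<^sup>2 * w i)"
proof -
  have "(\<Sum>i<N. sqrt (w i) * (a i * sqrt (w i)))\<^sup>2 \<le> (\<Sum>i<N. (sqrt (w i))\<^sup>2) * (\<Sum>i<N. (a i * sqrt (w i))\<^sup>2)"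
    by (rule Cauchy_Schwarz_ineq_sum)
  moreover have "(\<Sum>i<N. sqrt (w i) * (a i * sqrt (w i))) = (\<Sum>i<N. a i * w i)"
    using assms by (intro sum.cong refl) (simp add: mult.left_commute)
  moreover have "(\<Sum>i<N. (sqrt (w i))\<^sup>2) = (\<Sum>i<N. w i)" using assms by (intro sum.cong refl) simp
  moreover have "(\<Sum>i<N. (a i * sqrt (w i))\<^sup>2) = (\<Sum>i<N. (a i)\<^sup>2 * w i)"
    using assms by (intro sum.cong refl) (simp add: power_mult_distrib)
  ultimately show ?thesis by simp
qed

text \<open>Truncation without stopping. The events \<open>A u\<close> decrease, so on
  \<open>A t\<close> cutting each sample by its own \<open>A u\<close> changes nothing, and only the
  truncated moments bounded by \<open>g\<close> enter. The factor \<open>t - s\<close> comes from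
  Cauchy-Schwarz in time, the passage to the limit from Fatou.\<close>

lemma (in prob_space) drift_second_moment:
  fixes f :: "real \<Rightarrow> 'a \<Rightarrow> real" and A :: "real \<Rightarrow> 'a set"
  assumes st: "0 \<le> s" "s \<le> t" "t \<le> real T"
    and f: "\<And>u. u \<in> {s..t} \<Longrightarrow> f u \<in> borel_measurable M"
    and cont: "\<And>\<omega>. \<omega> \<in> space M \<Longrightarrow> continuous_on {s..t} (\<lambda>u. f u \<omega>)"
    and A: "\<And>u. u \<in> {s..t} \<Longrightarrow> A u \<in> events" "\<And>u v. s \<le> u \<Longrightarrow> u \<le> v \<Longrightarrow> v \<le> t \<Longrightarrow> A v \<subseteq> A u"
    and g: "\<And>u. u \<in> {s..t} \<Longrightarrow> L2 M (\<lambda>\<omega>. f u \<omega> * indicator (A u) \<omega>)"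
      "\<And>u. u \<in> {s..t} \<Longrightarrow> (\<integral>\<omega>. (f u \<omega> * indicator (A u) \<omega>)\<^sup>2 \<partial>M) \<le> g u"
    and C: "eventually (\<lambda>k. (\<Sum>i<T * Suc k. g (window s t k i) * (window s t k (Suc i) - window s t k i)) \<le> C) sequentially"
  shows "L2 M (\<lambda>\<omega>. (LINT u:{s..t}|lborel. f u \<omega>) * indicator (A t) \<omega>)"
    "(\<integral>\<omega>. ((LINT u:{s..t}|lborel. f u \<omega>) * indicator (A t) \<omega>)\<^sup>2 \<partial>M) \<le> (t - s) * C"
proof -
  define a where "a u \<omega> = f u \<omega> * indicator (A u) \<omega>" for u \<omega>
  define R where "R k \<omega> = (\<Sum>i<T * Suc k. a (window s t k i) \<omega> * (window s t k (Suc i) - window s t k i)) * indicator (A t) \<omega>" for k \<omega>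
  note w = window_simps[OF st(1,2)]
  have At[measurable]: "A t \<in> events" using A st by simp
  have aL: "L2 M (a (window s t k i))" for k i unfolding a_def by (rule g(1)[OF w(2)])
  have SL: "L2 M (\<lambda>\<omega>. \<Sum>i<T * Suc k. a (window s t k i) \<omega> * (window s t k (Suc i) - window s t k i))" for k
  proof (rule L2_sum)
    fix i
    show "L2 M (\<lambda>\<omega>. a (window s t k i) \<omega> * (window s t k (Suc i) - window s t k i))"
      using L2_cmult[OF aL[of k i], of "window s t k (Suc i) - window s t k i"] by (simp add: mult.commute)
  qed
  have RL: "L2 M (R k)" for k
  proof (rule L2_dominated[OF SL])
    show "R k \<in> borel_measurable M" unfolding R_def using SL[of k] by (intro borel_measurable_times) (auto simp: L2_def)
    show "\<bar>R k \<omega>\<bar> \<le> \<bar>\<Sum>i<T * Suc k. a (window s t k i) \<omega> * (window s t k (Suc i) - window s t k i)\<bar>" for \<omega>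
      by (simp add: R_def indicator_def)
  qed
  have RC: "eventually (\<lambda>k. (\<integral>\<omega>. (R k \<omega>)\<^sup>2 \<partial>M) \<le> (t - s) * C) sequentially"
    using C
  proof eventually_elim
    case (elim k)
    let ?w = "window s t k"
    have int: "integrable M (\<lambda>\<omega>. (a (?w i) \<omega>)\<^sup>2 * (?w (Suc i) - ?w i))" for i
      using L2_integrable[OF aL[of k i]] by simp
    have "(\<integral>\<omega>. (R k \<omega>)\<^sup>2 \<partial>M) \<le> (\<integral>\<omega>. (t - s) * (\<Sum>i<T * Suc k. (a (?w i) \<omega>)\<^sup>2 * (?w (Suc i) - ?w i)) \<partial>M)"
    proof (rule integral_mono)
      show "integrable M (\<lambda>\<omega>. (R k \<omega>)\<^sup>2)" using RL by (rule L2_integrable)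
      show "integrable M (\<lambda>\<omega>. (t - s) * (\<Sum>i<T * Suc k. (a (?w i) \<omega>)\<^sup>2 * (?w (Suc i) - ?w i)))"
        using int by (intro integrable_mult_right Bochner_Integration.integrable_sum) auto
      fix \<omega>
      have "(R k \<omega>)\<^sup>2 \<le> (\<Sum>i<T * Suc k. a (?w i) \<omega> * (?w (Suc i) - ?w i))\<^sup>2"
        by (simp add: R_def indicator_def)
      also have "\<dots> \<le> (\<Sum>i<T * Suc k. ?w (Suc i) - ?w i) * (\<Sum>i<T * Suc k. (a (?w i) \<omega>)\<^sup>2 * (?w (Suc i) - ?w i))"
        using w(3) by (intro sum_weighted_square_le) simp
      also have "(\<Sum>i<T * Suc k. ?w (Suc i) - ?w i) = t - s" by (rule window_sum[OF st])
      finally show "(R k \<omega>)\<^sup>2 \<le> (t - s) * (\<Sum>i<T * Suc k. (a (?w i) \<omega>)\<^sup>2 * (?w (Suc i) - ?w i))" .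
    qed
    also have "\<dots> = (t - s) * (\<Sum>i<T * Suc k. (\<integral>\<omega>. (a (?w i) \<omega>)\<^sup>2 \<partial>M) * (?w (Suc i) - ?w i))"
      using int by (subst integral_mult_right_zero, subst Bochner_Integration.integral_sum) auto
    also have "\<dots> \<le> (t - s) * (\<Sum>i<T * Suc k. g (?w i) * (?w (Suc i) - ?w i))"
      using st w g(2)[OF w(2)] unfolding a_def
      by (intro mult_left_mono sum_mono mult_right_mono) auto
    also have "\<dots> \<le> (t - s) * C" using st elim by (intro mult_left_mono) auto
    finally show ?case .
  qed
  have lim: "AE \<omega> in M. (\<lambda>k. R k \<omega>) \<longlonglongrightarrow> (LINT u:{s..t}|lborel. f u \<omega>) * indicator (A t) \<omega>"
  proof (rule AE_I2)
    fix \<omega> assume \<omega>: "\<omega> \<in> space M"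
    show "(\<lambda>k. R k \<omega>) \<longlonglongrightarrow> (LINT u:{s..t}|lborel. f u \<omega>) * indicator (A t) \<omega>"
    proof (cases "\<omega> \<in> A t")
      case True
      then have "\<omega> \<in> A (window s t k i)" for k i using A(2)[of "window s t k i" t] w(2)[of k i] by auto
      then have "R k \<omega> = (\<Sum>i<T * Suc k. f (window s t k i) \<omega> * (window s t k (Suc i) - window s t k i))" for k
        using True by (simp add: R_def a_def)
      then show ?thesis using riemann_sum_tendsto[OF st cont[OF \<omega>]] True by simp
    qed (simp add: R_def)
  qed
  have [measurable]: "(\<lambda>\<omega>. LINT u:{s..t}|lborel. f u \<omega>) \<in> borel_measurable M"
    by (rule riemann_integral_measurable[OF st(1,2) f cont])
  show "L2 M (\<lambda>\<omega>. (LINT u:{s..t}|lborel. f u \<omega>) * indicator (A t) \<omega>)"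
    "(\<integral>\<omega>. ((LINT u:{s..t}|lborel. f u \<omega>) * indicator (A t) \<omega>)\<^sup>2 \<partial>M) \<le> (t - s) * C"
    using L2_fatou[OF RL RC lim] by auto
qed

lemma (in prob_space) drift_second_moment_const:
  fixes f :: "real \<Rightarrow> 'a \<Rightarrow> real"
  assumes st: "0 \<le> s" "s \<le> t"
    and cont: "\<And>\<omega>. \<omega> \<in> space M \<Longrightarrow> continuous_on {s..t} (\<lambda>u. f u \<omega>)"
    and g: "\<And>u. u \<in> {s..t} \<Longrightarrow> L2 M (f u)" "\<And>u. u \<in> {s..t} \<Longrightarrow> (\<integral>\<omega>. (f u \<omega>)\<^sup>2 \<partial>M) \<le> c"
  shows "L2 M (\<lambda>\<omega>. LINT u:{s..t}|lborel. f u \<omega>)"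
    "(\<integral>\<omega>. (LINT u:{s..t}|lborel. f u \<omega>)\<^sup>2 \<partial>M) \<le> (t - s)\<^sup>2 * c"
proof -
  obtain T where T: "t \<le> real T" using real_arch_simple by blast
  have ev: "eventually (\<lambda>k. (\<Sum>i<T * Suc k. c * (window s t k (Suc i) - window s t k i)) \<le> c * (t - s)) sequentially"
    using window_sum[OF st T] by (simp flip: sum_distrib_left)
  have f: "\<And>u. u \<in> {s..t} \<Longrightarrow> f u \<in> borel_measurable M" using g(1) by (simp add: L2_def)

  have sq: "(\<integral>\<omega>. (h \<omega> * indicator (space M) \<omega>)\<^sup>2 \<partial>M) = (\<integral>\<omega>. (h \<omega>)\<^sup>2 \<partial>M)" for h :: "'a \<Rightarrow> real"
    by (intro Bochner_Integration.integral_cong) auto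
  have L2i: "L2 M (\<lambda>\<omega>. h \<omega> * indicator (space M) \<omega>) \<longleftrightarrow> L2 M h" for h :: "'a \<Rightarrow> real"
    unfolding L2_def by (intro conj_cong measurable_cong Bochner_Integration.integrable_cong refl) auto
  note D = drift_second_moment[where A = "\<lambda>_. space M" and g = "\<lambda>_. c" and C = "c * (t - s)",
      OF st T f cont _ _ _ _ ev, unfolded L2i sq]
  have eq: "(t - s)\<^sup>2 * c = (t - s) * (c * (t - s))" by (simp add: power2_eq_square)
  show "L2 M (\<lambda>\<omega>. LINT u:{s..t}|lborel. f u \<omega>)"
    "(\<integral>\<omega>. (LINT u:{s..t}|lborel. f u \<omega>)\<^sup>2 \<partial>M) \<le> (t - s)\<^sup>2 * c"
    unfolding eq using D g by simp_all
qed

section \<open>Moments and orthogonality of Ito increments\<close>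

context brownian_filtration
begin

text \<open>The only delicate cell is the one containing \<open>s\<close>: its part before
  \<open>s\<close> cancels, and what remains keeps the coefficient sampled at the grid point before
  \<open>s\<close>.\<close>

lemma ito_sum_increment:
  assumes st: "0 \<le> s" "s \<le> t"
  shows "ito_sum H t T k \<omega> - ito_sum H s T k \<omega> =
    esum (\<lambda>i \<omega>. clip k (H (min t (grid k i)) \<omega>)) (window s t k) (T * Suc k) \<omega>"
  unfolding ito_sum_def esum_def sum_subtractf[symmetric]
proof (intro sum.cong refl)
  fix i
  have le: "grid k i \<le> grid k (Suc i)" by (rule grid_simps(5))
  consider "s \<le> grid k i" | "grid k i < s" "grid k (Suc i) \<le> s" | "grid k i < s" "s < grid k (Suc i)" by linarith
  then show "clip k (H (min t (grid k i)) \<omega>) * (B (min t (grid k (Suc i))) \<omega> - B (min t (grid k i)) \<omega>) -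
    clip k (H (min s (grid k i)) \<omega>) * (B (min s (grid k (Suc i))) \<omega> - B (min s (grid k i)) \<omega>) =
    clip k (H (min t (grid k i)) \<omega>) * (B (window s t k (Suc i)) \<omega> - B (window s t k i) \<omega>)"
  proof cases
    case 1
    then show ?thesis using le st by (simp add: window_def min_absorb1 max_absorb2)
  next
    case 2
    then show ?thesis using le st by (simp add: window_def min_absorb2 max_absorb1)
  next
    case 3
    then show ?thesis using le st
      by (simp add: window_def min_absorb1 min_absorb2 max_absorb1 max_absorb2 algebra_simps)
  qed
qed

lemma ito_increment_subseq:
  assumes st: "0 \<le> s" "s \<le> t" "t \<le> real T"
    and It: "has_ito_integral M F B H t It" and Is: "has_ito_integral M F B H s Is"
    and H: "\<And>\<omega>. \<omega> \<in> space M \<Longrightarrow> continuous_on {0..t} (\<lambda>s. H s \<omega>)"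
  obtains r where "strict_mono (r :: nat \<Rightarrow> nat)"
    "AE \<omega> in M. (\<lambda>k. esum (\<lambda>i \<omega>. clip (r k) (H (min t (grid (r k) i)) \<omega>)) (window s t (r k)) (T * Suc (r k)) \<omega>)
      \<longlonglongrightarrow> It \<omega> - Is \<omega>"
proof -
  have m[measurable]: "It \<in> borel_measurable M" "Is \<in> borel_measurable M"
    using It Is by (auto simp: has_ito_integral_def)
  have HF: "H u \<in> borel_measurable (F u)" if "u \<in> {0..t}" for u
    using It that by (auto simp: has_ito_integral_def)
  have im[measurable]: "ito_sum H u T k \<in> borel_measurable M" if u: "u \<in> {0..t}" for u k
    unfolding ito_sum_def esum_def[abs_def]
  proof (intro borel_measurable_sum borel_measurable_times borel_measurable_diff B_measurable)
    fix i
    have v: "min u (grid k i) \<in> {0..t}" using u grid_simps(2) by (auto simp: min_def)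
    then have [measurable]: "H (min u (grid k i)) \<in> borel_measurable M"
      using adapted_M[OF _ HF[OF v]] by simp
    show "(\<lambda>\<omega>. clip k (H (min u (grid k i)) \<omega>)) \<in> borel_measurable M" by measurable
  qed (use u grid_simps(2) in auto)
  have Hs: "continuous_on {0..s} (\<lambda>s. H s \<omega>)" if "\<omega> \<in> space M" for \<omega>
    by (rule continuous_on_subset[OF H[OF that]]) (use st in auto)
  have T: "0 \<le> t" "s \<le> real T" using st by auto
  note 1 = ito_integral_riemann[OF T(1) st(3) It H]
  note 2 = ito_integral_riemann[OF st(1) T(2) Is Hs]
  let ?Y = "\<lambda>k \<omega>. (ito_sum H t T k \<omega> - ito_sum H s T k \<omega>) - (It \<omega> - Is \<omega>)"
  have [measurable]: "ito_sum H t T k \<in> borel_measurable M" "ito_sum H s T k \<in> borel_measurable M" for k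
    using im st by auto
  have Ym: "?Y k \<in> borel_measurable M" for k by measurable
  have "tends_to_zero_in_prob M (\<lambda>k \<omega>. ennreal \<bar>?Y k \<omega>\<bar>)"
    by (rule tends_to_zero_in_prob_add[OF _ _ 1 2]) auto
  from tends_to_zero_in_prob_AE_subseq[OF Ym this] obtain r :: "nat \<Rightarrow> nat"
    where r: "strict_mono r" "AE \<omega> in M. (\<lambda>k. ?Y (r k) \<omega>) \<longlonglongrightarrow> 0" .
  from r(2) have "AE \<omega> in M. (\<lambda>k. ito_sum H t T (r k) \<omega> - ito_sum H s T (r k) \<omega>) \<longlonglongrightarrow> It \<omega> - Is \<omega>"
    by eventually_elim (simp add: LIM_zero_iff)
  then show thesis
    using that[OF r(1)] unfolding ito_sum_increment[OF st(1,2)] by simp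
qed

lemma window_adapted:
  assumes st: "0 \<le> s" "s \<le> t" and H: "\<And>u. u \<in> {0..t} \<Longrightarrow> H u \<in> borel_measurable (F u)"
  shows "(\<lambda>\<omega>. clip k (H (min t (grid k i)) \<omega>)) \<in> borel_measurable (F (window s t k i))"
proof -
  have u: "min t (grid k i) \<in> {0..t}" using st grid_simps(2) by (auto simp: min_def)
  have "H (min t (grid k i)) \<in> borel_measurable (F (window s t k i))"
    by (rule adapted_mono[OF _ _ H[OF u]]) (use u in \<open>auto simp: window_def\<close>)
  then show ?thesis by measurable
qed

text \<open>As for the drift, the sums \<open>E k\<close> of the truncated integrand agree on
  \<open>A t\<close> with those of \<open>H\<close>, and adaptedness of \<open>A\<close> keeps the
  isometry available. Multiplication by the indicator of \<open>A t\<close>, which is known only at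
  time \<open>t\<close>, would destroy orthogonality to the past; therefore the last claim is
  restricted to trivial truncation.\<close>

lemma ito_increment_moments:
  fixes A :: "real \<Rightarrow> 'w set"
  assumes st: "0 \<le> s" "s \<le> t" "t \<le> real T"
    and It: "has_ito_integral M F B H t It" and Is: "has_ito_integral M F B H s Is"
    and H: "\<And>\<omega>. \<omega> \<in> space M \<Longrightarrow> continuous_on {0..t} (\<lambda>s. H s \<omega>)"
    and A: "\<And>u. u \<in> {0..t} \<Longrightarrow> A u \<in> sets (F u)" "\<And>u v. 0 \<le> u \<Longrightarrow> u \<le> v \<Longrightarrow> v \<le> t \<Longrightarrow> A v \<subseteq> A u"
    and g: "\<And>u. u \<in> {0..t} \<Longrightarrow> L2 M (\<lambda>\<omega>. H u \<omega> * indicator (A u) \<omega>)"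
      "\<And>u. u \<in> {0..t} \<Longrightarrow> (\<integral>\<omega>. (H u \<omega> * indicator (A u) \<omega>)\<^sup>2 \<partial>M) \<le> g u"
    and C: "eventually (\<lambda>k. (\<Sum>i<T * Suc k. g (min t (grid k i)) * (window s t k (Suc i) - window s t k i)) \<le> C) sequentially"
  shows "L2 M (\<lambda>\<omega>. (It \<omega> - Is \<omega>) * indicator (A t) \<omega>)"
    "(\<integral>\<omega>. ((It \<omega> - Is \<omega>) * indicator (A t) \<omega>)\<^sup>2 \<partial>M) \<le> C"
    "(\<And>u. u \<in> {0..t} \<Longrightarrow> A u = space M) \<Longrightarrow> W \<in> borel_measurable (F s) \<Longrightarrow> L2 M W \<Longrightarrow>
      (\<integral>\<omega>. (It \<omega> - Is \<omega>) * W \<omega> \<partial>M) = 0"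
proof -
  have m[measurable]: "It \<in> borel_measurable M" "Is \<in> borel_measurable M"
    using It Is by (auto simp: has_ito_integral_def)
  have HF: "H u \<in> borel_measurable (F u)" if "u \<in> {0..t}" for u
    using It that by (auto simp: has_ito_integral_def)
  obtain r where r: "strict_mono r"
    and lim: "AE \<omega> in M. (\<lambda>k. esum (\<lambda>i \<omega>. clip (r k) (H (min t (grid (r k) i)) \<omega>)) (window s t (r k)) (T * Suc (r k)) \<omega>)
      \<longlonglongrightarrow> It \<omega> - Is \<omega>"
    by (rule ito_increment_subseq[OF st It Is H])
  define a where "a u \<omega> = H u \<omega> * indicator (A u) \<omega>" for u \<omega>
  have aF: "a u \<in> borel_measurable (F u)" if "u \<in> {0..t}" for u
    unfolding a_def using HF[OF that] A(1)[OF that] by measurable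
  note w = window_simps[OF st(1,2)]
  define E where "E k = esum (\<lambda>i \<omega>. clip k (a (min t (grid k i)) \<omega>)) (window s t k) (T * Suc k)" for k
  have w0: "0 \<le> window s t k 0" for k using w st by simp
  have u: "min t (grid k i) \<in> {0..t}" for k i using st grid_simps(2) by (auto simp: min_def)
  note iso = esum_isometry[where \<tau> = "window s t k" and N = "T * Suc k" and c = "real k" and
      \<xi> = "\<lambda>i \<omega>. clip k (a (min t (grid k i)) \<omega>)" for k, OF w0 w(3) window_adapted[OF st(1,2) aF] abs_clip_le(1),
      folded E_def]
  have At[measurable]: "A t \<in> events" using A(1)[of t] subalg[of t] st by (auto simp: subalgebra_def)
  define R where "R k \<omega> = E k \<omega> * indicator (A t) \<omega>" for k \<omega>
  have EL: "L2 M (E k)" for k by (rule iso(2))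
  have RL: "L2 M (R k)" for k
  proof (rule L2_dominated[OF EL[of k]])
    show "R k \<in> borel_measurable M" unfolding R_def using EL[of k] by (intro borel_measurable_times) (auto simp: L2_def)
  qed (simp add: R_def indicator_def)
  have EC: "eventually (\<lambda>k. (\<integral>\<omega>. (E k \<omega>)\<^sup>2 \<partial>M) \<le> C) sequentially"
    using C
  proof eventually_elim
    case (elim k)
    have "(\<integral>\<omega>. (E k \<omega>)\<^sup>2 \<partial>M) =
      (\<Sum>i<T * Suc k. (\<integral>\<omega>. (clip k (a (min t (grid k i)) \<omega>))\<^sup>2 \<partial>M) * (window s t k (Suc i) - window s t k i))"
      by (rule iso(3))
    also have "\<dots> \<le> (\<Sum>i<T * Suc k. g (min t (grid k i)) * (window s t k (Suc i) - window s t k i))"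
    proof (intro sum_mono mult_right_mono)
      fix i
      have "L2 M (a (min t (grid k i)))" unfolding a_def by (rule g(1)[OF u])
      then have "(\<integral>\<omega>. (clip k (a (min t (grid k i)) \<omega>))\<^sup>2 \<partial>M) \<le> (\<integral>\<omega>. (a (min t (grid k i)) \<omega>)\<^sup>2 \<partial>M)"
        using abs_clip_le(2)
        by (intro integral_mono' L2_integrable) (auto simp: abs_le_square_iff)
      also have "\<dots> \<le> g (min t (grid k i))" unfolding a_def by (rule g(2)[OF u])
      finally show "(\<integral>\<omega>. (clip k (a (min t (grid k i)) \<omega>))\<^sup>2 \<partial>M) \<le> g (min t (grid k i))" .
    qed (use w in auto)
    also have "\<dots> \<le> C" by (rule elim)
    finally show ?case .
  qed
  have RC: "eventually (\<lambda>k. (\<integral>\<omega>. (R k \<omega>)\<^sup>2 \<partial>M) \<le> C) sequentially"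
    using EC
  proof eventually_elim
    case (elim k)
    have "(\<integral>\<omega>. (R k \<omega>)\<^sup>2 \<partial>M) \<le> (\<integral>\<omega>. (E k \<omega>)\<^sup>2 \<partial>M)"
    proof (intro integral_mono L2_integrable EL RL)
      show "(R k \<omega>)\<^sup>2 \<le> (E k \<omega>)\<^sup>2" for \<omega> by (simp add: R_def indicator_def)
    qed
    then show ?case using elim by simp
  qed
  note sub = eventually_subseq[OF r]
  have limR: "AE \<omega> in M. (\<lambda>k. R (r k) \<omega>) \<longlonglongrightarrow> (It \<omega> - Is \<omega>) * indicator (A t) \<omega>"
    using lim
  proof eventually_elim
    case (elim \<omega>)
    show ?case
    proof (cases "\<omega> \<in> A t")
      case True
      then have "\<omega> \<in> A (min t (grid k i))" for k i using A(2)[of "min t (grid k i)" t] u[of k i] by auto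
      then show ?thesis using elim True by (simp add: R_def E_def a_def esum_def)
    qed (simp add: R_def)
  qed
  show "L2 M (\<lambda>\<omega>. (It \<omega> - Is \<omega>) * indicator (A t) \<omega>)"
    "(\<integral>\<omega>. ((It \<omega> - Is \<omega>) * indicator (A t) \<omega>)\<^sup>2 \<partial>M) \<le> C"
    using L2_fatou[OF RL sub[OF RC] limR] by auto
  show "(\<integral>\<omega>. (It \<omega> - Is \<omega>) * W \<omega> \<partial>M) = 0"
    if As: "\<And>u. u \<in> {0..t} \<Longrightarrow> A u = space M" and W: "W \<in> borel_measurable (F s)" "L2 M W"
  proof (rule L2_weak_limit[OF EL sub[OF EC] _ _ W(2)])
    show "AE \<omega> in M. (\<lambda>k. E (r k) \<omega>) \<longlonglongrightarrow> It \<omega> - Is \<omega>"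
      using lim AE_space
    proof eventually_elim
      case (elim \<omega>)
      then show ?case using As[OF u] by (simp add: E_def a_def esum_def)
    qed
    show "(\<integral>\<omega>. E (r k) \<omega> * W \<omega> \<partial>M) = 0" for k
      unfolding E_def
      by (rule esum_orth[OF w0 w(3) window_adapted[OF st(1,2) aF] abs_clip_le(1)])
        (use W w in auto)
  qed measurable
qed

text \<open>The case without truncation. The bound \<open>c\<close> has to cover a left
  neighbourhood of \<open>s\<close>, because the cell that contains \<open>s\<close> samples the
  integrand before \<open>s\<close>.\<close>

lemma ito_increment_const:
  assumes st: "0 \<le> s" "s \<le> t" and \<eta>: "\<eta> > 0"
    and It: "has_ito_integral M F B H t It" and Is: "has_ito_integral M F B H s Is"
    and H: "\<And>\<omega>. \<omega> \<in> space M \<Longrightarrow> continuous_on {0..t} (\<lambda>s. H s \<omega>)"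
    and HL: "\<And>u. u \<in> {0..t} \<Longrightarrow> L2 M (H u)"
    and c: "\<And>u. max 0 (s - \<eta>) \<le> u \<Longrightarrow> u \<le> t \<Longrightarrow> (\<integral>\<omega>. (H u \<omega>)\<^sup>2 \<partial>M) \<le> c"
  shows "L2 M (\<lambda>\<omega>. It \<omega> - Is \<omega>)" "(\<integral>\<omega>. (It \<omega> - Is \<omega>)\<^sup>2 \<partial>M) \<le> c * (t - s)"
    "W \<in> borel_measurable (F s) \<Longrightarrow> L2 M W \<Longrightarrow> (\<integral>\<omega>. (It \<omega> - Is \<omega>) * W \<omega> \<partial>M) = 0"
proof -
  obtain T where T: "t \<le> real T" using real_arch_simple by blast
  have sq: "(\<integral>\<omega>. (h \<omega> * indicator (space M) \<omega>)\<^sup>2 \<partial>M) = (\<integral>\<omega>. (h \<omega>)\<^sup>2 \<partial>M)" for h :: "'w \<Rightarrow> real"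
    by (intro Bochner_Integration.integral_cong) auto
  have L2i: "L2 M (\<lambda>\<omega>. h \<omega> * indicator (space M) \<omega>) \<longleftrightarrow> L2 M h" for h :: "'w \<Rightarrow> real"
    unfolding L2_def by (intro conj_cong measurable_cong Bochner_Integration.integrable_cong refl) auto
  have ev: "eventually (\<lambda>k. (\<Sum>i<T * Suc k. (\<integral>\<omega>. (H (min t (grid k i)) \<omega>)\<^sup>2 \<partial>M) *
      (window s t k (Suc i) - window s t k i)) \<le> c * (t - s)) sequentially"
    by (rule window_sum_const_le[OF st T \<eta>, of "\<lambda>u. \<integral>\<omega>. (H u \<omega>)\<^sup>2 \<partial>M", OF c])
  have sp: "space M \<in> sets (F u)" if "u \<in> {0..t}" for u
    using that by (metis space_F sets.top atLeastAtMost_iff)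
  note D = ito_increment_moments[where H = H and A = "\<lambda>_. space M" and g = "\<lambda>u. \<integral>\<omega>. (H u \<omega>)\<^sup>2 \<partial>M" and
      C = "c * (t - s)", OF st T It Is H sp _ _ _ ev, unfolded L2i sq]
  show "L2 M (\<lambda>\<omega>. It \<omega> - Is \<omega>)" "(\<integral>\<omega>. (It \<omega> - Is \<omega>)\<^sup>2 \<partial>M) \<le> c * (t - s)"
    "W \<in> borel_measurable (F s) \<Longrightarrow> L2 M W \<Longrightarrow> (\<integral>\<omega>. (It \<omega> - Is \<omega>) * W \<omega> \<partial>M) = 0"
    using D HL by auto
qed

end

section \<open>The a priori second moment bound\<close>

text \<open>Lets the increment estimates be applied from time 0 to the integral itself. The given
  integral over \<open>{0..0}\<close> supplies the measurability clauses, and the time interval is a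
  null set.\<close>

lemma has_ito_integral_zero:
  assumes "has_ito_integral M F B H 0 I"
  shows "has_ito_integral M F B H 0 (\<lambda>_. 0)"
proof -
  have 1: "simple_ito M F B 0 (\<lambda>s \<omega>. 0) (\<lambda>\<omega>. 0)"
    unfolding simple_ito_def by (intro exI[of _ 0] exI[of _ "\<lambda>_. 0"]) auto
  have "(\<integral>\<^sup>+ s\<in>{0..0}. f s \<partial>lborel) = 0" for f :: "real \<Rightarrow> ennreal"
    by (rule nn_integral_null_set) (simp add: finite_imp_null_set_lborel)
  then have 2: "tends_to_zero_in_prob M (\<lambda>k \<omega>. \<integral>\<^sup>+ s\<in>{0..0}. ennreal ((0 - H s \<omega>)\<^sup>2) \<partial>lborel)"
    unfolding tends_to_zero_in_prob_def by simp
  have 3: "tends_to_zero_in_prob M (\<lambda>k \<omega>. ennreal \<bar>0 - 0\<bar>)"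
    unfolding tends_to_zero_in_prob_def by simp
  show ?thesis
    using assms unfolding has_ito_integral_def
    by (intro conjI exI[of _ "\<lambda>k s \<omega>. 0"] exI[of _ "\<lambda>k \<omega>. 0"] allI 1 2 3) auto
qed

text \<open>The Lipschitz constant of the coefficient as a map from the path to \<open>L2\<close>,
  with respect to the supremum of the norms over the past.\<close>

definition coeff_bound :: "real \<Rightarrow> nat \<Rightarrow> (nat \<Rightarrow> real) \<Rightarrow> real" where
  "coeff_bound c0 n c = \<bar>c0\<bar> + (\<Sum>i=1..n. \<bar>c i\<bar>)"

lemma coeff_bound_nonneg: "0 \<le> coeff_bound c0 n c"
  by (auto simp: coeff_bound_def intro!: add_nonneg_nonneg sum_nonneg)

text \<open>The 3 comes from squaring a sum of three terms, \<open>T\<close> from Cauchy-Schwarz for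
  the drift integral, and the second square from the isometry.\<close>

definition a_priori_rate :: "real \<Rightarrow> nat \<Rightarrow> (nat \<Rightarrow> real) \<Rightarrow> real \<Rightarrow> nat \<Rightarrow> (nat \<Rightarrow> real) \<Rightarrow> real \<Rightarrow> real" where
  "a_priori_rate a n b \<sigma> m \<sigma>' T = 3 * (T * (coeff_bound a n b)\<^sup>2 + (coeff_bound \<sigma> m \<sigma>')\<^sup>2)"

text \<open>The exponent is \<open>\<kappa> * T\<close> for the weight rate
  \<open>\<kappa> = 2 * K + 1\<close>; the 6 is twice the factor 3 in front of the initial moment,
  after absorbing half of the weighted supremum.\<close>

definition a_priori_const :: "real \<Rightarrow> nat \<Rightarrow> (nat \<Rightarrow> real) \<Rightarrow> real \<Rightarrow> nat \<Rightarrow> (nat \<Rightarrow> real) \<Rightarrow> real \<Rightarrow> real" where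
  "a_priori_const a n b \<sigma> m \<sigma>' T = 6 * exp ((2 * a_priori_rate a n b \<sigma> m \<sigma>' T + 1) * T)"

lemma a_priori_const_pos: "0 < a_priori_const a n b \<sigma> m \<sigma>' T"
  by (simp add: a_priori_const_def)

lemma pantograph_coeff_l2norm_le:
  assumes "L2 M (Y t)" "\<And>i. i \<in> {1..n} \<Longrightarrow> L2 M (Y (p i * t))"
  shows "L2 M (pantograph_coeff c0 n c p Y t)"
    "l2norm M (pantograph_coeff c0 n c p Y t) \<le> \<bar>c0\<bar> * l2norm M (Y t) + (\<Sum>i=1..n. \<bar>c i\<bar> * l2norm M (Y (p i * t)))"
proof -
  have S: "L2 M (\<lambda>\<omega>. \<Sum>i=1..n. c i * Y (p i * t) \<omega>)"
    using assms(2) by (intro L2_sum L2_cmult) auto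
  show "L2 M (pantograph_coeff c0 n c p Y t)"
    unfolding pantograph_coeff_def[abs_def] by (intro L2_add L2_cmult assms S)
  have "l2norm M (pantograph_coeff c0 n c p Y t) \<le>
    l2norm M (\<lambda>\<omega>. c0 * Y t \<omega>) + l2norm M (\<lambda>\<omega>. \<Sum>i=1..n. c i * Y (p i * t) \<omega>)"
    unfolding pantograph_coeff_def[abs_def] by (intro l2norm_triangle L2_cmult assms S)
  also have "l2norm M (\<lambda>\<omega>. \<Sum>i=1..n. c i * Y (p i * t) \<omega>) \<le> (\<Sum>i=1..n. l2norm M (\<lambda>\<omega>. c i * Y (p i * t) \<omega>))"
    using assms(2) by (intro l2norm_sum_le L2_cmult) auto
  finally show "l2norm M (pantograph_coeff c0 n c p Y t) \<le>
    \<bar>c0\<bar> * l2norm M (Y t) + (\<Sum>i=1..n. \<bar>c i\<bar> * l2norm M (Y (p i * t)))"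
    by (simp add: l2norm_cmult)
qed

lemma pantograph_coeff_l2norm_bound:
  assumes "L2 M (Y t)" "\<And>i. i \<in> {1..n} \<Longrightarrow> L2 M (Y (p i * t))"
    and "l2norm M (Y t) \<le> C" "\<And>i. i \<in> {1..n} \<Longrightarrow> l2norm M (Y (p i * t)) \<le> C"
  shows "l2norm M (pantograph_coeff c0 n c p Y t) \<le> coeff_bound c0 n c * C"
proof -
  have "l2norm M (pantograph_coeff c0 n c p Y t) \<le>
      \<bar>c0\<bar> * l2norm M (Y t) + (\<Sum>i=1..n. \<bar>c i\<bar> * l2norm M (Y (p i * t)))"
    by (rule pantograph_coeff_l2norm_le(2)) (use assms in auto)
  also have "\<dots> \<le> \<bar>c0\<bar> * C + (\<Sum>i=1..n. \<bar>c i\<bar> * C)"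
    using assms by (intro add_mono sum_mono mult_left_mono) auto
  finally show ?thesis by (simp add: coeff_bound_def distrib_right sum_distrib_right)
qed

lemma L2_square_le_iff:
  assumes "0 \<le> C"
  shows "(\<integral>\<omega>. (f \<omega>)\<^sup>2 \<partial>M) \<le> C\<^sup>2 \<longleftrightarrow> l2norm M f \<le> C"
  unfolding l2norm_sq[symmetric] using assms by (simp add: power_mono_iff)

section \<open>Solutions and their truncations\<close>

locale pantograph = brownian_filtration M F B
  for M :: "'w measure" and F B +
  fixes X0 :: "'w \<Rightarrow> real" and X :: "real \<Rightarrow> 'w \<Rightarrow> real"
    and a :: real and n :: nat and b q :: "nat \<Rightarrow> real"
    and \<sigma> :: real and m :: nat and \<sigma>' r :: "nat \<Rightarrow> real"
  assumes X_adapted: "0 \<le> t \<Longrightarrow> X t \<in> borel_measurable (F t)"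
    and X_cont: "\<omega> \<in> space M \<Longrightarrow> continuous_on {0..} (\<lambda>t. X t \<omega>)"
    and X_sol: "0 \<le> t \<Longrightarrow> \<exists>I. has_ito_integral M F B (pantograph_coeff \<sigma> m \<sigma>' r X) t I \<and>
        (AE \<omega> in M. X t \<omega> = X0 \<omega> + (LINT s:{0..t}|lborel. pantograph_coeff a n b q X s \<omega>) + I \<omega>)"
    and X0_L2: "L2 M X0"
    and q: "i \<in> {1..n} \<Longrightarrow> 0 < q i \<and> q i < 1"
    and r: "j \<in> {1..m} \<Longrightarrow> 0 < r j \<and> r j < 1"
begin

abbreviation D where "D \<equiv> pantograph_coeff a n b q X"
abbreviation G where "G \<equiv> pantograph_coeff \<sigma> m \<sigma>' r X"
abbreviation Ld where "Ld \<equiv> coeff_bound a n b"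
abbreviation Lg where "Lg \<equiv> coeff_bound \<sigma> m \<sigma>'"

lemma delay: "0 \<le> t \<Longrightarrow> i \<in> {1..n} \<Longrightarrow> 0 \<le> q i * t \<and> q i * t \<le> t"
  using q[of i] by (auto intro: mult_left_le_one_le)

lemma delay': "0 \<le> t \<Longrightarrow> j \<in> {1..m} \<Longrightarrow> 0 \<le> r j * t \<and> r j * t \<le> t"
  using r[of j] by (auto intro: mult_left_le_one_le)

lemma coeff_adapted:
  assumes "0 \<le> t" "\<And>i. i \<in> {1..k} \<Longrightarrow> 0 \<le> p i * t \<and> p i * t \<le> t"
  shows "pantograph_coeff c0 k c p X t \<in> borel_measurable (F t)"
  unfolding pantograph_coeff_def[abs_def]
  using assms X_adapted adapted_mono[OF _ _ X_adapted]
  by (intro borel_measurable_add borel_measurable_times borel_measurable_sum borel_measurable_const) auto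

lemma coeff_cont:
  assumes "\<omega> \<in> space M" "\<And>i. i \<in> {1..k} \<Longrightarrow> 0 < p i \<and> p i < 1"
  shows "continuous_on {0..} (\<lambda>t. pantograph_coeff c0 k c p X t \<omega>)"
proof -
  have "continuous_on {0..} (\<lambda>t. X (p i * t) \<omega>)" if "i \<in> {1..k}" for i
    by (rule continuous_on_compose2[OF X_cont[OF assms(1)], of _ "\<lambda>t. p i * t"])
      (use assms(2)[OF that] in \<open>auto intro!: continuous_intros\<close>)
  then show ?thesis
    unfolding pantograph_coeff_def
    by (intro continuous_on_add continuous_on_mult continuous_on_const continuous_on_sum X_cont[OF assms(1)]) auto
qed

lemma D_adapted: "0 \<le> t \<Longrightarrow> D t \<in> borel_measurable (F t)"
  by (rule coeff_adapted) (use delay in auto)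

lemma D_cont: "\<omega> \<in> space M \<Longrightarrow> 0 \<le> s \<Longrightarrow> continuous_on {s..t} (\<lambda>t. D t \<omega>)"
  by (rule continuous_on_subset[OF coeff_cont]) (use q in auto)

lemma G_cont: "\<omega> \<in> space M \<Longrightarrow> 0 \<le> s \<Longrightarrow> continuous_on {s..t} (\<lambda>t. G t \<omega>)"
  by (rule continuous_on_subset[OF coeff_cont]) (use r in auto)

lemma X_measurable: "0 \<le> t \<Longrightarrow> X t \<in> borel_measurable M"
  using adapted_M X_adapted by blast

text \<open>Stands in for a stopping time: these events are adapted and decrease with
  \<open>u\<close>, as the moment estimates demand, and no stopped integral has to be
  formed.\<close>

definition tame :: "nat \<Rightarrow> real \<Rightarrow> 'w set" where
  "tame N u = {\<omega> \<in> space M. \<forall>v\<in>{0..u}. \<bar>X v \<omega>\<bar> \<le> real N}"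

lemma tame_decreasing: "u \<le> v \<Longrightarrow> tame N v \<subseteq> tame N u"
  by (auto simp: tame_def)

text \<open>By continuity it suffices to test the countably many times
  \<open>u * j / (k + 1)\<close>. All of them lie in \<open>{0..u}\<close>, so each condition is
  known at time \<open>u\<close>.\<close>

lemma tame_adapted:
  assumes u: "0 \<le> u"
  shows "tame N u \<in> sets (F u)"
proof -
  define p where "p k j = u * (real j / real (Suc k))" for k j :: nat
  have p: "0 \<le> p k j \<and> p k j \<le> u" if "j \<le> Suc k" for k j
  proof -
    have "real j / real (Suc k) \<le> 1" using that by (simp add: divide_le_eq_1 del: of_nat_Suc)
    then show ?thesis using u unfolding p_def by (intro conjI mult_left_le mult_nonneg_nonneg) auto
  qed
  have "tame N u = {\<omega> \<in> space M. \<forall>k. \<forall>j\<in>{..Suc k}. \<bar>X (p k j) \<omega>\<bar> \<le> real N}"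
  proof (intro set_eqI iffI)
    fix \<omega> assume "\<omega> \<in> tame N u"
    then show "\<omega> \<in> {\<omega> \<in> space M. \<forall>k. \<forall>j\<in>{..Suc k}. \<bar>X (p k j) \<omega>\<bar> \<le> real N}"
      using p by (auto simp: tame_def)
  next
    fix \<omega> assume \<omega>: "\<omega> \<in> {\<omega> \<in> space M. \<forall>k. \<forall>j\<in>{..Suc k}. \<bar>X (p k j) \<omega>\<bar> \<le> real N}"
    have "\<bar>X v \<omega>\<bar> \<le> real N" if v: "v \<in> {0..u}" for v
    proof (rule ccontr)
      assume big: "\<not> \<bar>X v \<omega>\<bar> \<le> real N"
      have c: "continuous_on {0..} (\<lambda>t. X t \<omega>)" using X_cont \<omega> by simp
      define e where "e = \<bar>X v \<omega>\<bar> - real N"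
      have "e > 0" using big by (simp add: e_def)
      then obtain d where d: "d > 0" "\<And>v'. v' \<in> {0..} \<Longrightarrow> dist v' v < d \<Longrightarrow> dist (X v' \<omega>) (X v \<omega>) < e"
        using c v unfolding continuous_on_iff by (metis atLeastAtMost_iff atLeast_iff)
      \<comment> \<open>This \<open>k\<close> makes the mesh \<open>u / (k + 1)\<close> smaller than
        \<open>d\<close>; the index \<open>j\<close> below is then the last test point not after
        \<open>v\<close>.\<close>
      obtain k :: nat where k: "u / d < real k" using reals_Archimedean2 by blast
      define j where "j = nat \<lfloor>v * real (Suc k) / u\<rfloor>"
      have "\<bar>p k j - v\<bar> < d \<and> j \<le> Suc k"
      proof (cases "u = 0")
        case True
        then show ?thesis using v d by (simp add: p_def j_def)
      next
        case False
        then have u0: "u > 0" using u by simp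
        have nn: "0 \<le> v * real (Suc k) / u" using v u0 by simp
        have "real j \<le> v * real (Suc k) / u" "v * real (Suc k) / u < real j + 1"
          using nn unfolding j_def by linarith+
        then have j1: "real j * u \<le> v * real (Suc k)" "v * real (Suc k) < (real j + 1) * u"
          using u0 by (simp_all add: field_simps)
        have "v * real (Suc k) \<le> u * real (Suc k)" using v by (intro mult_right_mono) auto
        with j1(1) have "real j * u \<le> u * real (Suc k)" by (rule order_trans)
        then have "real j * u \<le> real (Suc k) * u" by (simp only: mult.commute)
        then have "j \<le> Suc k" using u0 by (simp only: mult_le_cancel_right_pos of_nat_le_iff)
        moreover have "p k j \<le> v" "v - p k j < u / real (Suc k)"
        proof -
          have S: "0 < real (Suc k)" by simp
          have "p k j = real j * u / real (Suc k)" by (simp add: p_def)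
          also have "\<dots> \<le> v" using j1(1) S by (simp only: pos_divide_le_eq)
          finally show "p k j \<le> v" .
          have "v < (real j + 1) * u / real (Suc k)" using j1(2) S by (simp only: pos_less_divide_eq)
          also have "\<dots> = p k j + u / real (Suc k)" by (simp add: p_def distrib_right add_divide_distrib)
          finally show "v - p k j < u / real (Suc k)" by simp
        qed
        moreover have "u / real (Suc k) < d"
          using k d(1) by (simp add: field_simps)
        ultimately show ?thesis by auto
      qed
      then have j: "\<bar>p k j - v\<bar> < d" "j \<le> Suc k" by auto
      have "dist (X (p k j) \<omega>) (X v \<omega>) < e" using d(2)[of "p k j"] p[OF j(2)] j(1) by (simp add: dist_real_def)
      moreover have "\<bar>X (p k j) \<omega>\<bar> \<le> real N" using \<omega> j(2) by auto
      ultimately show False by (simp add: e_def dist_real_def)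
    qed
    then show "\<omega> \<in> tame N u" using \<omega> by (simp add: tame_def)
  qed
  moreover have "{\<omega> \<in> space M. \<forall>k. \<forall>j\<in>{..Suc k}. \<bar>X (p k j) \<omega>\<bar> \<le> real N} \<in> sets (F u)"
  proof -
    have [measurable]: "X (p k j) \<in> borel_measurable (F u)" if "j \<in> {..Suc k}" for k j
      using p[of j k] that adapted_mono[OF _ _ X_adapted] by simp
    have "{\<omega> \<in> space (F u). \<forall>k. \<forall>j\<in>{..Suc k}. \<bar>X (p k j) \<omega>\<bar> \<le> real N} \<in> sets (F u)"
      by measurable
    then show ?thesis by (simp add: space_F[OF u])
  qed
  ultimately show ?thesis by simp
qed

lemma tame_events: "0 \<le> u \<Longrightarrow> tame N u \<in> events"
  using tame_adapted[of u N] subalg[of u] by (auto simp: subalgebra_def)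

lemma tame_eventually:
  assumes "0 \<le> u" "\<omega> \<in> space M"
  shows "eventually (\<lambda>N. \<omega> \<in> tame N u) sequentially"
proof -
  have "continuous_on {0..u} (\<lambda>t. X t \<omega>)" by (rule continuous_on_subset[OF X_cont[OF assms(2)]]) auto
  then have "bounded ((\<lambda>t. X t \<omega>) ` {0..u})" by (intro compact_imp_bounded compact_continuous_image) auto
  then obtain c where c: "\<forall>v\<in>{0..u}. \<bar>X v \<omega>\<bar> \<le> c" by (auto simp: bounded_iff)
  obtain N0 where "c \<le> real N0" using real_arch_simple by blast
  then show ?thesis
    using c assms by (intro eventually_sequentiallyI[of N0]) (force simp: tame_def)
qed

definition Y :: "nat \<Rightarrow> real \<Rightarrow> 'w \<Rightarrow> real" where
  "Y N u \<omega> = X u \<omega> * indicator (tame N u) \<omega>"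

lemma Y_L2: "0 \<le> u \<Longrightarrow> L2 M (Y N u)"
  by (rule L2_bounded[OF finite_measure_axioms, of _ "real N"])
    (use X_measurable tame_events in \<open>auto simp: Y_def[abs_def] tame_def indicator_def\<close>)

lemma Y_second_moment_le: "0 \<le> u \<Longrightarrow> (\<integral>\<omega>. (Y N u \<omega>)\<^sup>2 \<partial>M) \<le> (real N)\<^sup>2"
proof -
  assume u: "0 \<le> u"
  have "(Y N u \<omega>)\<^sup>2 \<le> (real N)\<^sup>2" for \<omega>
    using u by (auto simp: Y_def tame_def indicator_def abs_le_square_iff[symmetric])
  then have "(\<integral>\<omega>. (Y N u \<omega>)\<^sup>2 \<partial>M) \<le> (\<integral>\<omega>. (real N)\<^sup>2 \<partial>M)"
    by (intro integral_mono L2_integrable[OF Y_L2[OF u]] integrable_const)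
  then show ?thesis by (simp add: prob_space)
qed

text \<open>A delayed argument lies in the past, where the truncating event is larger: the delayed
  value cut at time \<open>t\<close> is dominated by the one cut at its own time.\<close>

lemma coeff_tame:
  assumes "0 \<le> t" "\<And>i. i \<in> {1..k} \<Longrightarrow> 0 \<le> p i * t \<and> p i * t \<le> t"
    and C: "\<And>u. 0 \<le> u \<Longrightarrow> u \<le> t \<Longrightarrow> l2norm M (Y N u) \<le> C"
  shows "L2 M (\<lambda>\<omega>. pantograph_coeff c0 k c p X t \<omega> * indicator (tame N t) \<omega>)"
    "l2norm M (\<lambda>\<omega>. pantograph_coeff c0 k c p X t \<omega> * indicator (tame N t) \<omega>) \<le> coeff_bound c0 k c * C"
proof -
  have eq: "(\<lambda>\<omega>. pantograph_coeff c0 k c p X t \<omega> * indicator (tame N t) \<omega>) =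
    pantograph_coeff c0 k c p (\<lambda>u \<omega>. X u \<omega> * indicator (tame N t) \<omega>) t"
    by (auto simp: pantograph_coeff_def fun_eq_iff distrib_right sum_distrib_right mult.assoc)
  have le: "\<bar>X u \<omega> * indicator (tame N t) \<omega>\<bar> \<le> \<bar>Y N u \<omega>\<bar>" if "u \<le> t" for u \<omega>
    using tame_decreasing[OF that, of N] by (auto simp: Y_def indicator_def)
  have L: "L2 M (\<lambda>\<omega>. X u \<omega> * indicator (tame N t) \<omega>)" if "0 \<le> u" "u \<le> t" for u
  proof (rule L2_dominated[OF Y_L2[OF that(1), of N] _ le[OF that(2)]])
    show "(\<lambda>\<omega>. X u \<omega> * indicator (tame N t) \<omega>) \<in> borel_measurable M"
      using X_measurable[OF that(1)] tame_events[OF assms(1), of N] by measurable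
  qed
  have lC: "l2norm M (\<lambda>\<omega>. X u \<omega> * indicator (tame N t) \<omega>) \<le> C" if "0 \<le> u" "u \<le> t" for u
  proof -
    have "l2norm M (\<lambda>\<omega>. X u \<omega> * indicator (tame N t) \<omega>) \<le> l2norm M (Y N u)"
      unfolding l2norm_def using le[OF that(2)]
      by (intro real_sqrt_le_mono integral_mono L2_integrable L Y_L2 that) (simp add: abs_le_square_iff)
    then show ?thesis using C[OF that] by simp
  qed
  show "L2 M (\<lambda>\<omega>. pantograph_coeff c0 k c p X t \<omega> * indicator (tame N t) \<omega>)"
    unfolding eq by (rule pantograph_coeff_l2norm_le(1)) (use assms L in auto)
  show "l2norm M (\<lambda>\<omega>. pantograph_coeff c0 k c p X t \<omega> * indicator (tame N t) \<omega>) \<le> coeff_bound c0 k c * C"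
    unfolding eq by (rule pantograph_coeff_l2norm_bound) (use assms L lC in auto)
qed

text \<open>One step of a Gronwall argument with an exponential weight: integrating the weight in
  time gains the factor \<open>1 / \<kappa>\<close>, which a large rate makes contractive.\<close>

lemma Y_step:
  assumes t: "0 \<le> t" and w: "0 \<le> w" and \<kappa>: "0 < \<kappa>"
    and hyp: "\<And>u. 0 \<le> u \<Longrightarrow> u \<le> t \<Longrightarrow> (\<integral>\<omega>. (Y N u \<omega>)\<^sup>2 \<partial>M) \<le> w * exp (\<kappa> * u)"
  shows "(\<integral>\<omega>. (Y N t \<omega>)\<^sup>2 \<partial>M) \<le> 3 * (\<integral>\<omega>. (X0 \<omega>)\<^sup>2 \<partial>M) + a_priori_rate a n b \<sigma> m \<sigma>' t * w * exp (\<kappa> * t) / \<kappa>"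
proof -
  obtain T where T: "t \<le> real T" using real_arch_simple by blast
  \<comment> \<open>The weight increases in time, so the bound at \<open>u\<close> also covers every
    delayed time \<open>v \<le> u\<close>.\<close>
  have Yn: "l2norm M (Y N v) \<le> sqrt (w * exp (\<kappa> * u))" if "0 \<le> v" "v \<le> u" "u \<le> t" for v u
  proof -
    have "(\<integral>\<omega>. (Y N v \<omega>)\<^sup>2 \<partial>M) \<le> w * exp (\<kappa> * v)" using hyp that by simp
    also have "\<dots> \<le> w * exp (\<kappa> * u)" using w \<kappa> that by (intro mult_left_mono) auto
    finally show ?thesis unfolding l2norm_def by (rule real_sqrt_le_mono)
  qed
  have sq: "(\<integral>\<omega>. (h \<omega>)\<^sup>2 \<partial>M) \<le> L\<^sup>2 * w * exp (\<kappa> * u)"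
    if "l2norm M h \<le> L * sqrt (w * exp (\<kappa> * u))" "0 \<le> L" for h L u
  proof -
    have "(l2norm M h)\<^sup>2 \<le> (L * sqrt (w * exp (\<kappa> * u)))\<^sup>2" using that by (intro power_mono) auto
    then show ?thesis using w by (simp add: l2norm_sq power_mult_distrib mult.assoc)
  qed
  have DL: "L2 M (\<lambda>\<omega>. D u \<omega> * indicator (tame N u) \<omega>)"
    "(\<integral>\<omega>. (D u \<omega> * indicator (tame N u) \<omega>)\<^sup>2 \<partial>M) \<le> Ld\<^sup>2 * w * exp (\<kappa> * u)" if "u \<in> {0..t}" for u
    using coeff_tame[where p = q and k = n and t = u and N = N and C = "sqrt (w * exp (\<kappa> * u))"] delay that Yn
    by (auto intro!: sq coeff_bound_nonneg)
  have GL: "L2 M (\<lambda>\<omega>. G u \<omega> * indicator (tame N u) \<omega>)"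
    "(\<integral>\<omega>. (G u \<omega> * indicator (tame N u) \<omega>)\<^sup>2 \<partial>M) \<le> Lg\<^sup>2 * w * exp (\<kappa> * u)" if "u \<in> {0..t}" for u
    using coeff_tame[where p = r and k = m and t = u and N = N and C = "sqrt (w * exp (\<kappa> * u))"] delay' that Yn
    by (auto intro!: sq coeff_bound_nonneg)
  have evD: "eventually (\<lambda>k. (\<Sum>i<T * Suc k. (Ld\<^sup>2 * w * exp (\<kappa> * window 0 t k i)) * (window 0 t k (Suc i) - window 0 t k i))
      \<le> Ld\<^sup>2 * w * exp (\<kappa> * t) / \<kappa>) sequentially"
  proof (intro always_eventually allI)
    fix k
    have "min t (grid k i) = window 0 t k i" for i
      using t grid_simps(2)[of k i] by (simp add: window_def)
    then show "(\<Sum>i<T * Suc k. (Ld\<^sup>2 * w * exp (\<kappa> * window 0 t k i)) * (window 0 t k (Suc i) - window 0 t k i))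
      \<le> Ld\<^sup>2 * w * exp (\<kappa> * t) / \<kappa>"
      using window_sum_exp_le[OF t T \<kappa>, of "Ld\<^sup>2 * w" k] w by simp
  qed
  have evG: "eventually (\<lambda>k. (\<Sum>i<T * Suc k. (Lg\<^sup>2 * w * exp (\<kappa> * min t (grid k i))) * (window 0 t k (Suc i) - window 0 t k i))
      \<le> Lg\<^sup>2 * w * exp (\<kappa> * t) / \<kappa>) sequentially"
    using window_sum_exp_le[OF t T \<kappa>, of "Lg\<^sup>2 * w"] w by simp
  define JD where "JD \<omega> = (LINT u:{0..t}|lborel. D u \<omega>)" for \<omega>
  have Dm: "D u \<in> borel_measurable M" if "u \<in> {0..t}" for u using adapted_M[OF _ D_adapted] that by simp
  have Dc: "continuous_on {0..t} (\<lambda>u. D u \<omega>)" "continuous_on {0..t} (\<lambda>u. G u \<omega>)" if "\<omega> \<in> space M" for \<omega>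
    using D_cont[OF that] G_cont[OF that] by auto
  have tE: "tame N u \<in> events" "tame N u \<in> sets (F u)" if "u \<in> {0..t}" for u
    using tame_events tame_adapted that by auto
  have tD: "tame N v \<subseteq> tame N u" if "0 \<le> u" "u \<le> v" "v \<le> t" for u v
    using tame_decreasing that by blast
  note JD' = drift_second_moment[where f = D and A = "tame N" and g = "\<lambda>u. Ld\<^sup>2 * w * exp (\<kappa> * u)" and s = 0 and t = t,
        OF order_refl t T Dm Dc(1) tE(1) tD DL evD]
  have JD: "L2 M (\<lambda>\<omega>. JD \<omega> * indicator (tame N t) \<omega>)"
    "(\<integral>\<omega>. (JD \<omega> * indicator (tame N t) \<omega>)\<^sup>2 \<partial>M) \<le> (t - 0) * (Ld\<^sup>2 * w * exp (\<kappa> * t) / \<kappa>)"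
  proof -
    show "L2 M (\<lambda>\<omega>. JD \<omega> * indicator (tame N t) \<omega>)" unfolding JD_def by (rule JD'(1))
    show "(\<integral>\<omega>. (JD \<omega> * indicator (tame N t) \<omega>)\<^sup>2 \<partial>M) \<le> (t - 0) * (Ld\<^sup>2 * w * exp (\<kappa> * t) / \<kappa>)"
      unfolding JD_def by (rule JD'(2))
  qed
  obtain I where I: "has_ito_integral M F B G t I" "AE \<omega> in M. X t \<omega> = X0 \<omega> + JD \<omega> + I \<omega>"
    using X_sol[OF t] unfolding JD_def by blast
  \<comment> \<open>The Ito estimate is formulated for increments, so the integral up to
    \<open>t\<close> is read as the increment from the zero integral at time 0.\<close>
  obtain I0 where "has_ito_integral M F B G 0 I0" using X_sol[OF order_refl] by blast
  then have Z: "has_ito_integral M F B G 0 (\<lambda>_. 0)" by (rule has_ito_integral_zero)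
  have II: "L2 M (\<lambda>\<omega>. I \<omega> * indicator (tame N t) \<omega>)"
    "(\<integral>\<omega>. (I \<omega> * indicator (tame N t) \<omega>)\<^sup>2 \<partial>M) \<le> Lg\<^sup>2 * w * exp (\<kappa> * t) / \<kappa>"
    using ito_increment_moments(1,2)[where H = G and A = "tame N" and g = "\<lambda>u. Lg\<^sup>2 * w * exp (\<kappa> * u)" and s = 0 and t = t,
        OF order_refl t T I(1) Z Dc(2) tE(2) tD GL evG] by simp_all

  have "(\<integral>\<omega>. (Y N t \<omega>)\<^sup>2 \<partial>M) \<le> (\<integral>\<omega>. 3 * (X0 \<omega>)\<^sup>2 + (3 * (JD \<omega> * indicator (tame N t) \<omega>)\<^sup>2 + 3 * (I \<omega> * indicator (tame N t) \<omega>)\<^sup>2) \<partial>M)"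
  proof (rule integral_mono_AE)
    show "integrable M (\<lambda>\<omega>. (Y N t \<omega>)\<^sup>2)" by (intro L2_integrable Y_L2 t)
    show "integrable M (\<lambda>\<omega>. 3 * (X0 \<omega>)\<^sup>2 + (3 * (JD \<omega> * indicator (tame N t) \<omega>)\<^sup>2 + 3 * (I \<omega> * indicator (tame N t) \<omega>)\<^sup>2))"
      by (intro Bochner_Integration.integrable_add integrable_mult_right L2_integrable X0_L2 JD II)
    show "AE \<omega> in M. (Y N t \<omega>)\<^sup>2 \<le> 3 * (X0 \<omega>)\<^sup>2 + (3 * (JD \<omega> * indicator (tame N t) \<omega>)\<^sup>2 + 3 * (I \<omega> * indicator (tame N t) \<omega>)\<^sup>2)"
      using I(2)
    proof eventually_elim
      case (elim \<omega>)
      have "(x + y + z)\<^sup>2 \<le> 3 * x\<^sup>2 + (3 * y\<^sup>2 + 3 * z\<^sup>2)" for x y z :: real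
        using zero_le_power2[of "x - y"] zero_le_power2[of "y - z"] zero_le_power2[of "x - z"]
        by (simp add: power2_eq_square algebra_simps)
      from this[of "X0 \<omega>" "JD \<omega>" "I \<omega>"] show ?case
        using elim by (auto simp: Y_def indicator_def)
    qed
  qed
  also have "\<dots> = 3 * (\<integral>\<omega>. (X0 \<omega>)\<^sup>2 \<partial>M) + (3 * (\<integral>\<omega>. (JD \<omega> * indicator (tame N t) \<omega>)\<^sup>2 \<partial>M) +
      3 * (\<integral>\<omega>. (I \<omega> * indicator (tame N t) \<omega>)\<^sup>2 \<partial>M))"
    using L2_integrable[OF X0_L2] L2_integrable[OF JD(1)] L2_integrable[OF II(1)] by simp
  also have "\<dots> \<le> 3 * (\<integral>\<omega>. (X0 \<omega>)\<^sup>2 \<partial>M) + (3 * (t * (Ld\<^sup>2 * w * exp (\<kappa> * t) / \<kappa>)) + 3 * (Lg\<^sup>2 * w * exp (\<kappa> * t) / \<kappa>))"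
  proof -
    have "(t - 0) * (Ld\<^sup>2 * w * exp (\<kappa> * t) / \<kappa>) = t * (Ld\<^sup>2 * w * exp (\<kappa> * t) / \<kappa>)" by simp
    with JD(2) II(2) show ?thesis by linarith
  qed
  also have "\<dots> = 3 * (\<integral>\<omega>. (X0 \<omega>)\<^sup>2 \<partial>M) + a_priori_rate a n b \<sigma> m \<sigma>' t * w * exp (\<kappa> * t) / \<kappa>"
    by (simp add: a_priori_rate_def algebra_simps add_divide_distrib)
  finally show ?thesis .
qed

text \<open>For fixed \<open>N\<close> the weighted supremum \<open>w\<close> is finite by
  truncation, and one step gives that \<open>w\<close> is at most \<open>3 * e0\<close> plus half of
  \<open>w\<close>. The resulting bound is free of \<open>N\<close>, and Fatou removes the
  truncation. Working with a supremum avoids integrating the second moment in time.\<close>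

lemma a_priori_bound:
  assumes t: "0 \<le> t" "t \<le> T"
  shows "L2 M (X t)" "(\<integral>\<omega>. (X t \<omega>)\<^sup>2 \<partial>M) \<le> a_priori_const a n b \<sigma> m \<sigma>' T * (\<integral>\<omega>. (X0 \<omega>)\<^sup>2 \<partial>M)"
proof -
  define e0 where "e0 = (\<integral>\<omega>. (X0 \<omega>)\<^sup>2 \<partial>M)"
  define K where "K = a_priori_rate a n b \<sigma> m \<sigma>' T"
  \<comment> \<open>With this rate the contraction factor \<open>K / \<kappa>\<close> is at most
    1/2.\<close>
  define \<kappa> where "\<kappa> = 2 * K + 1"
  have e0: "e0 \<ge> 0" by (simp add: e0_def)
  have T: "0 \<le> T" using t by simp
  have K: "K \<ge> 0" using T by (simp add: K_def a_priori_rate_def)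
  then have \<kappa>: "\<kappa> > 0" by (simp add: \<kappa>_def)
  have rate: "a_priori_rate a n b \<sigma> m \<sigma>' u \<le> K" if "u \<le> T" for u
    using that unfolding K_def a_priori_rate_def by (intro mult_left_mono add_right_mono mult_right_mono) auto
  have Yb: "(\<integral>\<omega>. (Y N t \<omega>)\<^sup>2 \<partial>M) \<le> 6 * exp (\<kappa> * T) * e0" for N
  proof -
    define S where "S = (\<lambda>u. exp (- \<kappa> * u) * (\<integral>\<omega>. (Y N u \<omega>)\<^sup>2 \<partial>M)) ` {0..T}"
    define w where "w = Sup S"
    \<comment> \<open>Finiteness of the supremum is the one place where boundedness by
      \<open>N\<close> is needed quantitatively; otherwise half of it could not be absorbed.\<close>
    have bdd: "bdd_above S"
    proof (rule bdd_aboveI)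
      fix x assume "x \<in> S"
      then obtain u where u: "u \<in> {0..T}" "x = exp (- \<kappa> * u) * (\<integral>\<omega>. (Y N u \<omega>)\<^sup>2 \<partial>M)" by (auto simp: S_def)
      have "x \<le> 1 * (real N)\<^sup>2"
        unfolding u(2) using u(1) \<kappa> Y_second_moment_le[of u N]
        by (intro mult_mono) auto
      then show "x \<le> (real N)\<^sup>2" by simp
    qed
    have wle: "(\<integral>\<omega>. (Y N u \<omega>)\<^sup>2 \<partial>M) \<le> w * exp (\<kappa> * u)" if "0 \<le> u" "u \<le> T" for u
    proof -
      have "exp (- \<kappa> * u) * (\<integral>\<omega>. (Y N u \<omega>)\<^sup>2 \<partial>M) \<le> w"
        unfolding w_def using that by (intro cSup_upper bdd) (auto simp: S_def)
      then have "exp (\<kappa> * u) * (exp (- \<kappa> * u) * (\<integral>\<omega>. (Y N u \<omega>)\<^sup>2 \<partial>M)) \<le> exp (\<kappa> * u) * w"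
        by (intro mult_left_mono) auto
      moreover have e: "exp (\<kappa> * u) * exp (- \<kappa> * u) = 1" by (simp flip: exp_add)
      have "exp (\<kappa> * u) * (exp (- \<kappa> * u) * (\<integral>\<omega>. (Y N u \<omega>)\<^sup>2 \<partial>M)) = (\<integral>\<omega>. (Y N u \<omega>)\<^sup>2 \<partial>M)"
        unfolding mult.assoc[symmetric] e by simp
      ultimately show ?thesis by (simp only: mult.commute)
    qed
    have w0: "0 \<le> w"
    proof -
      have "0 \<le> (\<integral>\<omega>. (Y N 0 \<omega>)\<^sup>2 \<partial>M)" by simp
      also have "\<dots> \<le> w" using wle[of 0] T by simp
      finally show ?thesis .
    qed
    have "w \<le> 3 * e0 + K * w / \<kappa>"
      unfolding w_def
    proof (rule cSup_least)
      show "S \<noteq> {}" using T by (auto simp: S_def)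
      fix x assume "x \<in> S"
      then obtain u where u: "0 \<le> u" "u \<le> T" "x = exp (- \<kappa> * u) * (\<integral>\<omega>. (Y N u \<omega>)\<^sup>2 \<partial>M)" by (auto simp: S_def)
      have "(\<integral>\<omega>. (Y N u \<omega>)\<^sup>2 \<partial>M) \<le> 3 * e0 + a_priori_rate a n b \<sigma> m \<sigma>' u * w * exp (\<kappa> * u) / \<kappa>"
        unfolding e0_def by (rule Y_step[OF u(1) w0 \<kappa>]) (use wle u in auto)
      also have "\<dots> \<le> 3 * e0 + K * w * exp (\<kappa> * u) / \<kappa>"
        using rate[OF u(2)] w0 \<kappa> by (intro add_left_mono divide_right_mono mult_right_mono) auto
      finally have "x \<le> exp (- \<kappa> * u) * (3 * e0 + K * w * exp (\<kappa> * u) / \<kappa>)"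
        unfolding u(3) by (intro mult_left_mono) auto
      also have "\<dots> = exp (- \<kappa> * u) * (3 * e0) + K * w / \<kappa> * (exp (- \<kappa> * u) * exp (\<kappa> * u))"
        by (simp add: algebra_simps)
      also have "\<dots> \<le> 1 * (3 * e0) + K * w / \<kappa> * 1"
      proof (intro add_mono mult_right_mono)
        show "K * w / \<kappa> * (exp (- \<kappa> * u) * exp (\<kappa> * u)) \<le> K * w / \<kappa> * 1" by (simp add: exp_minus)
      qed (use e0 \<kappa> u in auto)
      finally show "x \<le> 3 * e0 + K * Sup S / \<kappa>" by (simp add: w_def)
    qed
    moreover have "K * w / \<kappa> \<le> w / 2"
      using K w0 \<kappa> by (simp add: \<kappa>_def field_simps)
    ultimately have w6: "w \<le> 6 * e0" by linarith
    have "(\<integral>\<omega>. (Y N t \<omega>)\<^sup>2 \<partial>M) \<le> w * exp (\<kappa> * t)" using wle t by simp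
    also have "\<dots> \<le> (6 * e0) * exp (\<kappa> * T)" using w6 w0 e0 t \<kappa> by (intro mult_mono) auto
    finally show ?thesis by (simp add: ac_simps)
  qed
  have lim: "AE \<omega> in M. (\<lambda>N. Y N t \<omega>) \<longlonglongrightarrow> X t \<omega>"
  proof (rule AE_I2)
    fix \<omega> assume "\<omega> \<in> space M"
    from tame_eventually[OF t(1) this] have "eventually (\<lambda>N. Y N t \<omega> = X t \<omega>) sequentially"
      by eventually_elim (simp add: Y_def)
    then show "(\<lambda>N. Y N t \<omega>) \<longlonglongrightarrow> X t \<omega>" by (rule tendsto_eventually)
  qed
  show "L2 M (X t)" "(\<integral>\<omega>. (X t \<omega>)\<^sup>2 \<partial>M) \<le> a_priori_const a n b \<sigma> m \<sigma>' T * (\<integral>\<omega>. (X0 \<omega>)\<^sup>2 \<partial>M)"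
    using L2_fatou[OF Y_L2[OF t(1)] always_eventually[OF allI[OF Yb]] lim X_measurable[OF t(1)]]
    by (auto simp: a_priori_const_def \<kappa>_def K_def e0_def)
qed

end

section \<open>The mean-square comparison argument\<close>

text \<open>If the inequality failed, there would be a last time up to which it holds throughout;
  continuity keeps it there, and it extends a little further. The hypothesis \<open>step\<close> is
  asked only at contact and may use the whole past, which is what delayed terms refer to.\<close>

lemma dini_comparison:
  fixes v \<psi> :: "real \<Rightarrow> real"
  assumes v: "continuous_on {0..} v" and \<psi>: "continuous_on {0..} \<psi>" and t0: "0 \<le> t0"
    and init: "\<And>t. 0 \<le> t \<Longrightarrow> t \<le> t0 \<Longrightarrow> v t \<le> \<psi> t"
    and step: "\<And>t. t0 \<le> t \<Longrightarrow> (\<And>u. 0 \<le> u \<Longrightarrow> u \<le> t \<Longrightarrow> v u \<le> \<psi> u) \<Longrightarrow> v t = \<psi> t \<Longrightarrow>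
      \<exists>\<eta>>0. \<forall>h. 0 < h \<and> h < \<eta> \<longrightarrow> v (t + h) \<le> \<psi> (t + h)"
    and t: "0 \<le> t"
  shows "v t \<le> \<psi> t"
proof (rule ccontr)
  assume bad: "\<not> v t \<le> \<psi> t"
  then have tt: "t0 < t" using init t by force
  have cont: "continuous_on {0..} (\<lambda>u. v u - \<psi> u)" by (intro continuous_intros v \<psi>)
  define S where "S = {s \<in> {t0..t}. \<forall>u\<in>{0..s}. v u \<le> \<psi> u}"
  have S0: "t0 \<in> S" using tt init by (auto simp: S_def)
  have bdd: "bdd_above S" by (rule bdd_aboveI[of _ t]) (auto simp: S_def)
  define s where "s = Sup S"
  have s: "t0 \<le> s" "s \<le> t"
    unfolding s_def using S0 bdd by (auto intro!: cSup_upper cSup_least simp: S_def)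
  have below: "v u \<le> \<psi> u" if "0 \<le> u" "u < s" for u
  proof -
    obtain s' where "s' \<in> S" "u < s'" using \<open>u < s\<close> less_cSup_iff[of S u] S0 bdd by (auto simp: s_def)
    then show ?thesis using \<open>0 \<le> u\<close> by (auto simp: S_def)
  qed
  have at: "v s \<le> \<psi> s"
  proof (rule ccontr)
    assume "\<not> v s \<le> \<psi> s"
    then have e: "0 < v s - \<psi> s" by simp
    have "t0 < s"
    proof (rule ccontr)
      assume "\<not> t0 < s"
      then have "v s \<le> \<psi> s" using s t0 by (intro init) auto
      then show False using \<open>\<not> v s \<le> \<psi> s\<close> by simp
    qed
    obtain d where d: "d > 0" "\<And>u. u \<in> {0..} \<Longrightarrow> dist u s < d \<Longrightarrow> dist (v u - \<psi> u) (v s - \<psi> s) < v s - \<psi> s"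
      using cont e s t0 unfolding continuous_on_iff by (metis atLeast_iff order_trans)
    define u where "u = max 0 (s - d / 2)"
    have u: "0 \<le> u" "u < s" "dist u s < d" using d(1) \<open>t0 < s\<close> t0 by (auto simp: u_def dist_real_def)
    have "dist (v u - \<psi> u) (v s - \<psi> s) < v s - \<psi> s" using d(2)[of u] u by simp
    moreover have "v u - \<psi> u \<le> 0" using below u by simp
    ultimately show False using e by (simp add: dist_real_def)
  qed
  have all: "v u \<le> \<psi> u" if "0 \<le> u" "u \<le> s" for u using below[of u] at that by (cases "u = s") auto
  have "s < t" using at bad s by (cases "s = t") auto
  \<comment> \<open>Without contact at \<open>s\<close> continuity extends the inequality; at
    contact the hypothesis \<open>step\<close> does.\<close>
  have "\<exists>\<eta>>0. \<forall>h. 0 < h \<and> h < \<eta> \<longrightarrow> v (s + h) \<le> \<psi> (s + h)"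
  proof (cases "v s = \<psi> s")
    case True
    then show ?thesis using step[OF s(1) all] by blast
  next
    case False
    then have e: "0 < \<psi> s - v s" using at by simp
    obtain d where d: "d > 0" "\<And>u. u \<in> {0..} \<Longrightarrow> dist u s < d \<Longrightarrow> dist (v u - \<psi> u) (v s - \<psi> s) < \<psi> s - v s"
      using cont e s t0 unfolding continuous_on_iff by (metis atLeast_iff order_trans)
    have "v (s + h) \<le> \<psi> (s + h)" if "0 < h" "h < d" for h
    proof -
      have "s + h \<in> {0..}" "dist (s + h) s < d" using that s t0 by (auto simp: dist_real_def)
      from d(2)[OF this] show ?thesis by (simp add: dist_real_def abs_less_iff)
    qed
    then show ?thesis using d(1) by blast
  qed
  then obtain \<eta> where \<eta>: "\<eta> > 0" "\<And>h. 0 < h \<Longrightarrow> h < \<eta> \<Longrightarrow> v (s + h) \<le> \<psi> (s + h)" by blast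
  define h where "h = min (\<eta> / 2) (t - s)"
  have h: "0 < h" "h < \<eta>" "s + h \<le> t" using \<eta>(1) \<open>s < t\<close> by (auto simp: h_def min_def)
  have "v u \<le> \<psi> u" if "0 \<le> u" "u \<le> s + h" for u
  proof (cases "u \<le> s")
    case False
    then show ?thesis using \<eta>(2)[of "u - s"] that h by simp
  qed (use all that in auto)
  then have "s + h \<in> S" using h s by (auto simp: S_def)
  then have "s + h \<le> s" unfolding s_def by (intro cSup_upper bdd)
  then show False using h by simp
qed

section \<open>Mean-square regularity and growth of the solution\<close>

context pantograph
begin

abbreviation x where "x t \<equiv> l2norm M (X t)"
abbreviation e0 where "e0 \<equiv> \<integral>\<omega>. (X0 \<omega>)\<^sup>2 \<partial>M"

lemma X_L2: "0 \<le> t \<Longrightarrow> L2 M (X t)"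
  using a_priori_bound(1)[of t t] by simp

definition xmax :: "real \<Rightarrow> real" where
  "xmax T = sqrt (a_priori_const a n b \<sigma> m \<sigma>' T * e0)"

lemma xmax_nonneg: "0 \<le> xmax T"
  using a_priori_const_pos by (auto simp: xmax_def less_imp_le)

lemma x_le_xmax: "0 \<le> t \<Longrightarrow> t \<le> T \<Longrightarrow> x t \<le> xmax T"
  unfolding xmax_def l2norm_def by (rule real_sqrt_le_mono[OF a_priori_bound(2)])

lemma D_L2: "0 \<le> t \<Longrightarrow> L2 M (D t)"
  by (rule pantograph_coeff_l2norm_le(1)) (use X_L2 delay in auto)

lemma G_L2: "0 \<le> t \<Longrightarrow> L2 M (G t)"
  by (rule pantograph_coeff_l2norm_le(1)) (use X_L2 delay' in auto)

lemma D_le: "0 \<le> t \<Longrightarrow> (\<And>u. 0 \<le> u \<Longrightarrow> u \<le> t \<Longrightarrow> x u \<le> C) \<Longrightarrow> l2norm M (D t) \<le> Ld * C"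
  by (rule pantograph_coeff_l2norm_bound) (use X_L2 delay in auto)

lemma G_le: "0 \<le> t \<Longrightarrow> (\<And>u. 0 \<le> u \<Longrightarrow> u \<le> t \<Longrightarrow> x u \<le> C) \<Longrightarrow> l2norm M (G t) \<le> Lg * C"
  by (rule pantograph_coeff_l2norm_bound) (use X_L2 delay' in auto)

lemma drift_int:
  assumes "0 \<le> s" "s \<le> t" and C: "\<And>u. s \<le> u \<Longrightarrow> u \<le> t \<Longrightarrow> l2norm M (D u) \<le> C"
  shows "L2 M (\<lambda>\<omega>. LINT u:{s..t}|lborel. D u \<omega>)" "l2norm M (\<lambda>\<omega>. LINT u:{s..t}|lborel. D u \<omega>) \<le> (t - s) * C"
proof -
  have C0: "0 \<le> C" using C[of s] assms l2norm_nonneg[of M "D s"] by linarith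
  have 1: "(\<integral>\<omega>. (D u \<omega>)\<^sup>2 \<partial>M) \<le> C\<^sup>2" if "u \<in> {s..t}" for u
    unfolding L2_square_le_iff[OF C0] using C that by simp
  note D = drift_second_moment_const[where f = D, OF assms(1,2) D_cont[OF _ assms(1)] D_L2 1]
  show "L2 M (\<lambda>\<omega>. LINT u:{s..t}|lborel. D u \<omega>)" using D(1) assms by simp
  have "(\<integral>\<omega>. (LINT u:{s..t}|lborel. D u \<omega>)\<^sup>2 \<partial>M) \<le> ((t - s) * C)\<^sup>2"
    using D(2) assms by (simp add: power_mult_distrib)
  then show "l2norm M (\<lambda>\<omega>. LINT u:{s..t}|lborel. D u \<omega>) \<le> (t - s) * C"
    by (intro iffD1[OF L2_square_le_iff]) (use C0 assms in auto)
qed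

text \<open>Collects what later arguments use about the Ito increment \<open>J\<close>. The norm
  bound is left open in \<eta> and \<open>c\<close> for the same \<open>J\<close>: crude constants
  give Hoelder continuity, and a window shrinking with the step gives the sharp first-order
  rate.\<close>

lemma increment_decomposition:
  assumes st: "0 \<le> s" "s \<le> t"
  obtains J where "L2 M J"
    "AE \<omega> in M. X t \<omega> - X s \<omega> = (LINT u:{s..t}|lborel. D u \<omega>) + J \<omega>"
    "\<And>\<eta> c. \<eta> > 0 \<Longrightarrow> 0 \<le> c \<Longrightarrow> (\<And>u. max 0 (s - \<eta>) \<le> u \<Longrightarrow> u \<le> t \<Longrightarrow> l2norm M (G u) \<le> c) \<Longrightarrow>
      l2norm M J \<le> c * sqrt (t - s)"
    "\<And>W. W \<in> borel_measurable (F s) \<Longrightarrow> L2 M W \<Longrightarrow> (\<integral>\<omega>. J \<omega> * W \<omega> \<partial>M) = 0"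
proof -
  obtain It where It: "has_ito_integral M F B G t It"
    "AE \<omega> in M. X t \<omega> = X0 \<omega> + (LINT u:{0..t}|lborel. D u \<omega>) + It \<omega>" using X_sol[of t] st by auto
  obtain Is where Is: "has_ito_integral M F B G s Is"
    "AE \<omega> in M. X s \<omega> = X0 \<omega> + (LINT u:{0..s}|lborel. D u \<omega>) + Is \<omega>" using X_sol[of s] st by auto
  have GL: "L2 M (G u)" if "u \<in> {0..t}" for u using G_L2 that by simp
  define C where "C = (Lg * xmax t)\<^sup>2"
  have GC: "(\<integral>\<omega>. (G u \<omega>)\<^sup>2 \<partial>M) \<le> C" if "max 0 (s - 1) \<le> u" "u \<le> t" for u
    unfolding C_def
    by (subst L2_square_le_iff) (use that x_le_xmax xmax_nonneg coeff_bound_nonneg in \<open>auto intro!: G_le\<close>)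
  note base = ito_increment_const[OF st zero_less_one It(1) Is(1) G_cont[OF _ order_refl] GL GC]
  show thesis
  proof (rule that[of "\<lambda>\<omega>. It \<omega> - Is \<omega>"])
    show "L2 M (\<lambda>\<omega>. It \<omega> - Is \<omega>)" by (rule base(1)) auto
    show "(\<integral>\<omega>. (It \<omega> - Is \<omega>) * W \<omega> \<partial>M) = 0" if "W \<in> borel_measurable (F s)" "L2 M W" for W
      by (rule base(3)) (use that in auto)
    show "AE \<omega> in M. X t \<omega> - X s \<omega> = (LINT u:{s..t}|lborel. D u \<omega>) + (It \<omega> - Is \<omega>)"
      using It(2) Is(2) AE_space
    proof eventually_elim
      case (elim \<omega>)
      have c: "continuous_on {0..t} (\<lambda>u. D u \<omega>)" using D_cont elim by simp
      have i: "(LINT u:{v..w}|lborel. D u \<omega>) = integral {v..w} (\<lambda>u. D u \<omega>)" if "0 \<le> v" "w \<le> t" for v w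
      proof -
        have "continuous_on {v..w} (\<lambda>u. D u \<omega>)" by (rule continuous_on_subset[OF c]) (use that in auto)
        then have "set_integrable lborel {v..w} (\<lambda>u. D u \<omega>)" by (rule borel_integrable_atLeastAtMost')
        then show ?thesis by (rule set_borel_integral_eq_integral(2))
      qed
      have "integral {0..s} (\<lambda>u. D u \<omega>) + integral {s..t} (\<lambda>u. D u \<omega>) = integral {0..t} (\<lambda>u. D u \<omega>)"
        using st by (intro Henstock_Kurzweil_Integration.integral_combine integrable_continuous_real c)
      then show ?case using elim i[of 0 t] i[of 0 s] i[of s t] st by simp
    qed
    show "l2norm M (\<lambda>\<omega>. It \<omega> - Is \<omega>) \<le> c * sqrt (t - s)"
      if \<eta>: "\<eta> > 0" and c: "0 \<le> c" and Gc: "\<And>u. max 0 (s - \<eta>) \<le> u \<Longrightarrow> u \<le> t \<Longrightarrow> l2norm M (G u) \<le> c" for \<eta> c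
    proof -
      have "(\<integral>\<omega>. (G u \<omega>)\<^sup>2 \<partial>M) \<le> c\<^sup>2" if "max 0 (s - \<eta>) \<le> u" "u \<le> t" for u
        unfolding L2_square_le_iff[OF c] using Gc that by simp
      from ito_increment_const(2)[OF st \<eta> It(1) Is(1) G_cont[OF _ order_refl] GL this]
      have "(\<integral>\<omega>. (It \<omega> - Is \<omega>)\<^sup>2 \<partial>M) \<le> (c * sqrt (t - s))\<^sup>2"
        using st by (simp add: power_mult_distrib)
      then show ?thesis by (intro iffD1[OF L2_square_le_iff]) (use c st in auto)
    qed
  qed
qed

text \<open>The constant of the 1/2-Hoelder bound of \<open>X\<close> in mean square on
  \<open>{0..T}\<close>; the drift is of order \<open>t - s\<close> and is absorbed at the price of
  \<open>sqrt T\<close>.\<close>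

definition hoelder :: "real \<Rightarrow> real" where
  "hoelder T = (Ld * sqrt T + Lg) * xmax T"

lemma hoelder_nonneg: "0 \<le> T \<Longrightarrow> 0 \<le> hoelder T"
  by (simp add: hoelder_def coeff_bound_nonneg xmax_nonneg)

lemma X_hoelder:
  assumes st: "0 \<le> s" "s \<le> t" "t \<le> T"
  shows "l2norm M (\<lambda>\<omega>. X t \<omega> - X s \<omega>) \<le> hoelder T * sqrt (t - s)"
proof -
  obtain J where J: "L2 M J"
    "AE \<omega> in M. X t \<omega> - X s \<omega> = (LINT u:{s..t}|lborel. D u \<omega>) + J \<omega>"
    "\<And>\<eta> c. \<eta> > 0 \<Longrightarrow> 0 \<le> c \<Longrightarrow> (\<And>u. max 0 (s - \<eta>) \<le> u \<Longrightarrow> u \<le> t \<Longrightarrow> l2norm M (G u) \<le> c) \<Longrightarrow>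
      l2norm M J \<le> c * sqrt (t - s)"
    by (rule increment_decomposition[OF st(1,2)]) blast
  have Dle: "l2norm M (D u) \<le> Ld * xmax T" if "s \<le> u" "u \<le> t" for u
    using that st x_le_xmax by (intro D_le) auto
  have Gle: "l2norm M (G u) \<le> Lg * xmax T" if "max 0 (s - 1) \<le> u" "u \<le> t" for u
    using that st x_le_xmax by (intro G_le) auto
  note P = drift_int[OF st(1,2) Dle]
  have sq: "t - s \<le> sqrt T * sqrt (t - s)"
  proof -
    have "t - s = sqrt (t - s) * sqrt (t - s)" using st by simp
    also have "\<dots> \<le> sqrt T * sqrt (t - s)" using st by (intro mult_right_mono real_sqrt_le_mono) auto
    finally show ?thesis .
  qed
  have "l2norm M (\<lambda>\<omega>. X t \<omega> - X s \<omega>) = l2norm M (\<lambda>\<omega>. (LINT u:{s..t}|lborel. D u \<omega>) + J \<omega>)"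
    using X_measurable st P(1) J(1) by (intro l2norm_cong_AE J(2)) (auto simp: L2_def)
  also have "\<dots> \<le> l2norm M (\<lambda>\<omega>. LINT u:{s..t}|lborel. D u \<omega>) + l2norm M J"
    by (rule l2norm_triangle[OF P(1) J(1)])
  also have "\<dots> \<le> (t - s) * (Ld * xmax T) + Lg * xmax T * sqrt (t - s)"
    using P(2) J(3)[OF zero_less_one _ Gle] coeff_bound_nonneg xmax_nonneg by (intro add_mono) auto
  also have "\<dots> \<le> (sqrt T * sqrt (t - s)) * (Ld * xmax T) + Lg * xmax T * sqrt (t - s)"
    using sq coeff_bound_nonneg xmax_nonneg by (intro add_right_mono mult_right_mono) auto
  also have "\<dots> = hoelder T * sqrt (t - s)" by (simp add: hoelder_def algebra_simps)
  finally show ?thesis .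
qed

lemma X_hoelder':
  assumes "0 \<le> s" "0 \<le> t" "s \<le> T" "t \<le> T" "\<bar>t - s\<bar> \<le> h"
  shows "l2norm M (\<lambda>\<omega>. X t \<omega> - X s \<omega>) \<le> hoelder T * sqrt h"
proof -
  have h0: "0 \<le> hoelder T" using assms hoelder_nonneg by simp
  have "l2norm M (\<lambda>\<omega>. X t \<omega> - X s \<omega>) \<le> hoelder T * sqrt \<bar>t - s\<bar>"
  proof (cases "s \<le> t")
    case True
    then show ?thesis using X_hoelder[of s t T] assms by simp
  next
    case False
    have "l2norm M (\<lambda>\<omega>. X t \<omega> - X s \<omega>) = l2norm M (\<lambda>\<omega>. X s \<omega> - X t \<omega>)"
      by (simp add: l2norm_def power2_commute)
    then show ?thesis using X_hoelder[of t s T] False assms by simp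
  qed
  also have "\<dots> \<le> hoelder T * sqrt h" using assms h0 by (intro mult_left_mono real_sqrt_le_mono) auto
  finally show ?thesis .
qed

text \<open>Delay factors below 1 contract time differences, so every delayed term has at least the
  regularity of \<open>X\<close> itself.\<close>

lemma coeff_hoelder:
  assumes "0 \<le> s" "0 \<le> t" "s \<le> T" "t \<le> T" "\<bar>t - s\<bar> \<le> h"
    and p: "\<And>i. i \<in> {1..k} \<Longrightarrow> 0 < p i \<and> p i < 1"
  shows "l2norm M (\<lambda>\<omega>. pantograph_coeff c0 k c p X t \<omega> - pantograph_coeff c0 k c p X s \<omega>)
    \<le> coeff_bound c0 k c * (hoelder T * sqrt h)"
proof -

  have L: "L2 M (\<lambda>\<omega>. X u \<omega> - X v \<omega>)" if "0 \<le> u" "0 \<le> v" for u v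
    using that by (intro L2_diff X_L2)
  have p': "0 \<le> p i * u \<and> p i * u \<le> u" if "i \<in> {1..k}" "0 \<le> u" for i u
    using p[OF that(1)] that(2) by (auto intro: mult_left_le_one_le)
  have pd: "\<bar>p i * t - p i * s\<bar> \<le> h" if "i \<in> {1..k}" for i
  proof -
    have "\<bar>p i * t - p i * s\<bar> = p i * \<bar>t - s\<bar>" using p[OF that] by (simp add: abs_mult flip: right_diff_distrib)
    also have "\<dots> \<le> 1 * \<bar>t - s\<bar>" using p[OF that] by (intro mult_right_mono) auto
    finally show ?thesis using assms by simp
  qed
  have "l2norm M (\<lambda>\<omega>. pantograph_coeff c0 k c p X t \<omega> - pantograph_coeff c0 k c p X s \<omega>) =
    l2norm M (\<lambda>\<omega>. c0 * (X t \<omega> - X s \<omega>) + (\<Sum>i=1..k. c i * (X (p i * t) \<omega> - X (p i * s) \<omega>)))"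
    unfolding pantograph_coeff_def by (simp add: right_diff_distrib sum_subtractf add_diff_add)
  also have "\<dots> \<le> l2norm M (\<lambda>\<omega>. c0 * (X t \<omega> - X s \<omega>)) + l2norm M (\<lambda>\<omega>. \<Sum>i=1..k. c i * (X (p i * t) \<omega> - X (p i * s) \<omega>))"
    using assms p' by (intro l2norm_triangle L2_cmult L2_sum L) auto
  also have "\<dots> \<le> \<bar>c0\<bar> * l2norm M (\<lambda>\<omega>. X t \<omega> - X s \<omega>) + (\<Sum>i=1..k. l2norm M (\<lambda>\<omega>. c i * (X (p i * t) \<omega> - X (p i * s) \<omega>)))"
    using assms p' unfolding l2norm_cmult[of M c0] by (intro add_left_mono l2norm_sum_le L2_cmult L) auto
  also have "\<dots> \<le> \<bar>c0\<bar> * (hoelder T * sqrt h) + (\<Sum>i=1..k. \<bar>c i\<bar> * (hoelder T * sqrt h))"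
    unfolding l2norm_cmult
  proof (intro add_mono sum_mono mult_left_mono)
    show "l2norm M (\<lambda>\<omega>. X t \<omega> - X s \<omega>) \<le> hoelder T * sqrt h" by (rule X_hoelder') (use assms in auto)
    fix i assume i: "i \<in> {1..k}"
    show "l2norm M (\<lambda>\<omega>. X (p i * t) \<omega> - X (p i * s) \<omega>) \<le> hoelder T * sqrt h"
    proof (rule X_hoelder'[OF _ _ _ _ pd[OF i]])
      show "0 \<le> p i * s" "0 \<le> p i * t" "p i * s \<le> T" "p i * t \<le> T"
        using p'[OF i, of s] p'[OF i, of t] assms by auto
    qed
  qed auto
  also have "\<dots> = coeff_bound c0 k c * (hoelder T * sqrt h)"
    by (simp add: coeff_bound_def distrib_right sum_distrib_right)
  finally show ?thesis .
qed

lemma x_cont: "continuous_on {0..} x"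
proof (rule continuous_onI)
  fix t e :: real assume t: "t \<in> {0..}" and e: "e > 0"
  define T where "T = t + 1"
  define d where "d = min 1 ((e / (2 * (hoelder T + 1)))\<^sup>2)"
  have h0: "0 \<le> hoelder T" using t by (intro hoelder_nonneg) (simp add: T_def)
  have d: "d > 0" using e h0 by (auto simp: d_def)
  have small: "hoelder T * sqrt d < e"
  proof -
    have "sqrt d \<le> sqrt ((e / (2 * (hoelder T + 1)))\<^sup>2)" by (rule real_sqrt_le_mono) (simp add: d_def)
    also have "\<dots> = e / (2 * (hoelder T + 1))" using e h0 by simp
    finally have "hoelder T * sqrt d \<le> hoelder T * (e / (2 * (hoelder T + 1)))" using h0 by (intro mult_left_mono)
    also have "\<dots> < e" using e h0 by (simp add: field_simps add_pos_nonneg)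
    finally show ?thesis .
  qed
  show "\<exists>d>0. \<forall>u\<in>{0..}. dist u t < d \<longrightarrow> dist (x u) (x t) \<le> e"
  proof (intro exI[of _ d] conjI d ballI impI)
    fix u assume u: "u \<in> {0..}" "dist u t < d"
    have uT: "u \<le> T" using u by (auto simp: T_def d_def dist_real_def)
    have L: "L2 M (X u)" "L2 M (X t)" using t u X_L2 by auto
    have 1: "l2norm M (\<lambda>\<omega>. X u \<omega> - X t \<omega>) \<le> hoelder T * sqrt d"
      by (rule X_hoelder') (use t u uT in \<open>auto simp: T_def dist_real_def\<close>)
    have 2: "l2norm M (\<lambda>\<omega>. X t \<omega> - X u \<omega>) \<le> hoelder T * sqrt d"
      by (rule X_hoelder') (use t u uT in \<open>auto simp: T_def dist_real_def\<close>)
    show "dist (x u) (x t) \<le> e"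
      using l2norm_diff_triangle[OF L] l2norm_diff_triangle[OF L(2,1)] 1 2 small by (simp add: dist_real_def)
  qed
qed

definition drift_rate :: "real \<Rightarrow> real" where
  "drift_rate t = 2 * a * (x t)\<^sup>2 + 2 * (\<Sum>i=1..n. \<bar>b i\<bar> * (x t * x (q i * t)))"

definition noise_norm :: "real \<Rightarrow> real" where
  "noise_norm t = \<bar>\<sigma>\<bar> * x t + (\<Sum>j=1..m. \<bar>\<sigma>' j\<bar> * x (r j * t))"

lemma noise_norm_nonneg: "0 \<le> noise_norm t"
  by (auto simp: noise_norm_def intro!: add_nonneg_nonneg sum_nonneg)

lemma drift_rate_bound:
  assumes t: "0 \<le> t"
  shows "2 * (\<integral>\<omega>. X t \<omega> * D t \<omega> \<partial>M) \<le> drift_rate t"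
proof -
  have L: "L2 M (X t)" "\<And>i. i \<in> {1..n} \<Longrightarrow> L2 M (X (q i * t))" using t X_L2 delay by auto
  have eq: "X t \<omega> * D t \<omega> = a * (X t \<omega>)\<^sup>2 + (\<Sum>i=1..n. b i * (X t \<omega> * X (q i * t) \<omega>))" for \<omega>
    by (simp add: pantograph_coeff_def power2_eq_square distrib_left sum_distrib_left ac_simps)
  have "(\<integral>\<omega>. X t \<omega> * D t \<omega> \<partial>M) = a * (\<integral>\<omega>. (X t \<omega>)\<^sup>2 \<partial>M) + (\<integral>\<omega>. (\<Sum>i=1..n. b i * (X t \<omega> * X (q i * t) \<omega>)) \<partial>M)"
    unfolding eq using L2_integrable[OF L(1)] L2_mult_integrable[OF L(1) L(2)]
    by (subst Bochner_Integration.integral_add) auto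
  also have "(\<integral>\<omega>. (\<Sum>i=1..n. b i * (X t \<omega> * X (q i * t) \<omega>)) \<partial>M) = (\<Sum>i=1..n. b i * (\<integral>\<omega>. X t \<omega> * X (q i * t) \<omega> \<partial>M))"
    using L2_mult_integrable[OF L(1) L(2)] by (subst Bochner_Integration.integral_sum) auto
  also have "\<dots> \<le> (\<Sum>i=1..n. \<bar>b i\<bar> * (x t * x (q i * t)))"
  proof (rule sum_mono)
    fix i assume i: "i \<in> {1..n}"
    have "b i * (\<integral>\<omega>. X t \<omega> * X (q i * t) \<omega> \<partial>M) \<le> \<bar>b i\<bar> * \<bar>\<integral>\<omega>. X t \<omega> * X (q i * t) \<omega> \<partial>M\<bar>"
      by (simp flip: abs_mult)
    also have "\<dots> \<le> \<bar>b i\<bar> * (x t * x (q i * t))"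
      by (intro mult_left_mono L2_cauchy_schwarz L i) auto
    finally show "b i * (\<integral>\<omega>. X t \<omega> * X (q i * t) \<omega> \<partial>M) \<le> \<bar>b i\<bar> * (x t * x (q i * t))" .
  qed
  finally show ?thesis by (simp add: drift_rate_def l2norm_sq)
qed

text \<open>
  The upper right Dini derivative of the second moment at \<open>t\<close> is at most
  \<open>drift_rate t + (noise_norm t)\<^sup>2\<close>, the bound that Ito's formula and the Cauchy-Schwarz inequality suggest.
\<close>

lemma second_moment_growth:
  assumes t: "0 \<le> t"
  shows "\<exists>c1 c2. 0 \<le> c2 \<and> (\<forall>h. 0 < h \<and> h \<le> 1 \<longrightarrow>
    (x (t + h))\<^sup>2 \<le> (x t)\<^sup>2 + h * (drift_rate t + c1 * sqrt h + (noise_norm t + c2 * sqrt h)\<^sup>2))"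
proof -
  define T where "T = t + 1"
  \<comment> \<open>\<open>c1\<close> accounts for freezing the drift at \<open>t\<close>. In
    \<open>c2\<close> the first term is the drift's share in the squared increment and the second
    the variation of the noise coefficient near \<open>t\<close>.\<close>
  define c1 where "c1 = 2 * x t * (Ld * hoelder T)"
  define c2 where "c2 = Ld * xmax T + Lg * hoelder T"
  have T: "0 \<le> T" using t by (simp add: T_def)
  have nn: "0 \<le> Ld" "0 \<le> Lg" "0 \<le> xmax T" "0 \<le> hoelder T"
    using coeff_bound_nonneg xmax_nonneg hoelder_nonneg[OF T] by auto
  have "(x (t + h))\<^sup>2 \<le> (x t)\<^sup>2 + h * (drift_rate t + c1 * sqrt h + (noise_norm t + c2 * sqrt h)\<^sup>2)"
    if h: "0 < h" "h \<le> 1" for h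
  proof -
    have th: "t \<le> t + h" "t + h \<le> T" using h by (auto simp: T_def)
    obtain J where J: "L2 M J"
      "AE \<omega> in M. X (t + h) \<omega> - X t \<omega> = (LINT u:{t..t+h}|lborel. D u \<omega>) + J \<omega>"
      "\<And>\<eta> c. \<eta> > 0 \<Longrightarrow> 0 \<le> c \<Longrightarrow> (\<And>u. max 0 (t - \<eta>) \<le> u \<Longrightarrow> u \<le> t + h \<Longrightarrow> l2norm M (G u) \<le> c) \<Longrightarrow>
        l2norm M J \<le> c * sqrt (t + h - t)"
      "\<And>W. W \<in> borel_measurable (F t) \<Longrightarrow> L2 M W \<Longrightarrow> (\<integral>\<omega>. J \<omega> * W \<omega> \<partial>M) = 0"
      by (rule increment_decomposition[OF t th(1)]) blast
    define P where "P \<omega> = (LINT u:{t..t+h}|lborel. D u \<omega>)" for \<omega>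
    \<comment> \<open>The error of freezing the drift at \<open>t\<close>. By the Hoelder bound it
      is of order \<open>h * sqrt h\<close>, so only \<open>h * D t\<close> counts at first
      order.\<close>
    define Q where "Q \<omega> = (LINT u:{t..t+h}|lborel. D u \<omega> - D t \<omega>)" for \<omega>
    have Xt: "L2 M (X t)" "X t \<in> borel_measurable (F t)" using X_L2 X_adapted t by auto
    have PL: "L2 M P" "l2norm M P \<le> h * (Ld * xmax T)"
    proof -
      have "l2norm M (D u) \<le> Ld * xmax T" if "t \<le> u" "u \<le> t + h" for u
        using that t th x_le_xmax by (intro D_le) auto
      from drift_int[OF t th(1) this] show "L2 M P" "l2norm M P \<le> h * (Ld * xmax T)"
        by (auto simp: P_def[abs_def])
    qed
    have DL: "L2 M (D t)" by (rule D_L2[OF t])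
    have QL: "L2 M Q" "l2norm M Q \<le> h * (Ld * (hoelder T * sqrt h))"
    proof -
      let ?c = "Ld * (hoelder T * sqrt h)"
      have c: "0 \<le> ?c" using nn h by simp
      have 1: "L2 M (\<lambda>\<omega>. D u \<omega> - D t \<omega>)" if "u \<in> {t..t+h}" for u
        using that t by (intro L2_diff D_L2) auto
      have 2: "(\<integral>\<omega>. (D u \<omega> - D t \<omega>)\<^sup>2 \<partial>M) \<le> ?c\<^sup>2" if "u \<in> {t..t+h}" for u
        unfolding L2_square_le_iff[OF c]
        by (rule coeff_hoelder) (use that t th q in auto)
      have 3: "continuous_on {t..t+h} (\<lambda>u. D u \<omega> - D t \<omega>)" if "\<omega> \<in> space M" for \<omega>
        by (intro continuous_intros D_cont that t)
      note R = drift_second_moment_const[where f = "\<lambda>u \<omega>. D u \<omega> - D t \<omega>", OF t th(1) 3 1 2]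
      show "L2 M Q" using R(1) by (simp add: Q_def[abs_def])
      have "(\<integral>\<omega>. (Q \<omega>)\<^sup>2 \<partial>M) \<le> (h * ?c)\<^sup>2"
        using R(2) by (simp add: Q_def power_mult_distrib)
      then show "l2norm M Q \<le> h * ?c" by (intro iffD1[OF L2_square_le_iff]) (use c h in auto)
    qed
    have PQ: "P \<omega> = h * D t \<omega> + Q \<omega>" if "\<omega> \<in> space M" for \<omega>
    proof -
      have i1: "set_integrable lborel {t..t+h} (\<lambda>u. D u \<omega>)"
        by (intro borel_integrable_atLeastAtMost' D_cont that t)
      have i2: "set_integrable lborel {t..t+h} (\<lambda>u. D t \<omega>)"
        by (intro borel_integrable_atLeastAtMost' continuous_on_const)
      have "Q \<omega> = P \<omega> - (LINT u:{t..t+h}|lborel. D t \<omega>)"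
        unfolding Q_def P_def by (rule set_integral_diff(2)[OF i1 i2])
      also have "(LINT u:{t..t+h}|lborel. D t \<omega>) = h * D t \<omega>"
        using h by (simp add: set_lebesgue_integral_def)
      finally show ?thesis by simp
    qed
    \<comment> \<open>The free \<eta> is taken as \<open>h\<close>: all sampled times are then
      within \<open>h\<close> of \<open>t\<close>, and the noise coefficient is its value at
      \<open>t\<close> up to order \<open>sqrt h\<close>.\<close>
    have JL: "l2norm M J \<le> (noise_norm t + Lg * (hoelder T * sqrt h)) * sqrt h"
    proof -
      have "l2norm M (G u) \<le> noise_norm t + Lg * (hoelder T * sqrt h)" if u: "max 0 (t - h) \<le> u" "u \<le> t + h" for u
      proof -
        have "l2norm M (G u) \<le> l2norm M (G t) + l2norm M (\<lambda>\<omega>. G u \<omega> - G t \<omega>)"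
          using u t by (intro l2norm_diff_triangle G_L2) auto
        also have "l2norm M (\<lambda>\<omega>. G u \<omega> - G t \<omega>) \<le> Lg * (hoelder T * sqrt h)"
          by (rule coeff_hoelder) (use u t th r in auto)
        also have "l2norm M (G t) \<le> noise_norm t"
          unfolding noise_norm_def by (rule pantograph_coeff_l2norm_le(2)) (use t X_L2 delay' in auto)
        finally show ?thesis by simp
      qed
      from J(3)[OF h(1) _ this] show ?thesis using noise_norm_nonneg[of t] nn h by simp
    qed
    have PJ: "L2 M (\<lambda>\<omega>. P \<omega> + J \<omega>)" by (rule L2_add[OF PL(1) J(1)])
    have "(x (t + h))\<^sup>2 = (\<integral>\<omega>. (X t \<omega> + (P \<omega> + J \<omega>))\<^sup>2 \<partial>M)"
      unfolding l2norm_sq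
    proof (rule integral_cong_AE)
      show "(\<lambda>\<omega>. (X (t + h) \<omega>)\<^sup>2) \<in> borel_measurable M" using X_measurable t h by simp
      show "(\<lambda>\<omega>. (X t \<omega> + (P \<omega> + J \<omega>))\<^sup>2) \<in> borel_measurable M"
        using L2_add[OF Xt(1) PJ] by (auto simp: L2_def)
      show "AE \<omega> in M. (X (t + h) \<omega>)\<^sup>2 = (X t \<omega> + (P \<omega> + J \<omega>))\<^sup>2"
        using J(2)
      proof eventually_elim
        case (elim \<omega>)
        then have "X (t + h) \<omega> = X t \<omega> + (P \<omega> + J \<omega>)" by (simp add: P_def)
        then show ?case by simp
      qed
    qed
    also have "\<dots> = (\<integral>\<omega>. (X t \<omega>)\<^sup>2 + (2 * (X t \<omega> * P \<omega>) + (2 * (J \<omega> * X t \<omega>) + (P \<omega> + J \<omega>)\<^sup>2)) \<partial>M)"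
      by (intro Bochner_Integration.integral_cong refl) (simp add: power2_eq_square algebra_simps)
    also have "\<dots> = (x t)\<^sup>2 + (2 * (\<integral>\<omega>. X t \<omega> * P \<omega> \<partial>M) + (2 * (\<integral>\<omega>. J \<omega> * X t \<omega> \<partial>M) + (l2norm M (\<lambda>\<omega>. P \<omega> + J \<omega>))\<^sup>2))"
      using L2_integrable[OF Xt(1)] L2_mult_integrable[OF Xt(1) PL(1)] L2_mult_integrable[OF J(1) Xt(1)] L2_integrable[OF PJ]
      by (simp add: l2norm_sq)
    \<comment> \<open>\<open>X t\<close> is known at time \<open>t\<close>, so the noise increment
      is orthogonal to it. The Cauchy-Schwarz bound of this cross term would only be of order
      \<open>sqrt h\<close>.\<close>
    also have "(\<integral>\<omega>. J \<omega> * X t \<omega> \<partial>M) = 0" by (rule J(4)[OF Xt(2,1)])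
    also have "(\<integral>\<omega>. X t \<omega> * P \<omega> \<partial>M) = h * (\<integral>\<omega>. X t \<omega> * D t \<omega> \<partial>M) + (\<integral>\<omega>. X t \<omega> * Q \<omega> \<partial>M)"
    proof -
      have "(\<integral>\<omega>. X t \<omega> * P \<omega> \<partial>M) = (\<integral>\<omega>. h * (X t \<omega> * D t \<omega>) + X t \<omega> * Q \<omega> \<partial>M)"
        by (intro Bochner_Integration.integral_cong refl) (simp add: PQ algebra_simps)
      then show ?thesis
        using L2_mult_integrable[OF Xt(1) DL] L2_mult_integrable[OF Xt(1) QL(1)] by simp
    qed
    finally have E: "(x (t + h))\<^sup>2 = (x t)\<^sup>2 + h * (2 * (\<integral>\<omega>. X t \<omega> * D t \<omega> \<partial>M)) + 2 * (\<integral>\<omega>. X t \<omega> * Q \<omega> \<partial>M)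
      + (l2norm M (\<lambda>\<omega>. P \<omega> + J \<omega>))\<^sup>2" by simp
    have 1: "h * (2 * (\<integral>\<omega>. X t \<omega> * D t \<omega> \<partial>M)) \<le> h * drift_rate t"
      using drift_rate_bound[OF t] h by (intro mult_left_mono) auto
    have 2: "2 * (\<integral>\<omega>. X t \<omega> * Q \<omega> \<partial>M) \<le> h * (c1 * sqrt h)"
    proof -
      have "(\<integral>\<omega>. X t \<omega> * Q \<omega> \<partial>M) \<le> x t * l2norm M Q"
        using L2_cauchy_schwarz[OF Xt(1) QL(1)] by simp
      also have "\<dots> \<le> x t * (h * (Ld * (hoelder T * sqrt h)))" using QL(2) by (intro mult_left_mono) auto
      finally show ?thesis by (simp add: c1_def algebra_simps)
    qed
    have 3: "(l2norm M (\<lambda>\<omega>. P \<omega> + J \<omega>))\<^sup>2 \<le> h * (noise_norm t + c2 * sqrt h)\<^sup>2"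
    proof -
      have "l2norm M (\<lambda>\<omega>. P \<omega> + J \<omega>) \<le> l2norm M P + l2norm M J"
        by (rule l2norm_triangle[OF PL(1) J(1)])
      also have "\<dots> \<le> h * (Ld * xmax T) + (noise_norm t + Lg * (hoelder T * sqrt h)) * sqrt h"
        using PL(2) JL by simp
      also have "\<dots> = sqrt h * (noise_norm t + c2 * sqrt h)"
      proof -
        have "h = sqrt h * sqrt h" using h by simp
        then have "h * (Ld * xmax T) = sqrt h * (sqrt h * (Ld * xmax T))" by (simp add: mult.assoc[symmetric])
        then show ?thesis by (simp add: c2_def algebra_simps)
      qed
      finally have "(l2norm M (\<lambda>\<omega>. P \<omega> + J \<omega>))\<^sup>2 \<le> (sqrt h * (noise_norm t + c2 * sqrt h))\<^sup>2"
        by (intro power_mono) auto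
      then show ?thesis using h by (simp add: power_mult_distrib)
    qed
    show ?thesis using E 1 2 3 by (simp add: distrib_left)
  qed
  moreover have "0 \<le> c2" using nn by (simp add: c2_def)
  ultimately show ?thesis by blast
qed

text \<open>At a contact time the current second moment equals the supersolution while all past ones
  lie below it, so delayed norms are at most \<open>pq\<close> or \<open>pr\<close> times the
  current norm. The growth rate then falls strictly below \<alpha> / (1 + t), the relative slope of
  (1 + t)^\<alpha>. The constant does not depend on \<open>X0\<close> except through
  \<open>e0\<close>.\<close>

lemma mean_square_bound:
  assumes t0: "0 \<le> t0"
    and pq: "\<And>i t. i \<in> {1..n} \<Longrightarrow> t0 \<le> t \<Longrightarrow> ((1 + q i * t) / (1 + t)) powr (\<alpha> / 2) \<le> pq i"
    and pr: "\<And>j t. j \<in> {1..m} \<Longrightarrow> t0 \<le> t \<Longrightarrow> ((1 + r j * t) / (1 + t)) powr (\<alpha> / 2) \<le> pr j"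
    and rate: "\<And>t. t0 \<le> t \<Longrightarrow>
      2 * a + 2 * (\<Sum>i=1..n. \<bar>b i\<bar> * pq i) + (\<bar>\<sigma>\<bar> + (\<Sum>j=1..m. \<bar>\<sigma>' j\<bar> * pr j))\<^sup>2 < \<alpha> / (1 + t)"
    and t: "0 \<le> t"
  shows "(x t)\<^sup>2 \<le> a_priori_const a n b \<sigma> m \<sigma>' t0 * max 1 ((1 + t0) powr (- \<alpha>)) * e0 * (1 + t) powr \<alpha>"
proof -
  define K where "K = a_priori_const a n b \<sigma> m \<sigma>' t0 * max 1 ((1 + t0) powr (- \<alpha>))"
  have ac: "0 < a_priori_const a n b \<sigma> m \<sigma>' t0" by (rule a_priori_const_pos)
  have e0: "0 \<le> e0" by simp
  have "(x t)\<^sup>2 \<le> K * e0 * (1 + t) powr \<alpha> + \<epsilon>" if "\<epsilon> > 0" for \<epsilon>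
  proof -
    \<comment> \<open>The extra term keeps \<open>C\<close> positive even if \<open>e0 = 0\<close>;
      its scaling makes it contribute exactly \<epsilon> at the time \<open>t\<close> under
      consideration.\<close>
    define C where "C = K * e0 + \<epsilon> / (1 + t) powr \<alpha>"
    have K0: "0 \<le> K" using ac by (simp add: K_def)
    have C: "C > 0" unfolding C_def using K0 e0 that t by (intro add_nonneg_pos) auto
    define \<psi> where "\<psi> u = C * (1 + u) powr \<alpha>" for u
    have "(x t)\<^sup>2 \<le> \<psi> t"
    proof (rule dini_comparison[where v = "\<lambda>t. (x t)\<^sup>2" and \<psi> = \<psi>, OF _ _ t0 _ _ t])
      show "continuous_on {0..} (\<lambda>t. (x t)\<^sup>2)" by (intro continuous_intros x_cont)
      show "continuous_on {0..} \<psi>" unfolding \<psi>_def by (intro continuous_intros) auto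
    next
      fix u assume u: "0 \<le> u" "u \<le> t0"
      \<comment> \<open>On \<open>{0..t0}\<close> the a priori bound has to lie below the
        supersolution. The maximum in the constant covers both signs of \<alpha>: the power is at
        least 1 if \<alpha> is nonnegative, and decreases to its value at \<open>t0\<close>
        otherwise.\<close>
      have "1 \<le> max 1 ((1 + t0) powr (- \<alpha>)) * (1 + u) powr \<alpha>"
      proof (cases "\<alpha> \<ge> 0")
        case True
        then have "1 \<le> (1 + u) powr \<alpha>" using u by (simp add: ge_one_powr_ge_zero)
        then have "1 * 1 \<le> max 1 ((1 + t0) powr (- \<alpha>)) * (1 + u) powr \<alpha>" by (intro mult_mono) auto
        then show ?thesis by simp
      next
        case False
        have "1 = (1 + t0) powr (- \<alpha>) * (1 + t0) powr \<alpha>" using t0 by (simp flip: powr_add)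
        also have "\<dots> \<le> max 1 ((1 + t0) powr (- \<alpha>)) * (1 + u) powr \<alpha>"
          using u False by (intro mult_mono powr_mono2') auto
        finally show ?thesis .
      qed
      then have "a_priori_const a n b \<sigma> m \<sigma>' t0 * e0 * 1 \<le>
        a_priori_const a n b \<sigma> m \<sigma>' t0 * e0 * (max 1 ((1 + t0) powr (- \<alpha>)) * (1 + u) powr \<alpha>)"
        using ac e0 by (intro mult_left_mono) auto
      also have "\<dots> = K * e0 * (1 + u) powr \<alpha>" by (simp add: K_def)
      also have "\<dots> \<le> \<psi> u"
        unfolding \<psi>_def C_def using that by (intro mult_right_mono) auto
      finally show "(x u)\<^sup>2 \<le> \<psi> u" using a_priori_bound(2)[OF u] by (simp add: l2norm_sq)
    next
      fix s assume s: "t0 \<le> s" and le: "\<And>u. 0 \<le> u \<Longrightarrow> u \<le> s \<Longrightarrow> (x u)\<^sup>2 \<le> \<psi> u" and eq: "(x s)\<^sup>2 = \<psi> s"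
      have s0: "0 \<le> s" using s t0 by simp
      define \<Lambda> where "\<Lambda> = 2 * a + 2 * (\<Sum>i=1..n. \<bar>b i\<bar> * pq i) + (\<bar>\<sigma>\<bar> + (\<Sum>j=1..m. \<bar>\<sigma>' j\<bar> * pr j))\<^sup>2"
      have \<psi>pos: "\<psi> s > 0" using C s0 by (simp add: \<psi>_def)
      have z: "x s = sqrt C * (1 + s) powr (\<alpha> / 2)"
      proof -
        have "x s = sqrt (\<psi> s)" using eq l2norm_nonneg[of M "X s"] by (metis real_sqrt_abs abs_of_nonneg)
        also have "\<dots> = sqrt C * sqrt ((1 + s) powr \<alpha>)" by (simp add: \<psi>_def real_sqrt_mult)
        also have "sqrt ((1 + s) powr \<alpha>) = (1 + s) powr (\<alpha> / 2)"
          using s0 by (simp add: powr_half_sqrt[symmetric] powr_powr)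
        finally show ?thesis .
      qed
      \<comment> \<open>The supersolution bounds the delayed norm from above and equals the current
        one, so the constant \<open>C\<close> cancels.\<close>
      have del: "x (p * s) \<le> ((1 + p * s) / (1 + s)) powr (\<alpha> / 2) * x s" if "0 \<le> p * s" "p * s \<le> s" for p
      proof -
        have "x (p * s) \<le> sqrt (\<psi> (p * s))" using le[OF that] real_le_rsqrt by blast
        also have "\<dots> = sqrt C * (1 + p * s) powr (\<alpha> / 2)"
          using that by (simp add: \<psi>_def real_sqrt_mult powr_half_sqrt[symmetric] powr_powr)
        also have "(1 + p * s) powr (\<alpha> / 2) = ((1 + p * s) / (1 + s)) powr (\<alpha> / 2) * (1 + s) powr (\<alpha> / 2)"
          using that s0 by (simp flip: powr_mult)
        finally show ?thesis unfolding z by (simp add: ac_simps)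
      qed
      have dq: "x (q i * s) \<le> pq i * x s" if "i \<in> {1..n}" for i
        using del[of "q i"] delay[OF s0 that] pq[OF that s]
          mult_right_mono[OF pq[OF that s] l2norm_nonneg[of M "X s"]] by linarith
      have dr: "x (r j * s) \<le> pr j * x s" if "j \<in> {1..m}" for j
        using del[of "r j"] delay'[OF s0 that] pr[OF that s]
          mult_right_mono[OF pr[OF that s] l2norm_nonneg[of M "X s"]] by linarith
      have R: "drift_rate s + (noise_norm s)\<^sup>2 \<le> \<Lambda> * \<psi> s"
      proof -
        have "(\<Sum>i=1..n. \<bar>b i\<bar> * (x s * x (q i * s))) \<le> (\<Sum>i=1..n. \<bar>b i\<bar> * (x s * (pq i * x s)))"
          using dq by (intro sum_mono mult_left_mono) auto
        also have "\<dots> = (\<Sum>i=1..n. \<bar>b i\<bar> * pq i) * (x s)\<^sup>2"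
          by (simp add: sum_distrib_left sum_distrib_right power2_eq_square ac_simps)
        finally have 1: "drift_rate s \<le> (2 * a + 2 * (\<Sum>i=1..n. \<bar>b i\<bar> * pq i)) * (x s)\<^sup>2"
          by (simp add: drift_rate_def algebra_simps)
        have "noise_norm s \<le> \<bar>\<sigma>\<bar> * x s + (\<Sum>j=1..m. \<bar>\<sigma>' j\<bar> * (pr j * x s))"
          unfolding noise_norm_def using dr by (intro add_left_mono sum_mono mult_left_mono) auto
        also have "\<dots> = (\<bar>\<sigma>\<bar> + (\<Sum>j=1..m. \<bar>\<sigma>' j\<bar> * pr j)) * x s"
          by (simp add: distrib_right sum_distrib_right mult.assoc)
        finally have "(noise_norm s)\<^sup>2 \<le> ((\<bar>\<sigma>\<bar> + (\<Sum>j=1..m. \<bar>\<sigma>' j\<bar> * pr j)) * x s)\<^sup>2"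
          using noise_norm_nonneg by (intro power_mono) auto
        then have 2: "(noise_norm s)\<^sup>2 \<le> (\<bar>\<sigma>\<bar> + (\<Sum>j=1..m. \<bar>\<sigma>' j\<bar> * pr j))\<^sup>2 * (x s)\<^sup>2"
          by (simp only: power_mult_distrib)
        have "\<Lambda> * \<psi> s = (2 * a + 2 * (\<Sum>i=1..n. \<bar>b i\<bar> * pq i)) * (x s)\<^sup>2 +
            (\<bar>\<sigma>\<bar> + (\<Sum>j=1..m. \<bar>\<sigma>' j\<bar> * pr j))\<^sup>2 * (x s)\<^sup>2"
          by (simp only: \<Lambda>_def eq[symmetric] distrib_right)
        then show ?thesis using add_mono[OF 1 2] by simp
      qed
      obtain c1 c2 where growth: "\<And>h. 0 < h \<Longrightarrow> h \<le> 1 \<Longrightarrow>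
          (x (s + h))\<^sup>2 \<le> (x s)\<^sup>2 + h * (drift_rate s + c1 * sqrt h + (noise_norm s + c2 * sqrt h)\<^sup>2)"
        using second_moment_growth[OF s0] by blast
      define d where "d = C * (\<alpha> * (1 + s) powr (\<alpha> - 1))"
      have dpsi: "d = \<psi> s * (\<alpha> / (1 + s))" using s0 by (simp add: d_def \<psi>_def powr_diff)
      have "\<Lambda> * \<psi> s < d"
        using mult_strict_left_mono[OF rate[OF s, folded \<Lambda>_def] \<psi>pos] by (simp add: dpsi mult.commute)
      then have Rd: "drift_rate s + (noise_norm s)\<^sup>2 < d" using R by simp
      \<comment> \<open>A value strictly between the growth rate of the second moment and the slope
        of \<psi>; for small \<open>h\<close> it separates the two difference quotients.\<close>
      define mid where "mid = (drift_rate s + (noise_norm s)\<^sup>2 + d) / 2"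
      have "((\<lambda>u. C * (1 + u) powr \<alpha>) has_field_derivative C * (\<alpha> * (1 + s) powr (\<alpha> - 1))) (at s)"
        using s0 by (auto intro!: derivative_eq_intros)
      then have "((\<lambda>h. (\<psi> (s + h) - \<psi> s) / h) \<longlongrightarrow> d) (at 0)"
        unfolding DERIV_def \<psi>_def d_def by simp
      then have l1: "((\<lambda>h. (\<psi> (s + h) - \<psi> s) / h) \<longlongrightarrow> d) (at_right 0)"
        by (rule filterlim_mono[OF _ order_refl at_le]) auto
      have "((\<lambda>h. drift_rate s + c1 * sqrt h + (noise_norm s + c2 * sqrt h)\<^sup>2) \<longlongrightarrow>
        drift_rate s + c1 * sqrt 0 + (noise_norm s + c2 * sqrt 0)\<^sup>2) (at_right 0)"
        by (intro tendsto_intros)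
      then have l2: "((\<lambda>h. drift_rate s + c1 * sqrt h + (noise_norm s + c2 * sqrt h)\<^sup>2) \<longlongrightarrow>
        drift_rate s + (noise_norm s)\<^sup>2) (at_right 0)" by simp
      have "eventually (\<lambda>h. mid < (\<psi> (s + h) - \<psi> s) / h) (at_right 0)"
        by (rule order_tendstoD(1)[OF l1]) (use Rd in \<open>simp add: mid_def\<close>)
      moreover have "eventually (\<lambda>h. drift_rate s + c1 * sqrt h + (noise_norm s + c2 * sqrt h)\<^sup>2 < mid) (at_right 0)"
        by (rule order_tendstoD(2)[OF l2]) (use Rd in \<open>simp add: mid_def\<close>)
      moreover have "eventually (\<lambda>h::real. h < 1) (at_right 0)"
        by (rule eventually_at_rightI[of 0 1]) auto
      moreover have "eventually (\<lambda>h::real. 0 < h) (at_right 0)" by (rule eventually_at_right_less)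
      ultimately have "eventually (\<lambda>h. (x (s + h))\<^sup>2 \<le> \<psi> (s + h)) (at_right 0)"
      proof eventually_elim
        case (elim h)
        have "(x (s + h))\<^sup>2 \<le> \<psi> s + h * (drift_rate s + c1 * sqrt h + (noise_norm s + c2 * sqrt h)\<^sup>2)"
          using growth[of h] elim eq by simp
        also have "\<dots> \<le> \<psi> s + h * ((\<psi> (s + h) - \<psi> s) / h)"
          using elim by (intro add_left_mono mult_left_mono) auto
        also have "\<dots> = \<psi> (s + h)" using elim by simp
        finally show ?case .
      qed
      then show "\<exists>\<eta>>0. \<forall>h. 0 < h \<and> h < \<eta> \<longrightarrow> (x (s + h))\<^sup>2 \<le> \<psi> (s + h)"
        unfolding eventually_at_right_field by auto
    qed
    also have "\<psi> t = K * e0 * (1 + t) powr \<alpha> + \<epsilon>"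
      using t by (simp add: \<psi>_def C_def distrib_right)
    finally show ?thesis .
  qed
  then show ?thesis unfolding K_def[symmetric] by (rule field_le_epsilon)
qed

end

section \<open>Almost sure growth\<close>

text \<open>Decompose the event according to the first index above the level.\<close>

lemma (in brownian_filtration) kolmogorov_maximal:
  fixes Y :: "nat \<Rightarrow> 'w \<Rightarrow> real" and \<tau> :: "nat \<Rightarrow> real"
  assumes \<tau>: "0 \<le> \<tau> 0" "\<And>k. k < L \<Longrightarrow> \<tau> k \<le> \<tau> (Suc k)"
    and Y: "\<And>k. k \<le> L \<Longrightarrow> Y k \<in> borel_measurable (F (\<tau> k))" "\<And>k. k \<le> L \<Longrightarrow> L2 M (Y k)"
    and orth: "\<And>k W. k \<le> L \<Longrightarrow> W \<in> borel_measurable (F (\<tau> k)) \<Longrightarrow> L2 M W \<Longrightarrow>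
      (\<integral>\<omega>. (Y L \<omega> - Y k \<omega>) * W \<omega> \<partial>M) = 0"
    and c: "c > 0"
  shows "prob {\<omega> \<in> space M. \<exists>k\<le>L. c < \<bar>Y k \<omega>\<bar>} \<le> (\<integral>\<omega>. (Y L \<omega>)\<^sup>2 \<partial>M) / c\<^sup>2"
proof -
  have \<tau>m: "\<tau> j \<le> \<tau> k" if "j \<le> k" "k \<le> L" for j k
    using le_if_Suc_le[of L \<tau> j k] \<tau> that by auto
  have \<tau>0: "0 \<le> \<tau> k" if "k \<le> L" for k using \<tau>m[of 0 k] \<tau> that by auto
  define E where "E k = {\<omega> \<in> space M. c < \<bar>Y k \<omega>\<bar> \<and> (\<forall>j\<in>{..<k}. \<not> c < \<bar>Y j \<omega>\<bar>)}" for k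
  have EF: "E k \<in> sets (F (\<tau> k))" if k: "k \<le> L" for k
  proof -
    have m: "Y j \<in> borel_measurable (F (\<tau> k))" if "j \<in> {..<k}" for j
      using adapted_mono[OF \<tau>0 \<tau>m Y(1)] that k by auto
    have mk: "Y k \<in> borel_measurable (F (\<tau> k))" by (rule Y(1)[OF k])
    note m[measurable] mk[measurable]
    have "{\<omega> \<in> space (F (\<tau> k)). c < \<bar>Y k \<omega>\<bar> \<and> (\<forall>j\<in>{..<k}. \<not> c < \<bar>Y j \<omega>\<bar>)} \<in> sets (F (\<tau> k))"
      by measurable
    then show ?thesis unfolding E_def space_F[OF \<tau>0[OF k]] .
  qed
  have EM: "E k \<in> events" if "k \<le> L" for k
    using EF[OF that] subalg[OF \<tau>0[OF that]] by (auto simp: subalgebra_def)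
  have disj: "disjoint_family_on E {..L}"
  proof (unfold disjoint_family_on_def, intro ballI impI)
    fix j k :: nat assume "j \<noteq> k"
    then consider "j < k" | "k < j" by linarith
    then show "E j \<inter> E k = {}" by cases (auto simp: E_def)
  qed
  have un: "{\<omega> \<in> space M. \<exists>k\<le>L. c < \<bar>Y k \<omega>\<bar>} = (\<Union>k\<in>{..L}. E k)"
  proof (intro set_eqI iffI)
    fix \<omega> assume \<omega>: "\<omega> \<in> {\<omega> \<in> space M. \<exists>k\<le>L. c < \<bar>Y k \<omega>\<bar>}"
    define k where "k = (LEAST k. c < \<bar>Y k \<omega>\<bar>)"
    obtain k' where k': "k' \<le> L" "c < \<bar>Y k' \<omega>\<bar>" using \<omega> by auto
    have "c < \<bar>Y k \<omega>\<bar>" unfolding k_def using k'(2) by (rule LeastI)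
    moreover have "k \<le> k'" unfolding k_def using k'(2) by (rule Least_le)
    moreover have "\<forall>j\<in>{..<k}. \<not> c < \<bar>Y j \<omega>\<bar>" unfolding k_def using not_less_Least by blast
    ultimately show "\<omega> \<in> (\<Union>k\<in>{..L}. E k)" using \<omega> k'(1) by (auto simp: E_def)
  qed (auto simp: E_def)
  have EL: "L2 M (\<lambda>\<omega>. Z \<omega> * indicator (E k) \<omega>)" if "L2 M Z" "k \<le> L" for Z k
  proof (rule L2_dominated[OF that(1)])
    show "(\<lambda>\<omega>. Z \<omega> * indicator (E k) \<omega>) \<in> borel_measurable M"
      using EM[OF that(2)] that(1) by (intro borel_measurable_times) (auto simp: L2_def)
  qed (simp add: indicator_def)
  have key: "c\<^sup>2 * prob (E k) \<le> (\<integral>\<omega>. (Y L \<omega> * indicator (E k) \<omega>)\<^sup>2 \<partial>M)" if k: "k \<le> L" for k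
  proof -
    define W where "W \<omega> = Y k \<omega> * indicator (E k) \<omega>" for \<omega>
    have WL: "L2 M W" unfolding W_def by (intro EL Y k)
    have WF: "W \<in> borel_measurable (F (\<tau> k))"
      unfolding W_def using Y(1)[OF k] EF[OF k] by (intro borel_measurable_times) auto
    have dL: "L2 M (\<lambda>\<omega>. Y L \<omega> - Y k \<omega>)" by (intro L2_diff Y k order_refl)
    have "c\<^sup>2 * prob (E k) = (\<integral>\<omega>. c\<^sup>2 * indicator (E k) \<omega> \<partial>M)"
      using EM[OF k] by simp
    \<comment> \<open>On \<open>E k\<close> the integrand equals (Y k)^2 + (Y L - Y k)^2, hence is
      at least c^2. The subtracted cross term has mean zero because \<open>W\<close> is known at
      time \<open>\<tau> k\<close>.\<close>
    also have "\<dots> \<le> (\<integral>\<omega>. (Y L \<omega> * indicator (E k) \<omega>)\<^sup>2 - 2 * ((Y L \<omega> - Y k \<omega>) * W \<omega>) \<partial>M)"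
    proof (rule integral_mono)
      show "integrable M (\<lambda>\<omega>. c\<^sup>2 * indicator (E k) \<omega>)"
        using EM[OF k] by (intro integrable_mult_right integrable_real_indicator) (auto simp: less_top[symmetric])
      show "integrable M (\<lambda>\<omega>. (Y L \<omega> * indicator (E k) \<omega>)\<^sup>2 - 2 * ((Y L \<omega> - Y k \<omega>) * W \<omega>))"
        by (intro Bochner_Integration.integrable_diff integrable_mult_right L2_integrable EL Y k order_refl
            L2_mult_integrable dL WL)
      fix \<omega> assume "\<omega> \<in> space M"
      show "c\<^sup>2 * indicator (E k) \<omega> \<le> (Y L \<omega> * indicator (E k) \<omega>)\<^sup>2 - 2 * ((Y L \<omega> - Y k \<omega>) * W \<omega>)"
      proof (cases "\<omega> \<in> E k")
        case True
        then have "c < \<bar>Y k \<omega>\<bar>" by (simp add: E_def)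
        then have "c\<^sup>2 \<le> \<bar>Y k \<omega>\<bar>\<^sup>2" using c by (intro power_mono) auto
        then have "c\<^sup>2 \<le> (Y k \<omega>)\<^sup>2" by simp
        moreover have "(Y L \<omega>)\<^sup>2 - 2 * ((Y L \<omega> - Y k \<omega>) * Y k \<omega>) = (Y k \<omega>)\<^sup>2 + (Y L \<omega> - Y k \<omega>)\<^sup>2"
          by (simp add: power2_eq_square algebra_simps)
        ultimately have "c\<^sup>2 \<le> (Y L \<omega>)\<^sup>2 - 2 * ((Y L \<omega> - Y k \<omega>) * Y k \<omega>)"
          using zero_le_power2[of "Y L \<omega> - Y k \<omega>"] by linarith
        then show ?thesis using True by (simp add: W_def)
      qed (simp add: W_def)
    qed
    also have "\<dots> = (\<integral>\<omega>. (Y L \<omega> * indicator (E k) \<omega>)\<^sup>2 \<partial>M) - 2 * (\<integral>\<omega>. (Y L \<omega> - Y k \<omega>) * W \<omega> \<partial>M)"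
      using L2_integrable[OF EL[OF Y(2)[OF order_refl] k]] L2_mult_integrable[OF dL WL] by simp
    also have "(\<integral>\<omega>. (Y L \<omega> - Y k \<omega>) * W \<omega> \<partial>M) = 0" by (rule orth[OF k WF WL])
    finally show ?thesis by simp
  qed
  have "c\<^sup>2 * prob (\<Union>k\<in>{..L}. E k) = (\<Sum>k\<le>L. c\<^sup>2 * prob (E k))"
    using EM by (subst finite_measure_finite_Union[OF _ _ disj]) (auto simp: sum_distrib_left)
  also have "\<dots> \<le> (\<Sum>k\<le>L. (\<integral>\<omega>. (Y L \<omega> * indicator (E k) \<omega>)\<^sup>2 \<partial>M))"
    using key by (intro sum_mono) simp
  also have "\<dots> = (\<integral>\<omega>. (\<Sum>k\<le>L. (Y L \<omega> * indicator (E k) \<omega>)\<^sup>2) \<partial>M)"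
    by (rule Bochner_Integration.integral_sum[symmetric]) (intro L2_integrable EL Y, auto)
  also have "\<dots> \<le> (\<integral>\<omega>. (Y L \<omega>)\<^sup>2 \<partial>M)"
  proof (rule integral_mono)
    show "integrable M (\<lambda>\<omega>. \<Sum>k\<le>L. (Y L \<omega> * indicator (E k) \<omega>)\<^sup>2)"
      by (intro Bochner_Integration.integrable_sum L2_integrable EL Y) auto
    show "integrable M (\<lambda>\<omega>. (Y L \<omega>)\<^sup>2)" by (intro L2_integrable Y order_refl)
    fix \<omega>
    have "(\<Sum>k\<le>L. indicator (E k) \<omega> :: real) = indicator (\<Union>k\<in>{..L}. E k) \<omega>"
      by (rule indicator_UN_disjoint[symmetric, OF finite_atMost disj])
    then have "(\<Sum>k\<le>L. indicator (E k) \<omega> :: real) \<le> 1" by (simp add: indicator_def)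
    then have "(Y L \<omega>)\<^sup>2 * (\<Sum>k\<le>L. indicator (E k) \<omega>) \<le> (Y L \<omega>)\<^sup>2 * 1" by (intro mult_left_mono) auto
    moreover have "(\<Sum>k\<le>L. (Y L \<omega> * indicator (E k) \<omega>)\<^sup>2) = (Y L \<omega>)\<^sup>2 * (\<Sum>k\<le>L. indicator (E k) \<omega>)"
      unfolding sum_distrib_left by (intro sum.cong refl) (simp add: power_mult_distrib indicator_def)
    ultimately show "(\<Sum>k\<le>L. (Y L \<omega> * indicator (E k) \<omega>)\<^sup>2) \<le> (Y L \<omega>)\<^sup>2" by simp
  qed
  finally show ?thesis unfolding un using c by (simp add: field_simps)
qed

text \<open>Exceeding a level strictly is an open condition along a continuous path, so it already
  occurs at a dyadic time. This makes a supremum over an interval a countable matter.\<close>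

lemma dyadic_approximation:
  fixes f :: "real \<Rightarrow> real"
  assumes f: "continuous_on {s..s+1} f" and v: "v \<in> {s..s+1}" "c < \<bar>f v\<bar>"
  shows "\<exists>l. \<exists>k\<le>2^l. c < \<bar>f (s + real k / 2^l)\<bar>"
proof -
  have "\<bar>f v\<bar> - c > 0" using v by simp
  then obtain d where d: "d > 0" "\<And>u. u \<in> {s..s+1} \<Longrightarrow> dist u v < d \<Longrightarrow> dist (f u) (f v) < \<bar>f v\<bar> - c"
    using f v(1) unfolding continuous_on_iff by blast
  obtain l where l: "(1 / 2) ^ l < d" using real_arch_pow_inv[of d "1/2"] d(1) by auto
  define k where "k = nat \<lfloor>(v - s) * 2 ^ l\<rfloor>"
  have nn: "0 \<le> (v - s) * 2 ^ l" using v by simp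
  have k: "real k \<le> (v - s) * 2 ^ l" "(v - s) * 2 ^ l < real k + 1" using nn unfolding k_def by linarith+
  have "(v - s) * 2 ^ l \<le> 1 * 2 ^ l" using v by (intro mult_right_mono) auto
  with k(1) have "real k \<le> 1 * 2 ^ l" by (rule order_trans)
  then have "real k \<le> real (2 ^ l)" by (simp only: mult_1 of_nat_power of_nat_numeral)
  then have kl: "k \<le> 2 ^ l" by (simp only: of_nat_le_iff)
  have "real k / 2 ^ l \<le> v - s" "v - s < real k / 2 ^ l + 1 / 2 ^ l"
    using k by (simp_all add: field_simps)
  moreover have "1 / 2 ^ l < d" using l by (simp add: power_one_over)
  moreover have "0 \<le> real k / 2 ^ l" by simp
  ultimately have u: "s + real k / 2 ^ l \<in> {s..s+1}" "dist (s + real k / 2 ^ l) v < d"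
    using v unfolding dist_real_def atLeastAtMost_iff by linarith+
  from d(2)[OF this] have "c < \<bar>f (s + real k / 2 ^ l)\<bar>" by (simp add: dist_real_def)
  then show ?thesis using kl by blast
qed

section \<open>Control of the path over unit time windows\<close>

context pantograph
begin

text \<open>Almost surely the Ito increment, but defined from the path itself. It is thus continuous
  in \<open>t\<close> on every path, whereas \<open>has_ito_integral\<close> fixes the integral at
  each time only up to a null set.\<close>

definition noise :: "real \<Rightarrow> real \<Rightarrow> 'w \<Rightarrow> real" where
  "noise s t \<omega> = X t \<omega> - X s \<omega> - (LINT u:{s..t}|lborel. D u \<omega>)"

lemma drift_integral_split:
  assumes "\<omega> \<in> space M" "0 \<le> s" "s \<le> v" "v \<le> t"
  shows "(LINT u:{s..t}|lborel. D u \<omega>) = (LINT u:{s..v}|lborel. D u \<omega>) + (LINT u:{v..t}|lborel. D u \<omega>)"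
proof -
  have c: "continuous_on {s..t} (\<lambda>u. D u \<omega>)" using D_cont assms by simp
  have i: "(LINT u:{v..w}|lborel. D u \<omega>) = integral {v..w} (\<lambda>u. D u \<omega>)" if "s \<le> v" for v w
    by (intro set_borel_integral_eq_integral(2) borel_integrable_atLeastAtMost' D_cont)
      (use assms that in auto)
  have "integral {s..v} (\<lambda>u. D u \<omega>) + integral {v..t} (\<lambda>u. D u \<omega>) = integral {s..t} (\<lambda>u. D u \<omega>)"
    using assms by (intro Henstock_Kurzweil_Integration.integral_combine integrable_continuous_real c)
  then show ?thesis using i[of s t] i[of s v] i[of v t] assms by simp
qed

lemma noise_cont:
  assumes "\<omega> \<in> space M" "0 \<le> s"
  shows "continuous_on {s..s+1} (\<lambda>t. noise s t \<omega>)"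
proof -
  have c: "continuous_on {s..s+1} (\<lambda>u. D u \<omega>)" using D_cont assms by simp
  have i: "(LINT u:{s..t}|lborel. D u \<omega>) = integral {s..t} (\<lambda>u. D u \<omega>)" for t
    by (intro set_borel_integral_eq_integral(2) borel_integrable_atLeastAtMost' D_cont) (use assms in auto)
  have "continuous_on {s..s+1} (\<lambda>t. X t \<omega>)"
    by (rule continuous_on_subset[OF X_cont[OF assms(1)]]) (use assms in auto)
  then show ?thesis
    unfolding noise_def i
    by (intro continuous_on_diff continuous_on_const indefinite_integral_continuous_1 integrable_continuous_real c)
qed

lemma noise_adapted:
  assumes "0 \<le> s" "s \<le> t"
  shows "noise s t \<in> borel_measurable (F t)"
proof -
  have [measurable]: "X t \<in> borel_measurable (F t)" "X s \<in> borel_measurable (F t)"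
    using assms adapted_mono[OF _ _ X_adapted] X_adapted by auto
  have [measurable]: "(\<lambda>\<omega>. LINT u:{s..t}|lborel. D u \<omega>) \<in> borel_measurable (F t)"
  proof (rule riemann_integral_measurable[OF assms])
    show "D u \<in> borel_measurable (F t)" if "u \<in> {s..t}" for u
      using adapted_mono[OF _ _ D_adapted] that assms by auto
    show "continuous_on {s..t} (\<lambda>u. D u \<omega>)" if "\<omega> \<in> space (F t)" for \<omega>
      using D_cont that assms space_F[of t] by simp
  qed
  show ?thesis unfolding noise_def[abs_def] by measurable
qed

lemma noise_moments:
  assumes st: "0 \<le> s" "s \<le> t"
  shows "L2 M (noise s t)"
    "0 \<le> c \<Longrightarrow> (\<And>u. max 0 (s - 1) \<le> u \<Longrightarrow> u \<le> t \<Longrightarrow> l2norm M (G u) \<le> c) \<Longrightarrow>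
      l2norm M (noise s t) \<le> c * sqrt (t - s)"
    "W \<in> borel_measurable (F s) \<Longrightarrow> L2 M W \<Longrightarrow> (\<integral>\<omega>. noise s t \<omega> * W \<omega> \<partial>M) = 0"
proof -
  obtain J where J: "L2 M J"
    "AE \<omega> in M. X t \<omega> - X s \<omega> = (LINT u:{s..t}|lborel. D u \<omega>) + J \<omega>"
    "\<And>\<eta> c. \<eta> > 0 \<Longrightarrow> 0 \<le> c \<Longrightarrow> (\<And>u. max 0 (s - \<eta>) \<le> u \<Longrightarrow> u \<le> t \<Longrightarrow> l2norm M (G u) \<le> c) \<Longrightarrow>
      l2norm M J \<le> c * sqrt (t - s)"
    "\<And>W. W \<in> borel_measurable (F s) \<Longrightarrow> L2 M W \<Longrightarrow> (\<integral>\<omega>. J \<omega> * W \<omega> \<partial>M) = 0"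
    by (rule increment_decomposition[OF st]) blast
  have eq: "AE \<omega> in M. J \<omega> = noise s t \<omega>" using J(2) by eventually_elim (simp add: noise_def)
  have m[measurable]: "noise s t \<in> borel_measurable M" "J \<in> borel_measurable M"
    using adapted_M[OF _ noise_adapted[OF st]] st J(1) by (auto simp: L2_def)
  show "L2 M (noise s t)" by (rule L2_cong_AE[OF J(1) eq m(1)])
  show "l2norm M (noise s t) \<le> c * sqrt (t - s)"
    if "0 \<le> c" "\<And>u. max 0 (s - 1) \<le> u \<Longrightarrow> u \<le> t \<Longrightarrow> l2norm M (G u) \<le> c"
    using J(3)[OF zero_less_one that] l2norm_cong_AE[OF eq m(2,1)] by simp
  show "(\<integral>\<omega>. noise s t \<omega> * W \<omega> \<partial>M) = 0" if W: "W \<in> borel_measurable (F s)" "L2 M W"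
  proof -
    have "(\<integral>\<omega>. noise s t \<omega> * W \<omega> \<partial>M) = (\<integral>\<omega>. J \<omega> * W \<omega> \<partial>M)"
    proof (rule integral_cong_AE)
      show "AE \<omega> in M. noise s t \<omega> * W \<omega> = J \<omega> * W \<omega>" using eq by eventually_elim simp
    qed (use W m in \<open>auto simp: L2_def\<close>)
    then show ?thesis using J(4)[OF W] by simp
  qed
qed

text \<open>Kolmogorov's inequality on each dyadic level gives the same bound; the levels are nested
  and exhaust the event, so continuity from below transfers the bound to the whole interval.\<close>

lemma noise_maximal:
  assumes s: "0 \<le> s" and c: "0 \<le> c" and Gc: "\<And>u. max 0 (s - 1) \<le> u \<Longrightarrow> u \<le> s + 1 \<Longrightarrow> l2norm M (G u) \<le> c"
    and K: "K > 0"
  shows "{\<omega> \<in> space M. \<exists>v\<in>{s..s+1}. K < \<bar>noise s v \<omega>\<bar>} \<in> events"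
    "prob {\<omega> \<in> space M. \<exists>v\<in>{s..s+1}. K < \<bar>noise s v \<omega>\<bar>} \<le> c\<^sup>2 / K\<^sup>2"
proof -
  define \<tau> where "\<tau> l k = s + real k / 2 ^ l" for l k :: nat
  define E where "E l = {\<omega> \<in> space M. \<exists>k\<le>2^l. K < \<bar>noise s (\<tau> l k) \<omega>\<bar>}" for l
  have \<tau>r: "\<tau> l k \<in> {s..s+1}" if "k \<le> 2 ^ l" for l k
  proof -
    have "real k \<le> real (2 ^ l)" using that by (simp only: of_nat_le_iff)
    then show ?thesis by (simp add: \<tau>_def field_simps)
  qed
  have \<tau>m: "\<tau> l j \<le> \<tau> l k" if "j \<le> k" for l j k
    using that by (simp add: \<tau>_def divide_right_mono)
  have Em[measurable]: "E l \<in> events" for l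
  proof -
    have [measurable]: "noise s (\<tau> l k) \<in> borel_measurable M" if "k \<in> {..2^l}" for k
      using noise_moments(1)[OF s, of "\<tau> l k"] \<tau>r[of k l] that by (auto simp: L2_def)
    have "{\<omega> \<in> space M. \<exists>k\<in>{..2^l}. K < \<bar>noise s (\<tau> l k) \<omega>\<bar>} \<in> events" by measurable
    then show ?thesis by (simp add: E_def Bex_def)
  qed
  have Un: "{\<omega> \<in> space M. \<exists>v\<in>{s..s+1}. K < \<bar>noise s v \<omega>\<bar>} = (\<Union>l. E l)"
  proof (intro set_eqI iffI)
    fix \<omega> assume \<omega>: "\<omega> \<in> {\<omega> \<in> space M. \<exists>v\<in>{s..s+1}. K < \<bar>noise s v \<omega>\<bar>}"
    then obtain v where v: "v \<in> {s..s+1}" "K < \<bar>noise s v \<omega>\<bar>" and sp: "\<omega> \<in> space M" by blast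
    obtain l k where "k \<le> 2 ^ l" "K < \<bar>noise s (s + real k / 2 ^ l) \<omega>\<bar>"
      using dyadic_approximation[OF noise_cont[OF sp s] v] by blast
    then show "\<omega> \<in> (\<Union>l. E l)" using sp by (auto simp: E_def \<tau>_def)
  next
    fix \<omega> assume "\<omega> \<in> (\<Union>l. E l)"
    then show "\<omega> \<in> {\<omega> \<in> space M. \<exists>v\<in>{s..s+1}. K < \<bar>noise s v \<omega>\<bar>}"
      using \<tau>r unfolding E_def by blast
  qed
  have inc: "incseq E"
  proof (rule incseq_SucI, rule subsetI)
    fix l \<omega> assume "\<omega> \<in> E l"
    then obtain k where k: "\<omega> \<in> space M" "k \<le> 2 ^ l" "K < \<bar>noise s (\<tau> l k) \<omega>\<bar>" by (auto simp: E_def)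
    \<comment> \<open>A dyadic point reappears on the next level with doubled index.\<close>
    have "\<tau> (Suc l) (2 * k) = \<tau> l k" by (simp add: \<tau>_def)
    then show "\<omega> \<in> E (Suc l)" using k unfolding E_def by (intro CollectI conjI exI[of _ "2 * k"]) auto
  qed
  have Ple: "prob (E l) \<le> c\<^sup>2 / K\<^sup>2" for l
  proof -
    have \<tau>0: "0 \<le> \<tau> l 0" using s by (simp add: \<tau>_def)
    have \<tau>S: "\<tau> l k \<le> \<tau> l (Suc k)" if "k < 2 ^ l" for k by (rule \<tau>m) simp
    have top: "\<tau> l (2 ^ l) = s + 1" by (simp add: \<tau>_def)
    have "prob (E l) \<le> (\<integral>\<omega>. (noise s (\<tau> l (2 ^ l)) \<omega>)\<^sup>2 \<partial>M) / K\<^sup>2"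
      unfolding E_def
    proof (rule kolmogorov_maximal[where \<tau> = "\<tau> l" and Y = "\<lambda>k. noise s (\<tau> l k)" and L = "2 ^ l", OF \<tau>0 \<tau>S _ _ _ K])
      fix k :: nat assume k: "k \<le> 2 ^ l"
      have tk: "s \<le> \<tau> l k" "\<tau> l k \<le> s + 1" using \<tau>r[OF k] by auto
      show "noise s (\<tau> l k) \<in> borel_measurable (F (\<tau> l k))" by (rule noise_adapted[OF s tk(1)])
      show "L2 M (noise s (\<tau> l k))" by (rule noise_moments(1)[OF s tk(1)])
      fix W assume W: "W \<in> borel_measurable (F (\<tau> l k))" "L2 M W"
      have "(\<integral>\<omega>. (noise s (\<tau> l (2 ^ l)) \<omega> - noise s (\<tau> l k) \<omega>) * W \<omega> \<partial>M) = (\<integral>\<omega>. noise (\<tau> l k) (s + 1) \<omega> * W \<omega> \<partial>M)"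
      proof (intro Bochner_Integration.integral_cong refl)
        fix \<omega> assume "\<omega> \<in> space M"
        then show "(noise s (\<tau> l (2 ^ l)) \<omega> - noise s (\<tau> l k) \<omega>) * W \<omega> = noise (\<tau> l k) (s + 1) \<omega> * W \<omega>"
          using drift_integral_split[of \<omega> s "\<tau> l k" "s + 1"] s tk by (simp add: noise_def top)
      qed
      also have "\<dots> = 0" by (rule noise_moments(3)[OF _ _ W]) (use s tk in auto)
      finally show "(\<integral>\<omega>. (noise s (\<tau> l (2 ^ l)) \<omega> - noise s (\<tau> l k) \<omega>) * W \<omega> \<partial>M) = 0" .
    qed
    also have "(\<integral>\<omega>. (noise s (\<tau> l (2 ^ l)) \<omega>)\<^sup>2 \<partial>M) \<le> c\<^sup>2"
      unfolding top L2_square_le_iff[OF c]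
      using noise_moments(2)[of s "s + 1", OF s _ c Gc] by simp
    finally show ?thesis using K by (simp add: divide_right_mono)
  qed
  show "{\<omega> \<in> space M. \<exists>v\<in>{s..s+1}. K < \<bar>noise s v \<omega>\<bar>} \<in> events" unfolding Un by measurable
  have "(\<lambda>l. prob (E l)) \<longlonglongrightarrow> prob (\<Union>l. E l)"
    by (rule finite_Lim_measure_incseq) (use inc Em in auto)
  then show "prob {\<omega> \<in> space M. \<exists>v\<in>{s..s+1}. K < \<bar>noise s v \<omega>\<bar>} \<le> c\<^sup>2 / K\<^sup>2"
    unfolding Un by (rule LIMSEQ_le_const2) (use Ple in auto)
qed

text \<open>On a unit window the path is the sum of its initial value, a drift integral and the
  noise. Each exceeds \<open>K\<close> with probability of order \<open>y^2 / K^2\<close>, and off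
  these three events the sum is at most \<open>3 * K\<close>. The bounds reach back to
  \<open>s - 1\<close> because the Ito estimate samples before \<open>s\<close>.\<close>

lemma window_prob_bound:
  assumes s: "0 \<le> s" and y: "0 \<le> y" and K: "K > 0"
    and xy: "\<And>u. max 0 (s - 1) \<le> u \<Longrightarrow> u \<le> s + 1 \<Longrightarrow> x u \<le> y"
      "\<And>u i. max 0 (s - 1) \<le> u \<Longrightarrow> u \<le> s + 1 \<Longrightarrow> i \<in> {1..n} \<Longrightarrow> x (q i * u) \<le> y"
      "\<And>u j. max 0 (s - 1) \<le> u \<Longrightarrow> u \<le> s + 1 \<Longrightarrow> j \<in> {1..m} \<Longrightarrow> x (r j * u) \<le> y"
  shows "\<exists>A\<in>events. prob A \<le> (1 + Ld\<^sup>2 + Lg\<^sup>2) * y\<^sup>2 / K\<^sup>2 \<and>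
    (\<forall>\<omega>\<in>space M - A. \<forall>t\<in>{s..s+1}. \<bar>X t \<omega>\<bar> \<le> 3 * K)"
proof -
  have Dy: "l2norm M (D u) \<le> Ld * y" if "max 0 (s - 1) \<le> u" "u \<le> s + 1" for u
    by (rule pantograph_coeff_l2norm_bound) (use that xy X_L2 delay in auto)
  have Gy: "l2norm M (G u) \<le> Lg * y" if "max 0 (s - 1) \<le> u" "u \<le> s + 1" for u
    by (rule pantograph_coeff_l2norm_bound) (use that xy X_L2 delay' in auto)
  have L: "0 \<le> Ld * y" "0 \<le> Lg * y" using y coeff_bound_nonneg by auto
  \<comment> \<open>Integrating the absolute value over the full window dominates the drift integral
    for all end times at once.\<close>
  define R where "R \<omega> = (LINT u:{s..s+1}|lborel. \<bar>D u \<omega>\<bar>)" for \<omega>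
  have RL: "L2 M R" "(\<integral>\<omega>. (R \<omega>)\<^sup>2 \<partial>M) \<le> (Ld * y)\<^sup>2"
  proof -
    have 1: "continuous_on {s..s+1} (\<lambda>u. \<bar>D u \<omega>\<bar>)" if "\<omega> \<in> space M" for \<omega>
      by (intro continuous_intros D_cont that s)
    have 2: "L2 M (\<lambda>\<omega>. \<bar>D u \<omega>\<bar>)" if "u \<in> {s..s+1}" for u
      using D_L2[of u] that s by (auto simp: L2_def)
    have 3: "(\<integral>\<omega>. \<bar>D u \<omega>\<bar>\<^sup>2 \<partial>M) \<le> (Ld * y)\<^sup>2" if "u \<in> {s..s+1}" for u
      using Dy[of u] that s L2_square_le_iff[OF L(1), of M "D u"] by simp
    have "s \<le> s + 1" by simp
    note Q = drift_second_moment_const[where f = "\<lambda>u \<omega>. \<bar>D u \<omega>\<bar>", OF s this 1 2 3]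
    show "L2 M R" using Q(1) by (simp add: R_def[abs_def])
    show "(\<integral>\<omega>. (R \<omega>)\<^sup>2 \<partial>M) \<le> (Ld * y)\<^sup>2" using Q(2) by (simp add: R_def)
  qed
  define A1 where "A1 = {\<omega> \<in> space M. K \<le> \<bar>X s \<omega>\<bar>}"
  define A2 where "A2 = {\<omega> \<in> space M. K \<le> \<bar>R \<omega>\<bar>}"
  define A3 where "A3 = {\<omega> \<in> space M. \<exists>v\<in>{s..s+1}. K < \<bar>noise s v \<omega>\<bar>}"
  have [measurable]: "X s \<in> borel_measurable M" "R \<in> borel_measurable M"
    using X_measurable[OF s] RL by (auto simp: L2_def)
  have [measurable]: "A1 \<in> events" "A2 \<in> events" unfolding A1_def A2_def by measurable
  have A3[measurable]: "A3 \<in> events" unfolding A3_def by (rule noise_maximal(1)[OF s L(2) Gy K])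
  have "prob A1 \<le> (\<integral>\<omega>. (X s \<omega>)\<^sup>2 \<partial>M) / K\<^sup>2" unfolding A1_def by (rule L2_prob_bound[OF X_L2[OF s] K])
  also have "\<dots> \<le> y\<^sup>2 / K\<^sup>2"
    using xy(1)[of s] s L2_square_le_iff[OF y, of M "X s"] by (intro divide_right_mono) auto
  finally have 1: "prob A1 \<le> y\<^sup>2 / K\<^sup>2" .
  have "prob A2 \<le> (\<integral>\<omega>. (R \<omega>)\<^sup>2 \<partial>M) / K\<^sup>2" unfolding A2_def by (rule L2_prob_bound[OF RL(1) K])
  also have "\<dots> \<le> (Ld * y)\<^sup>2 / K\<^sup>2" using RL(2) by (intro divide_right_mono) auto
  finally have 2: "prob A2 \<le> (Ld * y)\<^sup>2 / K\<^sup>2" .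
  have 3: "prob A3 \<le> (Lg * y)\<^sup>2 / K\<^sup>2" unfolding A3_def by (rule noise_maximal(2)[OF s L(2) Gy K])
  have "prob (A1 \<union> A2 \<union> A3) \<le> prob A1 + prob A2 + prob A3"
    using measure_Un_le[of "A1 \<union> A2" M A3] measure_Un_le[of A1 M A2] by auto
  also have "\<dots> \<le> y\<^sup>2 / K\<^sup>2 + (Ld * y)\<^sup>2 / K\<^sup>2 + (Lg * y)\<^sup>2 / K\<^sup>2" using 1 2 3 by (intro add_mono)
  also have "\<dots> = (1 + Ld\<^sup>2 + Lg\<^sup>2) * y\<^sup>2 / K\<^sup>2"
    by (simp add: power_mult_distrib add_divide_distrib distrib_right)
  finally have P: "prob (A1 \<union> A2 \<union> A3) \<le> (1 + Ld\<^sup>2 + Lg\<^sup>2) * y\<^sup>2 / K\<^sup>2" .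
  show ?thesis
  proof (intro bexI[of _ "A1 \<union> A2 \<union> A3"] conjI P ballI)
    fix \<omega> t assume \<omega>: "\<omega> \<in> space M - (A1 \<union> A2 \<union> A3)" and t: "t \<in> {s..s+1}"
    have sp: "\<omega> \<in> space M" using \<omega> by simp
    have b1: "\<bar>X s \<omega>\<bar> < K" "\<bar>R \<omega>\<bar> < K" "\<bar>noise s t \<omega>\<bar> \<le> K"
      using \<omega> t by (auto simp: A1_def A2_def A3_def not_le not_less)
    have "\<bar>LINT u:{s..t}|lborel. D u \<omega>\<bar> \<le> R \<omega>"
    proof -
      have c: "continuous_on {s..s+1} (\<lambda>u. \<bar>D u \<omega>\<bar>)" by (intro continuous_intros D_cont sp s)
      have i: "set_integrable lborel {s..s+1} (\<lambda>u. \<bar>D u \<omega>\<bar>)" by (rule borel_integrable_atLeastAtMost'[OF c])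
      have j: "set_integrable lborel {s..t} (\<lambda>u. D u \<omega>)" by (intro borel_integrable_atLeastAtMost' D_cont sp s)
      have "\<bar>LINT u:{s..t}|lborel. D u \<omega>\<bar> \<le> (LINT u:{s..t}|lborel. \<bar>D u \<omega>\<bar>)"
        using set_integral_norm_bound[OF j] by simp
      also have "\<dots> \<le> R \<omega>"
        unfolding R_def set_lebesgue_integral_def
      proof (rule integral_mono)
        show "integrable lborel (\<lambda>u. indicator {s..t} u *\<^sub>R \<bar>D u \<omega>\<bar>)"
          using set_integrable_subset[OF i, of "{s..t}"] t unfolding set_integrable_def by auto
        show "integrable lborel (\<lambda>u. indicator {s..s+1} u *\<^sub>R \<bar>D u \<omega>\<bar>)"
          using i unfolding set_integrable_def .
        show "indicator {s..t} u *\<^sub>R \<bar>D u \<omega>\<bar> \<le> indicator {s..s+1} u *\<^sub>R \<bar>D u \<omega>\<bar>" for u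
          using t by (auto simp: indicator_def)
      qed
      finally show ?thesis .
    qed
    moreover have "X t \<omega> = noise s t \<omega> + X s \<omega> + (LINT u:{s..t}|lborel. D u \<omega>)" by (simp add: noise_def)
    ultimately show "\<bar>X t \<omega>\<bar> \<le> 3 * K" using b1 by linarith
  qed measurable
qed

end

text \<open>The constant only contributes \<open>ln C / ln t\<close>, which vanishes in the limit;
  zeros of \<open>f\<close> are harmless because \<open>elog\<close> is minus infinity
  there.\<close>

lemma Limsup_elog_le:
  fixes f :: "real \<Rightarrow> ennreal"
  assumes C: "C > 0" and f: "eventually (\<lambda>t. f t \<le> ennreal (C * t powr \<gamma>)) at_top"
  shows "Limsup at_top (\<lambda>t. elog (f t) / ereal (ln t)) \<le> ereal \<gamma>"
proof -
  have "Limsup at_top (\<lambda>t. elog (f t) / ereal (ln t)) \<le> Limsup at_top (\<lambda>t. ereal (ln C / ln t + \<gamma>))"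
  proof (rule Limsup_mono)
    show "eventually (\<lambda>t. elog (f t) / ereal (ln t) \<le> ereal (ln C / ln t + \<gamma>)) at_top"
      using f eventually_gt_at_top[of 1]
    proof eventually_elim
      case (elim t)
      have lt: "0 < ln t" using elim by simp
      show ?case
      proof (cases "f t")
        case (real x)
        show ?thesis
        proof (cases "x = 0")
          case True
          then show ?thesis using real lt by (simp add: elog_def)
        next
          case False
          then have x: "0 < x" using real by simp
          have pos: "0 < C * t powr \<gamma>" using C elim by simp
          have "x \<le> C * t powr \<gamma>" using elim real pos by simp
          then have "ln x \<le> ln (C * t powr \<gamma>)" using x pos by simp
          also have "\<dots> = ln C + \<gamma> * ln t" using C elim by (simp add: ln_mult ln_powr)
          finally have "ln x / ln t \<le> ln C / ln t + \<gamma>" using lt by (simp add: field_simps)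
          then show ?thesis using real x lt by (simp add: elog_def)
        qed
      next
        case top
        then show ?thesis using elim by (simp add: top_unique)
      qed
    qed
  qed
  also have "\<dots> = ereal \<gamma>"
  proof (rule lim_imp_Limsup)
    have "((\<lambda>t. ln C / ln t + \<gamma>) \<longlongrightarrow> 0 + \<gamma>) at_top"
      by (intro tendsto_add tendsto_const tendsto_divide_0[OF tendsto_const]
          filterlim_at_top_imp_at_infinity ln_at_top)
    then show "((\<lambda>t. ereal (ln C / ln t + \<gamma>)) \<longlongrightarrow> ereal \<gamma>) at_top" by simp
  qed simp
  finally show ?thesis .
qed

text \<open>Powers of comparable quantities are comparable. Adding the constants of both endpoints
  gives one formula for exponents of either sign.\<close>

lemma powr_le_scaled:
  fixes w \<rho> \<nu> \<beta> :: real
  assumes "0 < \<rho>" "0 < \<nu>" "\<rho> * \<nu> \<le> w" "w \<le> 3 * \<nu>"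
  shows "w powr \<beta> \<le> (3 powr \<beta> + \<rho> powr \<beta>) * \<nu> powr \<beta>"
proof (cases "0 \<le> \<beta>")
  case True
  have "0 < \<rho> * \<nu>" using assms by simp
  then have "0 \<le> w" using assms(3) by linarith
  then have "w powr \<beta> \<le> (3 * \<nu>) powr \<beta>"
    using assms True by (intro powr_mono2) auto
  also have "\<dots> = 3 powr \<beta> * \<nu> powr \<beta>" using assms by (simp add: powr_mult)
  also have "\<dots> \<le> (3 powr \<beta> + \<rho> powr \<beta>) * \<nu> powr \<beta>" by (intro mult_right_mono) auto
  finally show ?thesis .
next
  case False
  have "w powr \<beta> \<le> (\<rho> * \<nu>) powr \<beta>" using assms False by (intro powr_mono2') auto
  also have "\<dots> = \<rho> powr \<beta> * \<nu> powr \<beta>" using assms by (simp add: powr_mult)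
  also have "\<dots> \<le> (3 powr \<beta> + \<rho> powr \<beta>) * \<nu> powr \<beta>" by (intro mult_right_mono) auto
  finally show ?thesis .
qed

context pantograph
begin

lemma nn_second_moment: "0 \<le> t \<Longrightarrow> (\<integral>\<^sup>+\<omega>. ennreal (\<bar>X t \<omega>\<bar>\<^sup>2) \<partial>M) = ennreal ((x t)\<^sup>2)"
  using L2_nn_integral[OF X_L2] by (simp add: l2norm_sq)

lemma ms_growth:
  assumes C: "0 \<le> C" and bound: "\<And>t. 0 \<le> t \<Longrightarrow> (x t)\<^sup>2 \<le> C * (1 + t) powr \<beta>" and \<alpha>: "\<beta> \<le> \<alpha>"
  shows "ms_growth_le M X \<alpha>"
proof -
  \<comment> \<open>\<open>C\<close> may be zero, while a logarithm of the constant is taken later;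
    \<open>C + 1\<close> keeps it positive.\<close>
  define C' where "C' = (C + 1) * (3 powr \<beta> + 1 powr \<beta>)"
  have C': "C' > 0" using C by (simp add: C'_def add_nonneg_pos)
  have "eventually (\<lambda>t. (\<integral>\<^sup>+\<omega>. ennreal (\<bar>X t \<omega>\<bar>\<^sup>2) \<partial>M) \<le> ennreal (C' * t powr \<beta>)) at_top"
    using eventually_ge_at_top[of 1]
  proof eventually_elim
    case (elim t)
    have "(x t)\<^sup>2 \<le> C * (1 + t) powr \<beta>" using bound elim by simp
    also have "\<dots> \<le> (C + 1) * ((3 powr \<beta> + 1 powr \<beta>) * t powr \<beta>)"
      using C elim by (intro mult_mono powr_le_scaled) auto
    finally have "(x t)\<^sup>2 \<le> C' * t powr \<beta>" by (simp add: C'_def mult.assoc)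
    then show ?case using elim by (subst nn_second_moment) (auto intro: ennreal_leI)
  qed
  from Limsup_elog_le[OF C' this] show ?thesis
    unfolding ms_growth_le_def using \<alpha> by (meson ereal_less_eq(3) order_trans)
qed

text \<open>On the window starting at \<open>s k\<close> the level is (s k)^\<gamma> with 2\<gamma>
  = \<alpha> + 1, so the exceptional probability is of order (s k)^(\<beta> - \<alpha> - 1). The
  exponent is below -1 exactly because of the strict inequality \<beta> < \<alpha>.\<close>

lemma as_growth:
  assumes C: "0 \<le> C" and bound: "\<And>t. 0 \<le> t \<Longrightarrow> (x t)\<^sup>2 \<le> C * (1 + t) powr \<beta>" and \<alpha>: "\<beta> < \<alpha>"
  shows "as_growth_le M X ((\<alpha> + 1) / 2)"
proof -
  define \<gamma> where "\<gamma> = (\<alpha> + 1) / 2"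
  \<comment> \<open>The smallest delay factor, with 1 included for the undelayed argument. For times
    \<open>u\<close> of a window, \<open>1 + p * u\<close> then lies between
    \<open>\<rho> * s k\<close> and \<open>3 * s k\<close>, whatever the delay
    \<open>p\<close>.\<close>
  define \<rho> where "\<rho> = Min (insert 1 (q ` {1..n} \<union> r ` {1..m}))"
  have \<rho>pos: "0 < \<rho>" unfolding \<rho>_def using q r by (subst Min_gr_iff) auto
  have \<rho>mem: "\<rho> \<le> z" if "z \<in> insert 1 (q ` {1..n} \<union> r ` {1..m})" for z
    unfolding \<rho>_def by (rule Min_le[OF _ that]) simp
  have \<rho>le: "\<rho> \<le> 1" "\<And>i. i \<in> {1..n} \<Longrightarrow> \<rho> \<le> q i" "\<And>j. j \<in> {1..m} \<Longrightarrow> \<rho> \<le> r j"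
    by (rule \<rho>mem; blast)+
  define \<kappa> where "\<kappa> = 3 powr \<beta> + \<rho> powr \<beta>"
  have \<kappa>: "0 \<le> \<kappa>" by (simp add: \<kappa>_def)
  define s where "s k = real (Suc k)" for k
  have s1: "1 \<le> s k" for k by (simp add: s_def)
  define y where "y k = sqrt (C * (\<kappa> * s k powr \<beta>))" for k
  have y0: "0 \<le> y k" for k using C \<kappa> by (simp add: y_def)
  have xy: "x (p * u) \<le> y k" if u: "max 0 (s k - 1) \<le> u" "u \<le> s k + 1" and p: "\<rho> \<le> p" "p \<le> 1" for p u k
  proof -
    have pu: "0 \<le> p * u" "p * u \<le> u" using u p \<rho>pos by (auto intro!: mult_nonneg_nonneg mult_left_le_one_le)
    have "\<rho> * s k \<le> p * (1 + u)" using u p \<rho>pos s1[of k] by (intro mult_mono) auto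
    also have "\<dots> \<le> 1 + p * u" using p by (simp add: distrib_left)
    finally have lo: "\<rho> * s k \<le> 1 + p * u" .
    have hi: "1 + p * u \<le> 3 * s k" using pu u s1[of k] by linarith
    have "(x (p * u))\<^sup>2 \<le> C * (1 + p * u) powr \<beta>" using bound pu by simp
    also have "\<dots> \<le> C * (\<kappa> * s k powr \<beta>)"
      unfolding \<kappa>_def using C \<rho>pos s1[of k] lo hi by (intro mult_left_mono powr_le_scaled) auto
    finally show ?thesis unfolding y_def by (rule real_le_rsqrt)
  qed
  define Q where "Q = (1 + Ld\<^sup>2 + Lg\<^sup>2) * (C * \<kappa>)"
  have "\<exists>A\<in>events. prob A \<le> Q * s k powr (\<beta> - \<alpha> - 1) \<and>
      (\<forall>\<omega>\<in>space M - A. \<forall>t\<in>{s k..s k + 1}. \<bar>X t \<omega>\<bar> \<le> 3 * s k powr \<gamma>)" for k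
  proof -
    have K: "0 < s k powr \<gamma>" using s1[of k] by simp
    have x1: "x u \<le> y k" if "max 0 (s k - 1) \<le> u" "u \<le> s k + 1" for u
      using xy[OF that, of 1] \<rho>le(1) by simp
    have x2: "x (q i * u) \<le> y k" if "max 0 (s k - 1) \<le> u" "u \<le> s k + 1" "i \<in> {1..n}" for u i
      using xy[OF that(1,2), of "q i"] \<rho>le(2)[OF that(3)] q[OF that(3)] by simp
    have x3: "x (r j * u) \<le> y k" if "max 0 (s k - 1) \<le> u" "u \<le> s k + 1" "j \<in> {1..m}" for u j
      using xy[OF that(1,2), of "r j"] \<rho>le(3)[OF that(3)] r[OF that(3)] by simp
    have "0 \<le> s k" using s1[of k] by simp
    from window_prob_bound[OF this y0[of k] K x1 x2 x3]
    obtain A where A: "A \<in> events" "prob A \<le> (1 + Ld\<^sup>2 + Lg\<^sup>2) * (y k)\<^sup>2 / (s k powr \<gamma>)\<^sup>2"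
      "\<forall>\<omega>\<in>space M - A. \<forall>t\<in>{s k..s k + 1}. \<bar>X t \<omega>\<bar> \<le> 3 * s k powr \<gamma>" by blast
    have "(s k powr \<gamma>)\<^sup>2 = s k powr (\<alpha> + 1)"
    proof -
      have "\<gamma> + \<gamma> = \<alpha> + 1" by (simp add: \<gamma>_def)
      then show ?thesis by (simp add: power2_eq_square flip: powr_add)
    qed
    moreover have "(y k)\<^sup>2 = C * \<kappa> * s k powr \<beta>" using C \<kappa> by (simp add: y_def mult.assoc)
    moreover have "s k powr (\<beta> - \<alpha> - 1) = s k powr \<beta> / s k powr (\<alpha> + 1)"
      using s1[of k] by (simp add: diff_diff_eq flip: powr_diff)
    ultimately have "(1 + Ld\<^sup>2 + Lg\<^sup>2) * (y k)\<^sup>2 / (s k powr \<gamma>)\<^sup>2 = Q * s k powr (\<beta> - \<alpha> - 1)"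
      by (simp add: Q_def)
    then show ?thesis using A by auto
  qed
  then have "\<forall>k. \<exists>A. A \<in> events \<and> prob A \<le> Q * s k powr (\<beta> - \<alpha> - 1) \<and>
      (\<forall>\<omega>\<in>space M - A. \<forall>t\<in>{s k..s k + 1}. \<bar>X t \<omega>\<bar> \<le> 3 * s k powr \<gamma>)" by blast
  from choice[OF this] obtain A where A: "\<And>k. A k \<in> events" "\<And>k. prob (A k) \<le> Q * s k powr (\<beta> - \<alpha> - 1)"
    "\<And>k \<omega> t. \<omega> \<in> space M - A k \<Longrightarrow> t \<in> {s k..s k + 1} \<Longrightarrow> \<bar>X t \<omega>\<bar> \<le> 3 * s k powr \<gamma>" by blast
  have "summable (\<lambda>k. prob (A k))"
  proof (rule summable_comparison_test')
    have "summable (\<lambda>k. real k powr (\<beta> - \<alpha> - 1))" using \<alpha> by (subst summable_real_powr_iff) simp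
    then have "summable (\<lambda>k. real (Suc k) powr (\<beta> - \<alpha> - 1))" by (subst summable_Suc_iff)
    then show "summable (\<lambda>k. Q * s k powr (\<beta> - \<alpha> - 1))" unfolding s_def by (rule summable_mult)
    show "norm (prob (A k)) \<le> Q * s k powr (\<beta> - \<alpha> - 1)" if "0 \<le> k" for k using A(2)[of k] by simp
  qed
  then have "AE \<omega> in M. eventually (\<lambda>k. \<omega> \<in> space M - A k) sequentially"
    by (intro borel_cantelli_AE1 A(1)) (auto simp: less_top[symmetric])
  then show ?thesis
    unfolding as_growth_le_def \<gamma>_def[symmetric]
  proof eventually_elim
    case (elim \<omega>)
    then obtain k0 where k0: "\<And>k. k \<ge> k0 \<Longrightarrow> \<omega> \<in> space M - A k" by (auto simp: eventually_sequentially)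
    \<comment> \<open>The window start lies between \<open>t / 2\<close> and \<open>t\<close>; this
      accounts for the factors 1/2 and, generously, 3.\<close>
    define C' where "C' = 3 * (3 powr \<gamma> + (1 / 2) powr \<gamma>)"
    have C': "C' > 0" by (simp add: C'_def add_pos_pos)
    have "eventually (\<lambda>t. ennreal \<bar>X t \<omega>\<bar> \<le> ennreal (C' * t powr \<gamma>)) at_top"
      using eventually_ge_at_top[of "real k0 + 2"]
    proof eventually_elim
      case (elim t)
      \<comment> \<open>Windows start at \<open>s k = Suc k\<close>, so the one containing
        \<open>t\<close> has index \<open>\<lfloor>t\<rfloor> - 1\<close>.\<close>
      define k where "k = nat \<lfloor>t\<rfloor> - 1"
      have t2: "2 \<le> t" using elim by simp
      have fl: "2 \<le> \<lfloor>t\<rfloor>" "int k0 + 2 \<le> \<lfloor>t\<rfloor>" using elim by (simp_all add: le_floor_iff)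
      have sk: "s k = of_int \<lfloor>t\<rfloor>" using fl by (simp add: s_def k_def)
      have tk: "t \<in> {s k..s k + 1}" unfolding sk by (simp add: floor_le_iff)
      have kk: "k \<ge> k0" using fl by (simp add: k_def)
      have "\<bar>X t \<omega>\<bar> \<le> 3 * s k powr \<gamma>" by (rule A(3)[OF k0[OF kk] tk])
      also have "\<dots> \<le> 3 * ((3 powr \<gamma> + (1 / 2) powr \<gamma>) * t powr \<gamma>)"
        using tk t2 s1[of k] by (intro mult_left_mono powr_le_scaled) auto
      also have "\<dots> = C' * t powr \<gamma>" by (simp add: C'_def)
      finally show ?case by (rule ennreal_leI)
    qed
    from Limsup_elog_le[OF C' this] show ?case .
  qed
qed

end

section \<open>Choice of the exponent and the three cases\<close>

lemma pantographI:
  assumes "prob_space M" "brownian_motion M B"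
    and "\<forall>i\<in>{1..n}. 0 < q i \<and> q i < 1" "\<forall>j\<in>{1..m}. 0 < r j \<and> r j < 1"
    and "(X0, X) \<in> pantograph_solutions_L4 M B a n b q \<sigma> m \<sigma>' r"
  shows "pantograph M (gen_filtration M X0 B) B X0 X a n b q \<sigma> m \<sigma>' r"
proof -
  interpret prob_space M by fact
  have ip: "indep_of_process M X0 B"
    and m4: "(\<integral>\<^sup>+ \<omega>. ennreal (\<bar>X0 \<omega>\<bar> ^ 4) \<partial>M) < \<infinity>"
    and sol: "pantograph_solution M B a n b q \<sigma> m \<sigma>' r X0 X"
    using assms(5) by (auto simp: pantograph_solutions_L4_def)
  have X0m[measurable]: "X0 \<in> borel_measurable M" using ip by (simp add: indep_of_process_def)
  \<comment> \<open>The second moment is finite because x^2 is at most 1 + x^4.\<close>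
  have "(\<integral>\<^sup>+ \<omega>. ennreal ((X0 \<omega>)\<^sup>2) \<partial>M) \<le> (\<integral>\<^sup>+ \<omega>. 1 + ennreal (\<bar>X0 \<omega>\<bar> ^ 4) \<partial>M)"
  proof (rule nn_integral_mono)
    fix \<omega>
    have "(X0 \<omega>)\<^sup>2 \<le> 1 + \<bar>X0 \<omega>\<bar> ^ 4"
    proof -
      have "0 \<le> ((X0 \<omega>)\<^sup>2 - 1)\<^sup>2" by simp
      then have "2 * (X0 \<omega>)\<^sup>2 \<le> 1 + (X0 \<omega>) ^ 4" by (simp add: power2_diff flip: power_mult)
      then show ?thesis by (simp add: power_even_abs) (use zero_le_power2[of "X0 \<omega>"] in linarith)
    qed
    then have "ennreal ((X0 \<omega>)\<^sup>2) \<le> ennreal (1 + \<bar>X0 \<omega>\<bar> ^ 4)" by (rule ennreal_leI)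
    also have "\<dots> = 1 + ennreal (\<bar>X0 \<omega>\<bar> ^ 4)" by (subst ennreal_plus) auto
    finally show "ennreal ((X0 \<omega>)\<^sup>2) \<le> 1 + ennreal (\<bar>X0 \<omega>\<bar> ^ 4)" .
  qed
  also have "\<dots> = 1 + (\<integral>\<^sup>+ \<omega>. ennreal (\<bar>X0 \<omega>\<bar> ^ 4) \<partial>M)"
    by (subst nn_integral_add) (auto simp: emeasure_space_1)
  also have "\<dots> < \<infinity>" using m4 by (simp add: less_top)
  finally have X0L: "L2 M X0" using L2_iff_nn_integral[OF X0m] by simp
  interpret brownian_filtration M "gen_filtration M X0 B" B
    by (rule brownian_filtrationI[OF assms(1,2) ip])
  show ?thesis
    by unfold_locales (use sol X0L assms(3,4) in \<open>auto simp: pantograph_solution_def\<close>)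
qed

text \<open>
  Both exponents are read off one supersolution \<open>(1 + t) powr \<beta>\<close>; Borel-Cantelli costs the strict
  inequality \<open>\<beta> < \<alpha>\<close> in the almost sure bound.
\<close>

lemma pantograph_growth:
  assumes M: "prob_space M" "brownian_motion M B"
    and qr: "\<forall>i\<in>{1..n}. 0 < q i \<and> q i < 1" "\<forall>j\<in>{1..m}. 0 < r j \<and> r j < 1"
    and t0: "0 \<le> t0"
    and pq: "\<And>i t. i \<in> {1..n} \<Longrightarrow> t0 \<le> t \<Longrightarrow> ((1 + q i * t) / (1 + t)) powr (\<beta> / 2) \<le> pq i"
    and pr: "\<And>j t. j \<in> {1..m} \<Longrightarrow> t0 \<le> t \<Longrightarrow> ((1 + r j * t) / (1 + t)) powr (\<beta> / 2) \<le> pr j"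
    and rate: "\<And>t. t0 \<le> t \<Longrightarrow>
      2 * a + 2 * (\<Sum>i=1..n. \<bar>b i\<bar> * pq i) + (\<bar>\<sigma>\<bar> + (\<Sum>j=1..m. \<bar>\<sigma>' j\<bar> * pr j))\<^sup>2 < \<beta> / (1 + t)"
  shows "ms_poly_bound M (pantograph_solutions_L4 M B a n b q \<sigma> m \<sigma>' r) \<beta>"
    "\<beta> \<le> \<alpha> \<Longrightarrow> (X0, X) \<in> pantograph_solutions_L4 M B a n b q \<sigma> m \<sigma>' r \<Longrightarrow> ms_growth_le M X \<alpha>"
    "\<beta> < \<alpha> \<Longrightarrow> (X0, X) \<in> pantograph_solutions_L4 M B a n b q \<sigma> m \<sigma>' r \<Longrightarrow> as_growth_le M X ((\<alpha> + 1) / 2)"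
proof -
  \<comment> \<open>Fixed before any solution is chosen: this is the uniformity over initial values
    that \<open>ms_poly_bound\<close> demands.\<close>
  define C where "C = a_priori_const a n b \<sigma> m \<sigma>' t0 * max 1 ((1 + t0) powr (- \<beta>))"
  have C: "C > 0" unfolding C_def using a_priori_const_pos by (intro mult_pos_pos) auto
  have bound: "l2norm M (X t) ^ 2 \<le> C * (\<integral>\<omega>. (X0 \<omega>)\<^sup>2 \<partial>M) * (1 + t) powr \<beta>"
    if "(X0, X) \<in> pantograph_solutions_L4 M B a n b q \<sigma> m \<sigma>' r" "0 \<le> t" for X0 X t
  proof -
    interpret pantograph M "gen_filtration M X0 B" B X0 X a n b q \<sigma> m \<sigma>' r
      by (rule pantographI[OF M qr that(1)])
    show ?thesis unfolding C_def by (rule mean_square_bound[OF t0 pq pr rate that(2)])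
  qed
  show "ms_poly_bound M (pantograph_solutions_L4 M B a n b q \<sigma> m \<sigma>' r) \<beta>"
    unfolding ms_poly_bound_def
  proof (intro exI[of _ C] conjI C ballI, clarify)
    fix X0 X and t :: real
    assume S: "(X0, X) \<in> pantograph_solutions_L4 M B a n b q \<sigma> m \<sigma>' r" and t: "0 \<le> t"
    interpret pantograph M "gen_filtration M X0 B" B X0 X a n b q \<sigma> m \<sigma>' r
      by (rule pantographI[OF M qr S])
    have "(\<integral>\<^sup>+ \<omega>. ennreal (\<bar>X t \<omega>\<bar>\<^sup>2) \<partial>M) \<le> ennreal (C * (\<integral>\<omega>. (X0 \<omega>)\<^sup>2 \<partial>M) * (1 + t) powr \<beta>)"
      unfolding nn_second_moment[OF t] by (intro ennreal_leI bound S t)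
    also have "\<dots> = ennreal C * ennreal (\<integral>\<omega>. (X0 \<omega>)\<^sup>2 \<partial>M) * ennreal ((1 + t) powr \<beta>)"
      using C by (simp add: ennreal_mult)
    also have "ennreal (\<integral>\<omega>. (X0 \<omega>)\<^sup>2 \<partial>M) = (\<integral>\<^sup>+ \<omega>. ennreal (\<bar>X0 \<omega>\<bar>\<^sup>2) \<partial>M)"
      using L2_nn_integral[OF X0_L2] by simp
    finally show "(\<integral>\<^sup>+ \<omega>. ennreal (\<bar>X t \<omega>\<bar>\<^sup>2) \<partial>M) \<le>
      ennreal C * (\<integral>\<^sup>+ \<omega>. ennreal (\<bar>X0 \<omega>\<bar>\<^sup>2) \<partial>M) * ennreal ((1 + t) powr \<beta>)" .
  qed
  show "ms_growth_le M X \<alpha>" if "\<beta> \<le> \<alpha>" and S: "(X0, X) \<in> pantograph_solutions_L4 M B a n b q \<sigma> m \<sigma>' r"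
  proof -
    interpret pantograph M "gen_filtration M X0 B" B X0 X a n b q \<sigma> m \<sigma>' r
      by (rule pantographI[OF M qr S])
    show ?thesis using ms_growth[OF _ bound[OF S] that(1)] C by simp
  qed
  show "as_growth_le M X ((\<alpha> + 1) / 2)"
    if "\<beta> < \<alpha>" and S: "(X0, X) \<in> pantograph_solutions_L4 M B a n b q \<sigma> m \<sigma>' r"
  proof -
    interpret pantograph M "gen_filtration M X0 B" B X0 X a n b q \<sigma> m \<sigma>' r
      by (rule pantographI[OF M qr S])
    show ?thesis using as_growth[OF _ bound[OF S] that(1)] C by simp
  qed
qed

text \<open>The ratio decreases in \<open>t\<close> and has the value (1 + p)/2 at
  \<open>t = 1\<close>. A bound below 1 uniformly in \<open>t\<close> requires staying away from 0,
  where the ratio is 1.\<close>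

lemma delay_ratio_ge_one:
  fixes p t :: real
  assumes "0 < p" "p < 1" "1 \<le> t"
  shows "(1 + p * t) / (1 + t) \<le> (1 + p) / 2"
proof -
  have "0 \<le> (1 - p) * (t - 1)" using assms by simp
  then show ?thesis using assms by (simp add: field_simps)
qed

text \<open>The ratio never falls below its limit \<open>p\<close>, and a nonpositive power reverses
  the order.\<close>

lemma delay_ratio_powr_le:
  fixes p t \<beta> :: real
  assumes "0 < p" "p < 1" "0 \<le> t" "\<beta> \<le> 0"
  shows "((1 + p * t) / (1 + t)) powr \<beta> \<le> p powr \<beta>"
proof (rule powr_mono2')
  show "p \<le> (1 + p * t) / (1 + t)" using assms by (simp add: field_simps)
qed (use assms in auto)

text \<open>With \<open>\<beta>0 = 0\<close> the hypothesis is the condition of (ii), with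
  \<open>\<beta>0 = - 1\<close> that of (iii). Both are strict and continuous in the exponent, so
  they persist slightly below \<open>\<beta>0\<close>, which yields the strict inequality for
  \<beta>.\<close>

lemma pantograph_growth_negative:
  fixes q r b \<sigma>' :: "nat \<Rightarrow> real"
  assumes M: "prob_space M" "brownian_motion M B"
    and qr: "\<forall>i\<in>{1..n}. 0 < q i \<and> q i < 1" "\<forall>j\<in>{1..m}. 0 < r j \<and> r j < 1"
    and \<beta>0: "\<beta>0 \<le> 0"
    and neg: "2 * a + 2 * (\<Sum>i=1..n. \<bar>b i\<bar> * q i powr (\<beta>0 / 2)) + (\<bar>\<sigma>\<bar> + (\<Sum>j=1..m. \<bar>\<sigma>' j\<bar> * r j powr (\<beta>0 / 2)))\<^sup>2 < 0"
  shows "\<exists>\<beta><\<beta>0. ms_poly_bound M (pantograph_solutions_L4 M B a n b q \<sigma> m \<sigma>' r) \<beta> \<and>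
    (\<forall>\<alpha>\<ge>\<beta>. \<forall>(X0, X) \<in> pantograph_solutions_L4 M B a n b q \<sigma> m \<sigma>' r. ms_growth_le M X \<alpha>) \<and>
    (\<forall>\<alpha>>\<beta>. \<forall>(X0, X) \<in> pantograph_solutions_L4 M B a n b q \<sigma> m \<sigma>' r. as_growth_le M X ((\<alpha> + 1) / 2))"
proof -
  define \<Lambda> where "\<Lambda> \<beta> = 2 * a + 2 * (\<Sum>i=1..n. \<bar>b i\<bar> * q i powr (\<beta> / 2)) +
    (\<bar>\<sigma>\<bar> + (\<Sum>j=1..m. \<bar>\<sigma>' j\<bar> * r j powr (\<beta> / 2)))\<^sup>2" for \<beta>
  have q0: "q i \<noteq> 0" if "i \<in> {1..n}" for i using bspec[OF qr(1) that] by simp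
  have r0: "r j \<noteq> 0" if "j \<in> {1..m}" for j using bspec[OF qr(2) that] by simp
  have "(\<Lambda> \<longlongrightarrow> \<Lambda> \<beta>0) (at_left \<beta>0)"
    unfolding \<Lambda>_def by (intro tendsto_intros) (use q0 r0 in auto)
  then have "eventually (\<lambda>\<beta>. \<Lambda> \<beta> < 0) (at_left \<beta>0)"
    by (rule order_tendstoD(2)) (use neg in \<open>simp add: \<Lambda>_def\<close>)
  moreover have "eventually (\<lambda>\<beta>. \<beta> < \<beta>0) (at_left \<beta>0)" by (simp add: eventually_at_filter)
  ultimately have "eventually (\<lambda>\<beta>. \<Lambda> \<beta> < 0 \<and> \<beta> < \<beta>0) (at_left \<beta>0)" by eventually_elim simp
  then obtain \<beta> where \<beta>: "\<Lambda> \<beta> < 0" "\<beta> < \<beta>0" using eventually_happens'[OF trivial_limit_at_left_real] by blast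
  have \<beta>neg: "\<beta> < 0" using \<beta>(2) \<beta>0 by simp
  \<comment> \<open>A quotient of two negative numbers: past this time \<beta> / (1 + t) has risen
    above the fixed negative rate \<open>\<Lambda> \<beta>\<close>.\<close>
  define t0 where "t0 = \<beta> / \<Lambda> \<beta>"
  have t0: "0 \<le> t0" using \<beta> \<beta>neg by (simp add: t0_def divide_nonpos_neg)
  have pq: "((1 + q i * t) / (1 + t)) powr (\<beta> / 2) \<le> q i powr (\<beta> / 2)" if "i \<in> {1..n}" "t0 \<le> t" for i t
    using that qr t0 \<beta>neg by (intro delay_ratio_powr_le) auto
  have pr: "((1 + r j * t) / (1 + t)) powr (\<beta> / 2) \<le> r j powr (\<beta> / 2)" if "j \<in> {1..m}" "t0 \<le> t" for j t
    using that qr t0 \<beta>neg by (intro delay_ratio_powr_le) auto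
  have rate: "\<Lambda> \<beta> < \<beta> / (1 + t)" if t: "t0 \<le> t" for t
  proof -
    have "\<beta> / \<Lambda> \<beta> < 1 + t" using t by (simp add: t0_def)
    then have "(1 + t) * \<Lambda> \<beta> < \<beta>" using \<beta>(1) by (simp add: neg_divide_less_eq)
    then show ?thesis using t t0 by (simp add: pos_less_divide_eq mult.commute)
  qed
  note g = pantograph_growth[OF M qr t0 pq pr rate[unfolded \<Lambda>_def]]
  show ?thesis by (intro exI[of _ \<beta>] conjI allI impI ballI \<beta>(2) g(1)) (auto intro: g(2,3))
qed

text \<open>From time 1 on the delay ratios are bounded by constants below 1, so a high power makes
  all delayed terms negligible and only the instantaneous rate
  \<open>2 * a + \<sigma>\<^sup>2\<close> is left. The slope of the supersolution is nonnegative, so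
  a negative rate suffices.\<close>

lemma pantograph_growth_positive:
  fixes q r b \<sigma>' :: "nat \<Rightarrow> real"
  assumes M: "prob_space M" "brownian_motion M B"
    and qr: "\<forall>i\<in>{1..n}. 0 < q i \<and> q i < 1" "\<forall>j\<in>{1..m}. 0 < r j \<and> r j < 1"
    and neg: "2 * a + \<sigma>\<^sup>2 < 0"
  shows "\<exists>\<beta>. ms_poly_bound M (pantograph_solutions_L4 M B a n b q \<sigma> m \<sigma>' r) \<beta> \<and>
    (\<forall>\<alpha>\<ge>\<beta>. \<forall>(X0, X) \<in> pantograph_solutions_L4 M B a n b q \<sigma> m \<sigma>' r. ms_growth_le M X \<alpha>) \<and>
    (\<forall>\<alpha>>\<beta>. \<forall>(X0, X) \<in> pantograph_solutions_L4 M B a n b q \<sigma> m \<sigma>' r. as_growth_le M X ((\<alpha> + 1) / 2))"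
proof -
  define \<Lambda> where "\<Lambda> k = 2 * a + 2 * (\<Sum>i=1..n. \<bar>b i\<bar> * ((1 + q i) / 2) ^ k) +
    (\<bar>\<sigma>\<bar> + (\<Sum>j=1..m. \<bar>\<sigma>' j\<bar> * ((1 + r j) / 2) ^ k))\<^sup>2" for k :: nat
  have pow: "(\<lambda>k. ((1 + p) / 2) ^ k) \<longlonglongrightarrow> 0" if "0 < p \<and> p < 1" for p :: real
    using that by (intro LIMSEQ_realpow_zero) auto
  have "\<Lambda> \<longlonglongrightarrow> 2 * a + 2 * (\<Sum>i=1..n. \<bar>b i\<bar> * 0) + (\<bar>\<sigma>\<bar> + (\<Sum>j=1..m. \<bar>\<sigma>' j\<bar> * 0))\<^sup>2"
    unfolding \<Lambda>_def using qr by (intro tendsto_intros pow) auto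
  then have "eventually (\<lambda>k. \<Lambda> k < 0) sequentially"
    by (rule order_tendstoD(2)) (use neg in simp)
  then obtain k where k: "\<Lambda> k < 0" by (auto simp: eventually_sequentially)
  define \<beta> where "\<beta> = 2 * real k"
  have p: "((1 + p * t) / (1 + t)) powr (\<beta> / 2) \<le> ((1 + p) / 2) ^ k" if "0 < p \<and> p < 1" "1 \<le> t" for p t :: real
  proof -
    have "0 \<le> (1 + p * t) / (1 + t)" using that by (intro divide_nonneg_nonneg add_nonneg_nonneg) auto
    then have "((1 + p * t) / (1 + t)) powr (\<beta> / 2) \<le> ((1 + p) / 2) powr (\<beta> / 2)"
      using that by (intro powr_mono2 delay_ratio_ge_one) (auto simp: \<beta>_def)
    also have "\<dots> = ((1 + p) / 2) ^ k" using that by (simp add: \<beta>_def powr_realpow)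
    finally show ?thesis .
  qed
  have pq: "((1 + q i * t) / (1 + t)) powr (\<beta> / 2) \<le> ((1 + q i) / 2) ^ k" if "i \<in> {1..n}" "1 \<le> t" for i t
    using that qr by (intro p) auto
  have pr: "((1 + r j * t) / (1 + t)) powr (\<beta> / 2) \<le> ((1 + r j) / 2) ^ k" if "j \<in> {1..m}" "1 \<le> t" for j t
    using that qr by (intro p) auto
  have rate: "\<Lambda> k < \<beta> / (1 + t)" if "1 \<le> t" for t
  proof -
    have "0 \<le> \<beta> / (1 + t)" using that by (simp add: \<beta>_def)
    then show ?thesis using k by linarith
  qed
  note g = pantograph_growth[OF M qr zero_le_one pq pr rate[unfolded \<Lambda>_def]]
  show ?thesis by (intro exI[of _ \<beta>] conjI allI impI ballI g(1)) (auto intro: g(2,3))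
qed

theorem theorem8:
  fixes M :: "'w measure" and B :: "real \<Rightarrow> 'w \<Rightarrow> real"
    and n m :: nat
    and a \<sigma> :: real
    and b q \<sigma>' r :: "nat \<Rightarrow> real"
  assumes "prob_space M"
    and "brownian_motion M B"
    and "n \<ge> 1" and "m \<ge> 1"
    and "\<forall>i\<in>{1..n}. 0 < q i \<and> q i < 1" and "inj_on q {1..n}"
    and "\<forall>j\<in>{1..m}. 0 < r j \<and> r j < 1" and "inj_on r {1..m}"
  shows
    "(2 * a + \<sigma>\<^sup>2 < 0 \<longrightarrow>
        (\<exists>\<alpha>. \<forall>(X0, X) \<in> pantograph_solutions_L4 M B a n b q \<sigma> m \<sigma>' r.
            ms_growth_le M X \<alpha> \<and> as_growth_le M X ((\<alpha> + 1) / 2)) \<and>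
        ms_poly_bounded M (pantograph_solutions_L4 M B a n b q \<sigma> m \<sigma>' r) \<and>
        as_poly_bounded M (pantograph_solutions_L4 M B a n b q \<sigma> m \<sigma>' r)) \<and>
     (2 * a + 2 * (\<Sum>i=1..n. \<bar>b i\<bar>) + (\<bar>\<sigma>\<bar> + (\<Sum>j=1..m. \<bar>\<sigma>' j\<bar>))\<^sup>2 < 0 \<longrightarrow>
        (\<exists>\<alpha><0. \<forall>(X0, X) \<in> pantograph_solutions_L4 M B a n b q \<sigma> m \<sigma>' r.
            ms_growth_le M X \<alpha>) \<and>
        ms_poly_stable M (pantograph_solutions_L4 M B a n b q \<sigma> m \<sigma>' r)) \<and>
     (2 * a + 2 * (\<Sum>i=1..n. \<bar>b i\<bar> / sqrt (q i))
          + (\<bar>\<sigma>\<bar> + (\<Sum>j=1..m. \<bar>\<sigma>' j\<bar> / sqrt (r j)))\<^sup>2 < 0 \<longrightarrow>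
        (\<exists>\<alpha>< - 1. \<forall>(X0, X) \<in> pantograph_solutions_L4 M B a n b q \<sigma> m \<sigma>' r.
            ms_growth_le M X \<alpha> \<and> as_growth_le M X ((\<alpha> + 1) / 2)) \<and>
        ms_poly_stable M (pantograph_solutions_L4 M B a n b q \<sigma> m \<sigma>' r) \<and>
        as_poly_stable M (pantograph_solutions_L4 M B a n b q \<sigma> m \<sigma>' r))"
proof (intro conjI impI)
  note M = assms(1,2) and qr = assms(5,7)
  let ?S = "pantograph_solutions_L4 M B a n b q \<sigma> m \<sigma>' r"
  {
    assume neg: "2 * a + \<sigma>\<^sup>2 < 0"
    obtain \<beta> where \<beta>: "ms_poly_bound M ?S \<beta>"
      "\<forall>\<alpha>\<ge>\<beta>. \<forall>(X0, X) \<in> ?S. ms_growth_le M X \<alpha>"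
      "\<forall>\<alpha>>\<beta>. \<forall>(X0, X) \<in> ?S. as_growth_le M X ((\<alpha> + 1) / 2)"
      using pantograph_growth_positive[OF M qr neg] by blast
    have ms: "\<forall>(X0, X) \<in> ?S. ms_growth_le M X (\<beta> + 1)"
      \<comment> \<open>Any exponent above \<beta> would do for (A) and (B) together;
        \<open>\<beta> + 1\<close> leaves the gap that the almost sure bound requires.\<close>
      using spec[OF \<beta>(2), of "\<beta> + 1"] by (simp only: le_add_same_cancel1 zero_le_one simp_thms)
    have as: "\<forall>(X0, X) \<in> ?S. as_growth_le M X ((\<beta> + 1 + 1) / 2)"
      using spec[OF \<beta>(3), of "\<beta> + 1"] by (simp only: less_add_same_cancel1 zero_less_one simp_thms)
    show "\<exists>\<alpha>. \<forall>(X0, X)\<in>?S. ms_growth_le M X \<alpha> \<and> as_growth_le M X ((\<alpha> + 1) / 2)"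
      using ms as by (intro exI[of _ "\<beta> + 1"]) blast
    show "ms_poly_bounded M ?S" unfolding ms_poly_bounded_def using \<beta>(1) by blast
    show "as_poly_bounded M ?S" unfolding as_poly_bounded_def using as by blast
  next
    assume neg: "2 * a + 2 * (\<Sum>i=1..n. \<bar>b i\<bar>) + (\<bar>\<sigma>\<bar> + (\<Sum>j=1..m. \<bar>\<sigma>' j\<bar>))\<^sup>2 < 0"
    have "\<bar>b i\<bar> * q i powr (0 / 2) = \<bar>b i\<bar>" if "i \<in> {1..n}" for i using bspec[OF qr(1) that] by simp
    then have 1: "(\<Sum>i=1..n. \<bar>b i\<bar> * q i powr (0 / 2)) = (\<Sum>i=1..n. \<bar>b i\<bar>)" by (rule sum.cong[OF refl])
    have "\<bar>\<sigma>' j\<bar> * r j powr (0 / 2) = \<bar>\<sigma>' j\<bar>" if "j \<in> {1..m}" for j using bspec[OF qr(2) that] by simp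
    then have 2: "(\<Sum>j=1..m. \<bar>\<sigma>' j\<bar> * r j powr (0 / 2)) = (\<Sum>j=1..m. \<bar>\<sigma>' j\<bar>)" by (rule sum.cong[OF refl])
    have neg': "2 * a + 2 * (\<Sum>i=1..n. \<bar>b i\<bar> * q i powr (0 / 2)) +
      (\<bar>\<sigma>\<bar> + (\<Sum>j=1..m. \<bar>\<sigma>' j\<bar> * r j powr (0 / 2)))\<^sup>2 < 0" unfolding 1 2 by (rule neg)
    obtain \<beta> where \<beta>: "\<beta> < 0" "ms_poly_bound M ?S \<beta>" "\<forall>\<alpha>\<ge>\<beta>. \<forall>(X0, X) \<in> ?S. ms_growth_le M X \<alpha>"
      using pantograph_growth_negative[OF M qr order_refl neg'] by blast
    show "\<exists>\<alpha><0. \<forall>(X0, X)\<in>?S. ms_growth_le M X \<alpha>" using \<beta>(1,3) by blast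
    show "ms_poly_stable M ?S" unfolding ms_poly_stable_def using \<beta>(1,2) by blast
  next
    assume neg: "2 * a + 2 * (\<Sum>i=1..n. \<bar>b i\<bar> / sqrt (q i)) +
      (\<bar>\<sigma>\<bar> + (\<Sum>j=1..m. \<bar>\<sigma>' j\<bar> / sqrt (r j)))\<^sup>2 < 0"
    have pw: "c * p powr (- 1 / 2) = c / sqrt p" if "0 < p \<and> p < 1" for c p :: real
      using that by (simp add: powr_minus_divide powr_half_sqrt)
    have 1: "(\<Sum>i=1..n. \<bar>b i\<bar> * q i powr (- 1 / 2)) = (\<Sum>i=1..n. \<bar>b i\<bar> / sqrt (q i))"
      by (rule sum.cong[OF refl pw[OF bspec[OF qr(1)]]])
    have 2: "(\<Sum>j=1..m. \<bar>\<sigma>' j\<bar> * r j powr (- 1 / 2)) = (\<Sum>j=1..m. \<bar>\<sigma>' j\<bar> / sqrt (r j))"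
      by (rule sum.cong[OF refl pw[OF bspec[OF qr(2)]]])
    have neg': "2 * a + 2 * (\<Sum>i=1..n. \<bar>b i\<bar> * q i powr (- 1 / 2)) +
      (\<bar>\<sigma>\<bar> + (\<Sum>j=1..m. \<bar>\<sigma>' j\<bar> * r j powr (- 1 / 2)))\<^sup>2 < 0" unfolding 1 2 by (rule neg)
    have "(- 1 :: real) \<le> 0" by simp
    then obtain \<beta> where \<beta>: "\<beta> < - 1" "ms_poly_bound M ?S \<beta>"
      "\<forall>\<alpha>\<ge>\<beta>. \<forall>(X0, X) \<in> ?S. ms_growth_le M X \<alpha>"
      "\<forall>\<alpha>>\<beta>. \<forall>(X0, X) \<in> ?S. as_growth_le M X ((\<alpha> + 1) / 2)"
      using pantograph_growth_negative[OF M qr _ neg'] by blast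
    \<comment> \<open>The midpoint of \<beta> and -1: above \<beta>, as the almost sure bound
      requires, and still below -1, so that \<open>(\<alpha> + 1) / 2\<close> is negative.\<close>
    define \<alpha> where "\<alpha> = (\<beta> - 1) / 2"
    have \<alpha>: "\<alpha> < - 1" "\<beta> < \<alpha>" "\<beta> \<le> \<alpha>" using \<beta>(1) by (auto simp: \<alpha>_def)
    have ms: "\<forall>(X0, X) \<in> ?S. ms_growth_le M X \<alpha>" using \<beta>(3) \<alpha>(3) by blast
    have as: "\<forall>(X0, X) \<in> ?S. as_growth_le M X ((\<alpha> + 1) / 2)" using \<beta>(4) \<alpha>(2) by blast
    show "\<exists>\<alpha>< - 1. \<forall>(X0, X)\<in>?S. ms_growth_le M X \<alpha> \<and> as_growth_le M X ((\<alpha> + 1) / 2)"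
      using ms as \<alpha>(1) by blast
    have "\<beta> < 0" using \<beta>(1) by simp
    then show "ms_poly_stable M ?S" unfolding ms_poly_stable_def using \<beta>(2) by blast
    have "(\<alpha> + 1) / 2 < 0" using \<alpha> by simp
    then show "as_poly_stable M ?S" unfolding as_poly_stable_def using as by blast
  }
qed

end
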